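(* Let $m\in\mathbb Z^+$ and $\mathcal D_{2m}=\{(z,w)\in\mathbb C^2:|z|^2+|w|^{2m}<1\}$. For $w\in\mathbb D=\{|w|<1\}$ set $$r:=\frac{m-1}{m+2},\qquad t:=\frac{1-|w|^2}{1-r|w|^2}.$$ Then the Fefferman--Szegő metric at $(0,w)$ is $$g_{\mathrm{FS}}^{\mathcal D_{2m}}(0,w)=\begin{pmatrix}\dfrac{\alpha(t)}{t(1+2r)}&0\\ 0&\beta(t)\,\dfrac{(1-rt)^2}{t^2(1-r)^2}\end{pmatrix},\qquad \alpha(t):=2+rt+rt^2,\quad \beta(t):=2-rt^2.$$ Moreover, the Ricci curvature at $(0,w)$ is diagonal and has the form $$\mathrm{Ric}_{\mathrm{FS}}^{\mathcal D_{2m}}(0,w)=\begin{pmatrix}-\dfrac{2A(t)+4\alpha(t)}{t\alpha(t)(1+2r)}+\dfrac{B(t)}{(2r+1)t(2-rt^2)}+\dfrac{C(t)}{t\alpha(t)(1+2r)}&0\\ 0&D(t)+E(t)+F(t)\end{pmatrix},$$ where $$\begin{aligned}A(t)&=-r^2t^4+(3r^2+2r)t^3+2r^2t^2-2,\\ B(t)&=-2r^2t^4+(r+r^2)t^3+2(1+r)t-4,\\ C(t)&=(1-t)(1-rt)(2-rt^2),\end{aligned}$$ and $$\begin{aligned}D(t)&=\frac{-2t^2(1-r)^2(2-r^2t^2)-8t(1-r)(1-t)(2-r^3t^3)-6(1-t)^2(2-r^4t^4)}{t^2(1-r)^2(2-rt^2)},\\ E(t)&=\frac{4(1-t)(1-rt)(2-r^2t^3)^2}{t^2(1-r)^2(2-rt^2)^2},\\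 F(t)&=-\frac{(1-rt)^2(2-rt^2)}{(1-r)t\alpha(t)}-\frac{2(1-t)(1-rt)^2(2-r^2t^3)}{(1-r)^2t^2\alpha(t)}+\frac{(1-t)(1-rt)^3(2-rt^2)^2}{(1-r)^2t^2\alpha(t)^2}.\end{aligned}$$
   Context: Put $\rho(z,w)=|z|^2+|w|^{2m}-1$ and let $\sigma_{\mathrm E}$ be the Euclidean surface measure on $\partial\mathcal D_{2m}$. The Fefferman surface area measure is $d\sigma_{\mathrm F}=\varpi_{\mathrm F}\,d\sigma_{\mathrm E}$ with $$\varpi_{\mathrm F}=\frac1{|d\rho|}\left|\det\begin{pmatrix}\rho&\partial_{\bar j}\rho\\ \partial_i\rho&\partial_i\partial_{\bar j}\rho\end{pmatrix}_{1\le i,j\le 2}\right|^{\frac13},\qquad |d\rho|=\big(|\partial_z\rho|^2+|\partial_w\rho|^2\big)^{1/2},$$ i.e. $\varpi_{\mathrm F}(z,w)=\dfrac{(m^2|w|^{2m-2})^{1/3}}{\sqrt{|z|^2+m^2|w|^{4m-2}}}$ on $\partial\mathcal D_{2m}$. For $\xi\in\partial\mathcal D_{2m}$ let $\nu_\xi$ be the outward unit normal and let $\delta_\xi(z)$ be the minimum of the Euclidean distances from $z$ to $\partial\mathcal D_{2m}$ and to the tangent plane of $\partial\mathcal D_{2m}$ at $\xi$. For $\alpha>0$ let $\Gamma_\alpha(\xi)=\{z\in\mathcal D_{2m}:|(\xi-z)\cdot\overline{\nu_\xi}|<(1+\alpha)\delta_\xi(z),\ |\xi-z|^2<\alpha\delta_\xi(z)\}$,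 where $\cdot$ is the complex bilinear dot product, and let $\mathcal N(f)(\xi)=\sup_{z\in\Gamma_\alpha(\xi)}|f(z)|$. The Fefferman--Hardy space $\mathrm H^2_{\mathrm F}(\partial\mathcal D_{2m})$ is the set of holomorphic $f$ on $\mathcal D_{2m}$ with $\mathcal N(f)\in L^2(\partial\mathcal D_{2m},\sigma_{\mathrm F})$. Each such $f$ has a non-tangential boundary value $f^*$ $\sigma_{\mathrm F}$-a.e., and with the norm $\big(\int|f^*|^2d\sigma_{\mathrm F}\big)^{1/2}$ the space is a reproducing kernel Hilbert space. Its reproducing kernel $S_{\mathcal D_{2m}}(\zeta,\eta)$, satisfying $f(\zeta)=\int_{\partial\mathcal D_{2m}}S_{\mathcal D_{2m}}(\zeta,\xi)f^*(\xi)\,d\sigma_{\mathrm F}(\xi)$, is the Fefferman--Szegő kernel; write $S_{\mathcal D_{2m}}(\zeta)=S_{\mathcal D_{2m}}(\zeta,\zeta)$. The Fefferman--Szegő metric $g_{\mathrm{FS}}^{\mathcal D_{2m}}$ is the Kähler metric with components $g_{i\bar j}=\partial_i\partial_{\bar j}\log S_{\mathcal D_{2m}}$ in the coordinates $(z_1,z_2)=(z,w)$; it is identified with the matrix $(g_{i\bar j})$. Its Ricci curvature $\mathrm{Ric}_{\mathrm{FS}}^{\mathcal D_{2m}}$ is identified with the matrix of components $\mathrm{Ric}_{i\bar j}=-\partial_i\partial_{\bar j}\log\det(g_{k\bar l})$. *)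

theory Defs
  imports "HOL-Analysis.Analysis"
begin

section \<open>Complex analysis on \<open>\<complex>\<^sup>2\<close>\<close>

text \<open>
  \<open>\<complex>\<^sup>2\<close> is \<^typ>\<open>complex^2\<close>, with \<open>z = p $ 1\<close> and \<open>w = p $ 2\<close>. Its library norm and its library
  inner product (which is real) are those of \<open>\<real>\<^sup>4\<close>.
\<close>

definition wirtinger :: "2 \<Rightarrow> (complex^2 \<Rightarrow> complex) \<Rightarrow> complex^2 \<Rightarrow> complex" where
  "wirtinger i f p =
     (vector_derivative (\<lambda>x::real. f (p + x *\<^sub>R axis i 1)) (at 0)
      - \<i> * vector_derivative (\<lambda>y::real. f (p + y *\<^sub>R axis i \<i>)) (at 0)) / 2"

definition wirtinger_bar :: "2 \<Rightarrow> (complex^2 \<Rightarrow> complex) \<Rightarrow> complex^2 \<Rightarrow> complex" where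
  "wirtinger_bar i f p =
     (vector_derivative (\<lambda>x::real. f (p + x *\<^sub>R axis i 1)) (at 0)
      + \<i> * vector_derivative (\<lambda>y::real. f (p + y *\<^sub>R axis i \<i>)) (at 0)) / 2"

text \<open>The library's \<open>holomorphic_on\<close> is for functions of one complex variable.\<close>

definition holomorphic2_on :: "(complex^2 \<Rightarrow> complex) \<Rightarrow> (complex^2) set \<Rightarrow> bool" where
  "holomorphic2_on f U \<longleftrightarrow>
     (\<forall>p\<in>U. \<exists>a b. (f has_derivative (\<lambda>h. a * h $ 1 + b * h $ 2)) (at p within U))"

definition bilinear_dot :: "complex^2 \<Rightarrow> complex^2 \<Rightarrow> complex" where
  "bilinear_dot x y = (\<Sum>i\<in>UNIV. x $ i * y $ i)"


section \<open>The domain and its defining function\<close>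

definition ellipsoid :: "nat \<Rightarrow> (complex^2) set" where
  "ellipsoid m = {p. (cmod (p $ 1))\<^sup>2 + cmod (p $ 2) ^ (2 * m) < 1}"

definition rho :: "nat \<Rightarrow> complex^2 \<Rightarrow> complex" where
  "rho m p = of_real ((cmod (p $ 1))\<^sup>2 + cmod (p $ 2) ^ (2 * m) - 1)"

text \<open>
  The real gradient of \<open>\<rho>\<close>, read as a vector of \<open>\<complex>\<^sup>2\<close>, has the components
  \<open>\<partial>\<rho>/\<partial>x\<^sub>i + \<i> \<partial>\<rho>/\<partial>y\<^sub>i = 2 wirtinger_bar i \<rho>\<close>; the factor 2 goes away on normalising.
\<close>

definition outward_normal :: "nat \<Rightarrow> complex^2 \<Rightarrow> complex^2" where
  "outward_normal m \<xi> = sgn (\<chi> i. wirtinger_bar i (rho m) \<xi>)"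

definition tangent_plane :: "nat \<Rightarrow> complex^2 \<Rightarrow> (complex^2) set" where
  "tangent_plane m \<xi> = {x. (x - \<xi>) \<bullet> outward_normal m \<xi> = 0}"


section \<open>Surface measures\<close>

text \<open>The factor by which \<open>\<Phi>\<close> changes \<open>n\<close>-dimensional area: the square root of the Gram determinant.\<close>

definition area_factor :: "(real^'n \<Rightarrow> 'a::euclidean_space) \<Rightarrow> real^'n \<Rightarrow> real" where
  "area_factor \<Phi> u =
     sqrt (det (\<chi> i j. frechet_derivative \<Phi> (at u) (axis i 1) \<bullet> frechet_derivative \<Phi> (at u) (axis j 1)))"

definition surface_measure ::
  "'a::euclidean_space set \<Rightarrow> (real^'n) set \<Rightarrow> (real^'n \<Rightarrow> 'a) \<Rightarrow> 'a measure" where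
  "surface_measure M U \<Phi> =
     distr (density (restrict_space lborel U) (\<lambda>u. ennreal (area_factor \<Phi> u))) (restrict_space borel M) \<Phi>"

text \<open>
  The boundary is parametrized by \<open>s = |w|\<close> and by the arguments of \<open>z\<close> and \<open>w\<close>. The lemma
  \<open>bij_betw_boundary_param\<close> below says that this is one-to-one and reaches every boundary point
  apart from the two circles \<open>z = 0\<close> and \<open>w = 0\<close>, which carry no surface area.
\<close>

definition boundary_param :: "nat \<Rightarrow> real^3 \<Rightarrow> complex^2" where
  "boundary_param m u =
     vector [of_real (sqrt (1 - (u $ 1) ^ (2 * m))) * cis (u $ 2), of_real (u $ 1) * cis (u $ 3)]"

definition param_domain :: "(real^3) set" where
  "param_domain = {u. u $ 1 \<in> {0<..<1} \<and> u $ 2 \<in> {0..<2 * pi} \<and> u $ 3 \<in> {0..<2 * pi}}"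

definition sigma_E :: "nat \<Rightarrow> (complex^2) measure" where
  "sigma_E m = surface_measure (frontier (ellipsoid m)) param_domain (boundary_param m)"

definition fefferman_matrix :: "nat \<Rightarrow> complex^2 \<Rightarrow> complex^3^3" where
  "fefferman_matrix m p =
     (let \<rho> = rho m; d = wirtinger; d' = wirtinger_bar in
      vector [vector [\<rho> p,     d' 1 \<rho> p,         d' 2 \<rho> p],
              vector [d 1 \<rho> p, d 1 (d' 1 \<rho>) p,  d 1 (d' 2 \<rho>) p],
              vector [d 2 \<rho> p, d 2 (d' 1 \<rho>) p,  d 2 (d' 2 \<rho>) p]])"

definition fefferman_weight :: "nat \<Rightarrow> complex^2 \<Rightarrow> real" where
  "fefferman_weight m p =
     1 / sqrt ((cmod (wirtinger 1 (rho m) p))\<^sup>2 + (cmod (wirtinger 2 (rho m) p))\<^sup>2)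
     * root 3 (cmod (det (fefferman_matrix m p)))"

definition sigma_F :: "nat \<Rightarrow> (complex^2) measure" where
  "sigma_F m = density (sigma_E m) (\<lambda>p. ennreal (fefferman_weight m p))"


section \<open>The Fefferman--Hardy space and the Fefferman--Szego kernel\<close>

definition approach_dist :: "nat \<Rightarrow> complex^2 \<Rightarrow> complex^2 \<Rightarrow> real" where
  "approach_dist m \<xi> p = min (infdist p (frontier (ellipsoid m))) (infdist p (tangent_plane m \<xi>))"

definition approach_region :: "nat \<Rightarrow> real \<Rightarrow> complex^2 \<Rightarrow> (complex^2) set" where
  "approach_region m a \<xi> =
     {p \<in> ellipsoid m.
        cmod (bilinear_dot (\<xi> - p) (\<chi> i. cnj (outward_normal m \<xi> $ i))) < (1 + a) * approach_dist m \<xi> p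
        \<and> (norm (\<xi> - p))\<^sup>2 < a * approach_dist m \<xi> p}"

definition nt_maximal :: "nat \<Rightarrow> real \<Rightarrow> (complex^2 \<Rightarrow> complex) \<Rightarrow> complex^2 \<Rightarrow> ennreal" where
  "nt_maximal m a f \<xi> = (SUP p\<in>approach_region m a \<xi>. ennreal (cmod (f p)))"

definition hardy_space :: "nat \<Rightarrow> real \<Rightarrow> (complex^2 \<Rightarrow> complex) set" where
  "hardy_space m a =
     {f. holomorphic2_on f (ellipsoid m)
         \<and> nt_maximal m a f \<in> borel_measurable (sigma_F m)
         \<and> (\<integral>\<^sup>+ \<xi>. (nt_maximal m a f \<xi>)\<^sup>2 \<partial>sigma_F m) < \<infinity>}"

text \<open>\<open>g\<close> is (a representative of) the non-tangential boundary value \<open>f\<^sup>*\<close>.\<close>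

definition nt_boundary_value ::
  "nat \<Rightarrow> real \<Rightarrow> (complex^2 \<Rightarrow> complex) \<Rightarrow> (complex^2 \<Rightarrow> complex) \<Rightarrow> bool" where
  "nt_boundary_value m a f g \<longleftrightarrow>
     g \<in> borel_measurable (sigma_F m)
     \<and> (AE \<xi> in sigma_F m. (f \<longlongrightarrow> g \<xi>) (at \<xi> within approach_region m a \<xi>))"

text \<open>
  In the reproducing formula the second argument of \<open>S\<close> runs through the boundary: the values
  of \<open>S \<zeta>\<close> there are its non-tangential boundary values. The kernel function
  \<open>S(\<cdot>, \<zeta>)\<close>, which is the complex conjugate of \<open>S(\<zeta>, \<cdot>)\<close>, is the one that lies in the space.
\<close>

definition fefferman_szego_kernel ::
  "nat \<Rightarrow> real \<Rightarrow> (complex^2 \<Rightarrow> complex^2 \<Rightarrow> complex) \<Rightarrow> bool" where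
  "fefferman_szego_kernel m a S \<longleftrightarrow>
     (\<forall>\<zeta>\<in>ellipsoid m.
        (\<lambda>\<eta>. cnj (S \<zeta> \<eta>)) \<in> hardy_space m a
        \<and> nt_boundary_value m a (S \<zeta>) (S \<zeta>)
        \<and> (\<forall>f\<in>hardy_space m a. \<forall>g. nt_boundary_value m a f g \<longrightarrow>
              f \<zeta> = (\<integral>\<xi>. S \<zeta> \<xi> * g \<xi> \<partial>sigma_F m)))"


section \<open>The Fefferman--Szego metric and its Ricci curvature\<close>

definition fs_metric :: "(complex^2 \<Rightarrow> complex^2 \<Rightarrow> complex) \<Rightarrow> complex^2 \<Rightarrow> complex^2^2" where
  "fs_metric S p = (\<chi> i j. wirtinger i (wirtinger_bar j (\<lambda>q. Ln (S q q))) p)"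

definition fs_ricci :: "(complex^2 \<Rightarrow> complex^2 \<Rightarrow> complex) \<Rightarrow> complex^2 \<Rightarrow> complex^2^2" where
  "fs_ricci S p = (\<chi> i j. - wirtinger i (wirtinger_bar j (\<lambda>q. Ln (det (fs_metric S q)))) p)"


section \<open>The boundary and its parametrization\<close>

lemma frontier_ellipsoid:
  assumes "m \<ge> 1"
  shows "frontier (ellipsoid m) = {p. (cmod (p $ 1))\<^sup>2 + cmod (p $ 2) ^ (2 * m) = 1}"
proof -
  define f :: "complex^2 \<Rightarrow> real" where "f p = (cmod (p $ 1))\<^sup>2 + cmod (p $ 2) ^ (2 * m)" for p
  have cont: "continuous_on UNIV f"
    unfolding f_def
    by (intro continuous_on_add continuous_on_power continuous_on_norm continuous_on_component continuous_on_id)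
  have op: "open (ellipsoid m)"
    unfolding ellipsoid_def f_def [symmetric] by (rule open_Collect_less [OF cont continuous_on_const])
  have "closed {p. f p \<le> 1}"
    by (rule closed_Collect_le [OF cont continuous_on_const])
  then have "closure (ellipsoid m) \<subseteq> {p. f p \<le> 1}"
    by (intro closure_minimal) (auto simp: ellipsoid_def f_def)
  moreover have "p \<in> closure (ellipsoid m)" if p: "f p \<le> 1" for p
  proof (rule Lim_in_closed_set [OF closed_closure])
    define c where "c n = 1 - inverse (real (Suc n))" for n
    have c: "0 \<le> c n" "c n < 1" for n
      unfolding c_def by (simp_all add: inverse_le_1_iff del: of_nat_Suc)
    have "(\<lambda>n. c n *\<^sub>R p) \<longlonglongrightarrow> (1 - 0) *\<^sub>R p"
      unfolding c_def by (intro tendsto_scaleR tendsto_diff tendsto_const LIMSEQ_inverse_real_of_nat)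
    then show "(\<lambda>n. c n *\<^sub>R p) \<longlonglongrightarrow> p" by simp
    have "c n *\<^sub>R p \<in> ellipsoid m" for n
    proof -
      have "c n ^ (2 * m) \<le> c n ^ 2"
        using c assms by (intro power_decreasing) (auto intro: less_imp_le)
      then have le: "c n ^ (2 * m) * cmod (p $ 2) ^ (2 * m) \<le> c n ^ 2 * cmod (p $ 2) ^ (2 * m)"
        by (intro mult_right_mono) auto
      have scale: "f (d *\<^sub>R p) = d ^ 2 * (cmod (p $ 1))\<^sup>2 + d ^ (2 * m) * cmod (p $ 2) ^ (2 * m)"
        if "0 \<le> d" for d
        using that by (simp add: f_def power_mult_distrib)
      have "f (c n *\<^sub>R p) \<le> c n ^ 2 * (cmod (p $ 1))\<^sup>2 + c n ^ 2 * cmod (p $ 2) ^ (2 * m)"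
        using le by (simp only: scale [OF c(1)] add_le_cancel_left)
      also have "\<dots> = c n ^ 2 * f p"
        by (simp only: f_def distrib_left)
      also have "\<dots> \<le> c n ^ 2"
        by (rule mult_left_le [OF p]) simp
      also have "\<dots> < 1"
        using c by (simp add: power_less_one_iff)
      finally show ?thesis by (simp add: ellipsoid_def f_def)
    qed
    then show "\<forall>\<^sub>F n in sequentially. c n *\<^sub>R p \<in> closure (ellipsoid m)"
      using closure_subset by (auto intro!: always_eventually)
  qed simp
  ultimately have "closure (ellipsoid m) = {p. f p \<le> 1}" by blast
  moreover have "interior (ellipsoid m) = {p. f p < 1}"
    using op by (simp add: interior_open ellipsoid_def f_def)
  ultimately have "frontier (ellipsoid m) = {p. f p = 1}"
    unfolding frontier_def by force
  then show ?thesis by (simp only: f_def)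
qed

lemma bij_betw_boundary_param:
  assumes m: "m \<ge> 1"
  shows "bij_betw (boundary_param m) param_domain
           {p \<in> frontier (ellipsoid m). p $ 1 \<noteq> 0 \<and> p $ 2 \<noteq> 0}"
proof -
  have cis_eq: "x = y" if "cis x = cis y" "x \<in> {0..<2*pi}" "y \<in> {0..<2*pi}" for x y
    using that Arg2pi_unique [of 1 x "cis x"] Arg2pi_unique [of 1 y "cis y"]
    by (simp add: cis_conv_exp)
  have bound: "0 < u $ 1 ^ (2*m)" "u $ 1 ^ (2*m) < 1" if "u \<in> param_domain" for u
    using that m by (auto simp: param_domain_def power_less_one_iff)
  show ?thesis
  proof (rule bij_betwI')
    fix u v assume u: "u \<in> param_domain" and v: "v \<in> param_domain"
    show "(boundary_param m u = boundary_param m v) = (u = v)"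
    proof
      assume eq: "boundary_param m u = boundary_param m v"
      from arg_cong[OF eq, of "\<lambda>p. p $ 2"]
      have 2: "of_real (u $ 1) * cis (u $ 3) = of_real (v $ 1) * cis (v $ 3)"
        by (simp add: boundary_param_def)
      from arg_cong[OF this, of cmod] have s: "u $ 1 = v $ 1"
        using u v by (simp add: norm_mult param_domain_def)
      have 3: "u $ 3 = v $ 3"
        using 2 s u v by (intro cis_eq) (auto simp: param_domain_def)
      from arg_cong[OF eq, of "\<lambda>p. p $ 1"]
      have "cis (u $ 2) = cis (v $ 2)"
        using s bound[OF u] bound[OF v] by (simp add: boundary_param_def)
      then have "u $ 2 = v $ 2"
        using u v by (intro cis_eq) (auto simp: param_domain_def)
      with s 3 show "u = v" by (simp add: vec_eq_iff forall_3)
    qed simp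
  next
    fix u assume u: "u \<in> param_domain"
    then show "boundary_param m u \<in> {p \<in> frontier (ellipsoid m). p $ 1 \<noteq> 0 \<and> p $ 2 \<noteq> 0}"
      using bound[OF u] m
      by (auto simp: frontier_ellipsoid boundary_param_def norm_mult param_domain_def)
  next
    fix p assume p: "p \<in> {p \<in> frontier (ellipsoid m). p $ 1 \<noteq> 0 \<and> p $ 2 \<noteq> 0}"
    define u :: "real^3" where "u = vector [cmod (p $ 2), Arg2pi (p $ 1), Arg2pi (p $ 2)]"
    have e: "(cmod (p $ 1))\<^sup>2 + cmod (p $ 2) ^ (2*m) = 1"
      using p m by (auto simp: frontier_ellipsoid)
    have "(cmod (p $ 1))\<^sup>2 > 0" using p by simp
    with e have "cmod (p $ 2) ^ (2*m) < 1" by linarith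
    then have "cmod (p $ 2) < 1"
      using m by (simp add: power_less_one_iff)
    then have "u \<in> param_domain"
      using p Arg2pi by (auto simp: u_def param_domain_def)
    moreover have "sqrt (1 - cmod (p $ 2) ^ (2*m)) = cmod (p $ 1)"
      using e by (intro real_sqrt_unique) auto
    then have "p = boundary_param m u"
      using Arg2pi_eq[of "p $ 1"] Arg2pi_eq[of "p $ 2"]
      by (simp add: u_def boundary_param_def vec_eq_iff forall_2 cis_conv_exp)
    ultimately show "\<exists>u\<in>param_domain. p = boundary_param m u" by blast
  qed
qed

end

theory Submission
  imports Defs "HOL-Complex_Analysis.Cauchy_Integral_Formula"
begin

text \<open>
  The monomials \<open>z\<^sup>j w\<^sup>k\<close> are orthogonal for \<open>\<sigma>\<^sub>F\<close>, which is the torus-invariant measure with density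
  \<open>m\<^bsup>2/3\<^esup> s\<^bsup>(2m+1)/3\<^esup> ds d\<theta> d\<phi>\<close> in the coordinates \<open>s = |w|\<close>, \<open>\<theta> = arg z\<close>, \<open>\<phi> = arg w\<close>; their norms are Beta integrals.
  Testing the reproducing formula against monomials, and approaching the boundary along radii with
  the non-tangential maximal function as dominating function, determines all Taylor coefficients of
  \<open>S(\<cdot>, \<zeta>)\<close>. Summing the series gives, up to a constant factor,
  \<open>S(\<zeta>, \<zeta>) = (1 - |z|\<^sup>2)\<^bsup>-(4m+2)/(3m)\<^esup> (1 - r u) / (1 - u)\<^sup>2\<close> with \<open>u = |w|\<^sup>2 (1 - |z|\<^sup>2)\<^bsup>-1/m\<^esup>\<close>.
  For a potential \<open>- \<kappa> log (1 - |z|\<^sup>2) + L(u)\<close> the determinant of the complex Hessian is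
  \<open>(1 - |z|\<^sup>2)\<^bsup>-2-1/m\<^esup> (\<kappa> + u L'(u) / m) (L'(u) + u L''(u))\<close>, so its logarithm is a potential of the same form.
\<close>

section \<open>Wirtinger derivatives and the defining function\<close>

text \<open>The kernel enters only through the predicate \<open>fefferman_szego_kernel\<close>, so
  every property of \<open>S\<close> has to be extracted from the reproducing formula. The obstacle
  is that this formula sees \<open>S \<zeta>\<close> only on the boundary, while the metric needs it
  inside; the two are tied only by limits in the approach regions. Hence the dilates f(r \<xi>),
  whose integrals reduce to Taylor coefficients, and a radius beyond which all radial segments lie
  in their approach regions, uniformly in \<xi>. The exponents come from the moments: the Beta
  integrals have base b_k = k/m + (m + 2)/(3m), summation over j gives (1 - |z|^2)^(-b_k - 1), and
  the part linear in k turns |w|^2 into u. The number r = (m - 1)/(m + 2) appears on summing the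
  remaining factor b_k u^k over k. Although the statement concerns z = 0, the potentials are needed
  on the whole domain, because the Hessian also differentiates in z. On the axis u = |w|^2, and t is
  its image under the involution y -> (1 - y)/(1 - r y), in which 1 - u and 1 - r u acquire the
  common denominator 1 - r t.\<close>

definition has_wirtinger :: "(complex^2 \<Rightarrow> complex) \<Rightarrow> complex^2 \<Rightarrow> 2 \<Rightarrow> complex \<Rightarrow> complex \<Rightarrow> bool" where
  "has_wirtinger f p i A B \<longleftrightarrow>
     ((\<lambda>c. f (p + axis i c)) has_derivative (\<lambda>h. A * h + B * cnj h)) (at 0)"

text \<open>The directions 1 and \<i> turn A h + B cnj h into A + B and \<i> (A - B), from which the
  two defining combinations recover \<open>A\<close> and \<open>B\<close>. Asking for the full
  derivative in the slot \<open>i\<close>, rather than for two line derivatives, makes the product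
  and chain rules available.\<close>

lemma has_wirtinger_imp:
  assumes "has_wirtinger f p i A B"
  shows "wirtinger i f p = A" "wirtinger_bar i f p = B"
proof -
  have line: "((\<lambda>x::real. f (p + x *\<^sub>R axis i v)) has_vector_derivative (A * v + B * cnj v)) (at 0)" for v
  proof -
    have "((\<lambda>x::real. x *\<^sub>R v) has_derivative (\<lambda>x. x *\<^sub>R v)) (at 0)"
      by (auto intro!: derivative_eq_intros)
    then have "((\<lambda>x::real. f (p + axis i (x *\<^sub>R v))) has_derivative
        (\<lambda>x. A * (x *\<^sub>R v) + B * cnj (x *\<^sub>R v))) (at 0)"
      by (rule has_derivative_compose [where g = "\<lambda>c. f (p + axis i c)"])
         (use assms in \<open>simp add: has_wirtinger_def\<close>)
    moreover have "axis i (x *\<^sub>R v) = x *\<^sub>R axis i v" for x :: real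
      by (simp add: axis_def vec_eq_iff)
    ultimately show ?thesis
      by (simp add: has_vector_derivative_def scaleR_conv_of_real algebra_simps)
  qed
  note vd = vector_derivative_at [OF line [of 1]] vector_derivative_at [OF line [of \<i>]]
  show "wirtinger i f p = A" "wirtinger_bar i f p = B"
    unfolding wirtinger_def wirtinger_bar_def vd by (simp_all add: algebra_simps)
qed

text \<open>Closed formulas for the kernel and its potentials hold only inside the domain; since a
  derivative is local, they may still be differentiated there.\<close>

lemma has_wirtinger_cong:
  assumes "has_wirtinger f p i A B" and "open U" "p \<in> U" and "\<And>q. q \<in> U \<Longrightarrow> g q = f q"
  shows "has_wirtinger g p i A B"
proof -
  have ax: "continuous_on UNIV (\<lambda>c. p + axis i c)"
  proof -
    have "continuous_on UNIV (\<lambda>c::complex. \<chi> j. (p + axis i c) $ j)"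
      proof (intro continuous_on_vec_lambda)
      fix j show "continuous_on UNIV (\<lambda>c::complex. (p + axis i c) $ j)"
        by (cases "j = i") (auto simp: axis_def intro!: continuous_intros)
    qed
    then show ?thesis by (simp only: vec_lambda_eta)
  qed
  have "open ((\<lambda>c. p + axis i c) -` U)"
    using continuous_open_vimage[OF assms(2), of "\<lambda>c. p + axis i c"] ax
    by (simp add: continuous_on_eq_continuous_at)
  moreover have "0 \<in> (\<lambda>c. p + axis i c) -` U"
    using assms(3) by (simp add: axis_def vec_eq_iff plus_vec_def)
  ultimately have "eventually (\<lambda>c. c \<in> (\<lambda>c. p + axis i c) -` U) (nhds 0)"
    by (rule eventually_nhds_in_open)
  then show ?thesis
    using assms(1) unfolding has_wirtinger_def
    apply (rule_tac has_derivative_transform_eventually [where f = "\<lambda>c. f (p + axis i c)"])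
      apply (auto simp: eventually_at_filter assms(4) elim!: eventually_mono)
    using \<open>0 \<in> (\<lambda>c. p + axis i c) -` U\<close> assms(4) by auto
qed

section \<open>Explicit derivatives of the defining function\<close>

lemma rho_altdef: "rho m p = p $ 1 * cnj (p $ 1) + (p $ 2 * cnj (p $ 2)) ^ m - 1"
  by (simp add: rho_def complex_norm_square [symmetric] power_mult)

lemma axis_simps [simp]:
  "axis (1::2) c $ 1 = c" "axis (1::2) c $ 2 = 0" "axis (2::2) c $ 1 = 0" "axis (2::2) c $ 2 = c"
  by (simp_all add: axis_def)

lemma has_wirtinger_rho_1: "has_wirtinger (rho m) p 1 (cnj (p $ 1)) (p $ 1)"
  unfolding has_wirtinger_def rho_altdef
  by (auto intro!: derivative_eq_intros simp: algebra_simps)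

lemma has_wirtinger_rho_2:
  assumes "m \<ge> 1"
  shows "has_wirtinger (rho m) p 2
     (of_nat m * cnj (p $ 2) * (p $ 2 * cnj (p $ 2)) ^ (m - 1)) (of_nat m * p $ 2 * (p $ 2 * cnj (p $ 2)) ^ (m - 1))"
  unfolding has_wirtinger_def rho_altdef
  by (auto intro!: derivative_eq_intros simp: algebra_simps)

lemmas wirtinger_rho_1 = has_wirtinger_imp [OF has_wirtinger_rho_1]
lemmas wirtinger_rho_2 = has_wirtinger_imp [OF has_wirtinger_rho_2]

lemma wirtinger_rho_second:
  assumes "m \<ge> 1"
  shows "wirtinger 1 (wirtinger_bar 1 (rho m)) p = 1"
    "wirtinger 2 (wirtinger_bar 1 (rho m)) p = 0"
    "wirtinger 1 (wirtinger_bar 2 (rho m)) p = 0"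
    "wirtinger 2 (wirtinger_bar 2 (rho m)) p = of_nat m ^ 2 * (p $ 2 * cnj (p $ 2)) ^ (m - 1)"
proof -
  have 1: "wirtinger_bar 1 (rho m) = (\<lambda>p. p $ 1)"
    by (rule ext) (simp add: wirtinger_rho_1)
  \<comment> \<open>Separating the powers of w and of its conjugate lets the second differentiation
    treat them as a holomorphic and an antiholomorphic factor.\<close>
  have 2: "wirtinger_bar 2 (rho m) = (\<lambda>p. of_nat m * p $ 2 ^ m * cnj (p $ 2) ^ (m - 1))"
  proof (rule ext)
    fix p :: "complex^2"
    have "p $ 2 ^ m = p $ 2 * p $ 2 ^ (m - 1)"
      using assms by (metis Suc_diff_1 less_eq_Suc_le One_nat_def power_Suc)
    then show "wirtinger_bar 2 (rho m) p = of_nat m * p $ 2 ^ m * cnj (p $ 2) ^ (m - 1)"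
      using assms by (simp add: wirtinger_rho_2 power_mult_distrib)
  qed
  have "has_wirtinger (\<lambda>p. p $ 1) p 1 1 0" "has_wirtinger (\<lambda>p. p $ 1) p 2 0 0"
    "has_wirtinger (\<lambda>p. of_nat m * p $ 2 ^ m * cnj (p $ 2) ^ (m - 1)) p 1 0 0"
    by (auto simp: has_wirtinger_def intro!: derivative_eq_intros)
  \<comment> \<open>For m = 1 the truncated exponent m - 1 - 1 is harmless: its coefficient
    \<open>of_nat (m - 1)\<close> is 0.\<close>
  moreover have "has_wirtinger (\<lambda>p. of_nat m * p $ 2 ^ m * cnj (p $ 2) ^ (m - 1)) p 2
      (of_nat m ^ 2 * (p $ 2 * cnj (p $ 2)) ^ (m - 1))
      (of_nat m * p $ 2 ^ m * (of_nat (m - 1) * cnj (p $ 2) ^ (m - 1 - 1)))"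
    unfolding has_wirtinger_def
    by (auto intro!: derivative_eq_intros simp: algebra_simps power_mult_distrib power2_eq_square)
  ultimately show "wirtinger 1 (wirtinger_bar 1 (rho m)) p = 1"
    "wirtinger 2 (wirtinger_bar 1 (rho m)) p = 0"
    "wirtinger 1 (wirtinger_bar 2 (rho m)) p = 0"
    "wirtinger 2 (wirtinger_bar 2 (rho m)) p = of_nat m ^ 2 * (p $ 2 * cnj (p $ 2)) ^ (m - 1)"
    unfolding 1 2 by (auto dest: has_wirtinger_imp)
qed

lemma fefferman_weight_boundary:
  assumes "m \<ge> 1" "p \<in> frontier (ellipsoid m)"
  shows "fefferman_weight m p =
    root 3 ((real m)\<^sup>2 * cmod (p $ 2) ^ (2 * m - 2)) / sqrt ((cmod (p $ 1))\<^sup>2 + (real m)\<^sup>2 * cmod (p $ 2) ^ (4 * m - 2))"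
proof -
  have e: "(cmod (p $ 1))\<^sup>2 + cmod (p $ 2) ^ (2 * m) = 1"
    using assms by (simp add: frontier_ellipsoid)
  have e': "p $ 1 * cnj (p $ 1) + (p $ 2 * cnj (p $ 2)) ^ m = 1"
    using arg_cong [OF e, of complex_of_real]
    by (simp add: complex_norm_square [symmetric] power_mult)
  then have rho0: "rho m p = 0" by (simp add: rho_altdef)
  define x where "x = p $ 2 * cnj (p $ 2)"
  have x: "x = of_real ((cmod (p $ 2))\<^sup>2)" by (simp only: x_def complex_norm_square)
  have xm: "x ^ m = x * x ^ (m - 1)"
    using assms(1) by (metis Suc_diff_1 less_eq_Suc_le One_nat_def power_Suc)
  \<comment> \<open>With the corner entry \<open>rho m p\<close> equal to 0, the expansion leaves
    m^2 |w|^(2m-2) times |z|^2 + |w|^(2m), and that sum is 1 on the boundary.\<close>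
  have "det (fefferman_matrix m p) = - (of_nat m ^ 2 * x ^ (m - 1)) * (p $ 1 * cnj (p $ 1) + x ^ m)"
    unfolding fefferman_matrix_def Let_def det_3 xm
    using assms(1)
    by (simp add: rho0 wirtinger_rho_1 wirtinger_rho_2 wirtinger_rho_second x_def [symmetric])
       (simp add: x_def algebra_simps power2_eq_square)
  then have "det (fefferman_matrix m p) = - (of_nat m ^ 2 * x ^ (m - 1))"
    using e' by (simp add: x_def)
  then have 1: "cmod (det (fefferman_matrix m p)) = (real m)\<^sup>2 * cmod (p $ 2) ^ (2 * m - 2)"
    by (simp add: norm_mult norm_power x power_mult [symmetric] right_diff_distrib')
  have pw: "4 * m - 2 = 2 * (1 + 2 * (m - 1))" using assms(1) by simp
  have "cmod (wirtinger 2 (rho m) p) = real m * cmod (p $ 2) ^ (1 + 2 * (m - 1))"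
    using assms(1)
    by (simp add: wirtinger_rho_2 norm_mult norm_power x_def [symmetric] x power_mult [symmetric] algebra_simps
        del: of_real_power)
  then have 2: "(cmod (wirtinger 2 (rho m) p))\<^sup>2 = (real m)\<^sup>2 * cmod (p $ 2) ^ (4 * m - 2)"
    unfolding pw by (auto simp add: power_mult_distrib power_mult [symmetric] mult.commute power2_eq_square [of "cmod (p $ 2)"])
  show ?thesis
    unfolding fefferman_weight_def 1 2 by (simp add: wirtinger_rho_1)
qed

lemma outward_normal_altdef:
  assumes "m \<ge> 1"
  shows "outward_normal m \<xi> =
     sgn (vector [\<xi> $ 1, of_nat m * \<xi> $ 2 * of_real (cmod (\<xi> $ 2) ^ (2 * m - 2))])"
proof -
  have "(\<chi> i. wirtinger_bar i (rho m) \<xi>) = vector [\<xi> $ 1, of_nat m * \<xi> $ 2 * of_real (cmod (\<xi> $ 2) ^ (2 * m - 2))]"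
    using assms
    by (simp add: vec_eq_iff forall_2 wirtinger_rho_1 wirtinger_rho_2 complex_norm_square [symmetric]
        power_mult [symmetric] right_diff_distrib')
  then show ?thesis by (simp add: outward_normal_def)
qed

section \<open>Torus expansions of holomorphic functions\<close>

text \<open>Not normalised, and on the half-open angular range of \<open>param_domain\<close>; hence
  the factors 2 pi, and 4 pi^2 for the torus, in the coefficient formulas.\<close>

definition circle_measure :: "real measure" where
  "circle_measure = restrict_space lborel {0..<2 * pi}"

lemma space_circle_measure [simp]: "space circle_measure = {0..<2 * pi}"
  by (simp add: circle_measure_def space_restrict_space)

lemma measure_circle_measure [simp]: "measure circle_measure {0..<2 * pi} = 2 * pi"
  by (simp add: circle_measure_def measure_restrict_space)

interpretation circle_measure: finite_measure circle_measure
  by standard (simp add: circle_measure_def emeasure_restrict_space space_restrict_space)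

lemma measurable_circle_measure [measurable (raw)]:
  "f \<in> borel_measurable borel \<Longrightarrow> f \<in> borel_measurable circle_measure"
  by (simp add: circle_measure_def measurable_restrict_space1)

lemma integral_circle_orthogonal:
  "(\<integral>\<theta>. cis \<theta> ^ n * cnj (cis \<theta>) ^ j \<partial>circle_measure) = (if n = j then of_real (2 * pi) else 0)"
proof -
  define d :: real where "d = real n - real j"
  have e: "cis \<theta> ^ n * cnj (cis \<theta>) ^ j = cis (d * \<theta>)" for \<theta>
  proof -
    have "cis \<theta> ^ n * cnj (cis \<theta>) ^ j = cis (real n * \<theta>) * cis (- \<theta>) ^ j"
      by (subst Complex.DeMoivre) (simp add: cis_cnj)
    also have "\<dots> = cis (real n * \<theta> + real j * (- \<theta>))"
      by (simp only: Complex.DeMoivre cis_mult)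
    finally show ?thesis by (simp add: d_def algebra_simps)
  qed
  show ?thesis
  proof (cases "n = j")
    case True
    then have "d = 0" by (simp add: d_def)
    then show ?thesis unfolding e using True by (simp add: scaleR_conv_of_real)
  next
    case False
    then have d: "d \<noteq> 0" by (simp add: d_def)
    \<comment> \<open>One endpoint is added so that the fundamental theorem of calculus applies on a
      closed interval.\<close>
    have "(\<integral>\<theta>. indicator {0..<2 * pi} \<theta> *\<^sub>R cis (d * \<theta>) \<partial>lborel) =
        (\<integral>\<theta>. indicator {0..2 * pi} \<theta> *\<^sub>R cis (d * \<theta>) \<partial>lborel)"
      by (rule integral_discrete_difference [where X = "{2 * pi}"]) (auto split: split_indicator)
    also have "\<dots> = cis (d * (2 * pi)) / (\<i> * d) - cis (d * 0) / (\<i> * d)"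
    proof (rule integral_FTC_Icc)
      show "continuous_on {0..2 * pi} (\<lambda>\<theta>. cis (d * \<theta>))"
        by (intro continuous_intros)
      show "((\<lambda>\<theta>. cis (d * \<theta>) / (\<i> * d)) has_vector_derivative cis (d * x)) (at x within {0..2 * pi})" for x
      proof -
        have "((\<lambda>z. exp (\<i> * d * z) / (\<i> * d)) has_field_derivative exp (\<i> * d * of_real x)) (at (of_real x))"
          using d by (auto intro!: derivative_eq_intros)
        from has_vector_derivative_real_field [OF this] show ?thesis
          by (simp add: cis_conv_exp mult.assoc)
      qed
    qed simp
    \<comment> \<open>Since d is a difference of two integers, the antiderivative takes equal values
      at both ends.\<close>
    also have "cis (d * (2 * pi)) = cis (2 * pi * n) / cis (2 * pi * j)"
      by (simp add: cis_divide d_def algebra_simps)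
    also have "\<dots> = 1"
      by (simp add: cis_multiple_2pi)
    finally show ?thesis
      using False by (simp add: e circle_measure_def integral_restrict_space)
  qed
qed

text \<open>Cauchy's coefficient formula by integration term by term: orthogonality leaves only n =
  j. Convergence at a radius strictly between \<open>r\<close> and \<open>R\<close> makes the series
  absolutely convergent on the circle, which justifies the interchange.\<close>

lemma integral_circle_power_series:
  fixes c :: "nat \<Rightarrow> complex"
  assumes sums: "\<And>z. cmod z < R \<Longrightarrow> (\<lambda>n. c n * z ^ n) sums g z"
    and r: "0 \<le> r" "r < R"
  shows "(\<integral>\<theta>. g (r * cis \<theta>) * cnj (cis \<theta>) ^ j \<partial>circle_measure) = 2 * pi * r ^ j * c j"
proof -
  define f where "f n \<theta> = c n * (r * cis \<theta>) ^ n * cnj (cis \<theta>) ^ j" for n \<theta>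
  obtain r' where r': "r < r'" "r' < R" using r dense by blast
  have "summable (\<lambda>n. c n * of_real r' ^ n)"
    using sums [of "of_real r'"] r r' by (auto simp: sums_iff)
  then have abs: "summable (\<lambda>n. cmod (c n * of_real r ^ n))"
    by (rule powser_insidea) (use r r' in auto)
  have norm_f: "norm (f n \<theta>) = cmod (c n * of_real r ^ n)" for n \<theta>
    by (simp add: f_def norm_mult norm_power)
  have meas [measurable]: "f n \<in> borel_measurable borel" for n
    unfolding f_def
    by (intro borel_measurable_continuous_onI continuous_intros)
  have "(\<lambda>n. integral\<^sup>L circle_measure (f n)) sums (\<integral>\<theta>. (\<Sum>n. f n \<theta>) \<partial>circle_measure)"
  proof (rule sums_integral)
    show "integrable circle_measure (f n)" for n
      by (rule circle_measure.integrable_const_bound [where B = "cmod (c n * of_real r ^ n)"])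
         (simp_all only: norm_f order_refl AE_I2 measurable_circle_measure meas)
    show "AE \<theta> in circle_measure. summable (\<lambda>n. norm (f n \<theta>))"
      using abs by (simp only: norm_f AE_I2)
    show "summable (\<lambda>n. \<integral>\<theta>. norm (f n \<theta>) \<partial>circle_measure)"
      unfolding norm_f lebesgue_integral_const by (intro summable_scaleR_right abs)
  qed
  also have "(\<lambda>n. integral\<^sup>L circle_measure (f n)) = (\<lambda>n. if n = j then 2 * pi * r ^ j * c j else 0)"
  proof (rule ext)
    fix n
    have "f n = (\<lambda>\<theta>. (c n * r ^ n) * (cis \<theta> ^ n * cnj (cis \<theta>) ^ j))"
      by (simp add: f_def fun_eq_iff power_mult_distrib)
    then have "integral\<^sup>L circle_measure (f n) = (c n * r ^ n) * (if n = j then of_real (2 * pi) else 0)"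
      by (simp only: integral_mult_right_zero integral_circle_orthogonal)
    then show "integral\<^sup>L circle_measure (f n) = (if n = j then 2 * pi * r ^ j * c j else 0)"
      by simp
  qed
  finally have "(\<integral>\<theta>. (\<Sum>n. f n \<theta>) \<partial>circle_measure) = 2 * pi * r ^ j * c j"
    using sums_single [of j "\<lambda>_. 2 * pi * r ^ j * c j"] sums_unique2 by blast
  moreover have "(\<Sum>n. f n \<theta>) = g (r * cis \<theta>) * cnj (cis \<theta>) ^ j" for \<theta>
    unfolding f_def
    by (intro sums_unique [symmetric] sums_mult2 sums) (use r in \<open>simp add: norm_mult\<close>)
  ultimately show ?thesis by simp
qed

section \<open>Slices of the domain\<close>

lemma ellipsoid_iff: "vector [z, w] \<in> ellipsoid m \<longleftrightarrow> (cmod z)\<^sup>2 + cmod w ^ (2 * m) < 1"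
  by (simp add: ellipsoid_def)

lemma open_ellipsoid: "open (ellipsoid m)"
  unfolding ellipsoid_def
  by (intro open_Collect_less continuous_on_add continuous_on_power continuous_on_norm
      continuous_on_component continuous_on_id continuous_on_const)

lemma continuous_on_vector2 [continuous_intros]:
  fixes f g :: "'a::topological_space \<Rightarrow> complex"
  assumes "continuous_on X f" "continuous_on X g"
  shows "continuous_on X (\<lambda>x. vector [f x, g x] :: complex^2)"
proof -
  have "continuous_on X (\<lambda>x. \<chi> i. (vector [f x, g x] :: complex^2) $ i)"
  proof (rule continuous_on_vec_lambda)
    show "continuous_on X (\<lambda>x. (vector [f x, g x] :: complex^2) $ i)" for i
      using exhaust_2 [of i] assms by auto
  qed
  then show ?thesis by (simp only: vec_lambda_eta)
qed

lemma holomorphic2_on_continuous: "holomorphic2_on f U \<Longrightarrow> continuous_on U f"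
  unfolding holomorphic2_on_def continuous_on_eq_continuous_within
  by (meson has_derivative_continuous)

text \<open>Fixing one coordinate composes the complex linear derivative with an affine embedding of
  the plane, so only multiplication by \<open>a\<close> or by \<open>b\<close> is left.\<close>

lemma holomorphic2_on_slices:
  assumes "holomorphic2_on f (ellipsoid m)"
  shows "(\<lambda>z. f (vector [z, w])) holomorphic_on {z. vector [z, w] \<in> ellipsoid m}"
    and "(\<lambda>w. f (vector [z, w])) holomorphic_on {w. vector [z, w] \<in> ellipsoid m}"
proof -
  have der: "\<exists>a b. (f has_derivative (\<lambda>h. a * h $ 1 + b * h $ 2)) (at p)" if "p \<in> ellipsoid m" for p
    using assms that unfolding holomorphic2_on_def at_within_open [OF that open_ellipsoid, symmetric] by blast
  have lin: "bounded_linear (\<lambda>h::complex. vector [h * u, h * v] :: complex^2)" for u v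
  proof -
    have "linear (\<lambda>h::complex. vector [h * u, h * v] :: complex^2)"
      by (rule linearI) (simp_all add: vec_eq_iff forall_2 algebra_simps)
    then show ?thesis by (rule linear_conv_bounded_linear [THEN iffD1])
  qed
  have d: "((\<lambda>h. vector [z0 + h * u, w0 + h * v] :: complex^2) has_derivative (\<lambda>h. vector [h * u, h * v])) (at x)"
    for u v z0 w0 x
  proof -
    have "(\<lambda>h. vector [z0 + h * u, w0 + h * v] :: complex^2) = (\<lambda>h. vector [z0, w0] + vector [h * u, h * v])"
      by (simp add: fun_eq_iff vec_eq_iff forall_2)
    then show ?thesis
      by (auto intro!: derivative_eq_intros bounded_linear_imp_has_derivative lin)
  qed
  show "(\<lambda>z. f (vector [z, w])) holomorphic_on {z. vector [z, w] \<in> ellipsoid m}"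
    unfolding holomorphic_on_def field_differentiable_def
  proof safe
    fix z assume "vector [z, w] \<in> ellipsoid m"
    then obtain a b where "(f has_derivative (\<lambda>h. a * h $ 1 + b * h $ 2)) (at (vector [z, w]))"
      using der by blast
    then have "((\<lambda>z. f (vector [z, w])) has_derivative (\<lambda>h. a * h)) (at z)"
      using has_derivative_compose [OF d [of 0 1 w 0 z], of f "\<lambda>h. a * h $ 1 + b * h $ 2"] by simp
    then show "\<exists>f'. ((\<lambda>z. f (vector [z, w])) has_field_derivative f') (at z within {z. vector [z, w] \<in> ellipsoid m})"
      unfolding has_field_derivative_def by (blast intro: has_derivative_at_withinI)
  qed
  show "(\<lambda>w. f (vector [z, w])) holomorphic_on {w. vector [z, w] \<in> ellipsoid m}"
    unfolding holomorphic_on_def field_differentiable_def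
  proof safe
    fix w assume "vector [z, w] \<in> ellipsoid m"
    then obtain a b where "(f has_derivative (\<lambda>h. a * h $ 1 + b * h $ 2)) (at (vector [z, w]))"
      using der by blast
    then have "((\<lambda>w. f (vector [z, w])) has_derivative (\<lambda>h. b * h)) (at w)"
      using has_derivative_compose [OF d [of z 0 0 1 w], of f "\<lambda>h. a * h $ 1 + b * h $ 2"] by simp
    then show "\<exists>f'. ((\<lambda>w. f (vector [z, w])) has_field_derivative f') (at w within {w. vector [z, w] \<in> ellipsoid m})"
      unfolding has_field_derivative_def by (blast intro: has_derivative_at_withinI)
  qed
qed

text \<open>Because slices are full discs about 0, a one-variable Taylor series at 0 converges on
  all of a slice.\<close>

lemma slice_ball:
  assumes "m \<ge> 1" "cmod z < 1"
  shows "{w. vector [z, w] \<in> ellipsoid m} = ball 0 (root (2 * m) (1 - (cmod z)\<^sup>2))"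
proof -
  have "1 - (cmod z)\<^sup>2 > 0" using assms(2) by (simp add: power_less_one_iff abs_square_less_1)
  moreover have "cmod w ^ (2 * m) < 1 - (cmod z)\<^sup>2 \<longleftrightarrow> cmod w < root (2 * m) (1 - (cmod z)\<^sup>2)" for w
    using real_root_less_iff [of "2 * m" "cmod w ^ (2 * m)" "1 - (cmod z)\<^sup>2"] assms(1)
    by (simp add: real_root_power_cancel)
  moreover have "vector [z, w] \<in> ellipsoid m \<longleftrightarrow> cmod w ^ (2 * m) < 1 - (cmod z)\<^sup>2" for w
    by (simp only: ellipsoid_iff less_diff_eq add.commute)
  ultimately show ?thesis by (simp add: ball_def)
qed

lemma slice_ball':
  assumes "m \<ge> 1" "cmod w < 1"
  shows "{z. vector [z, w] \<in> ellipsoid m} = ball 0 (sqrt (1 - cmod w ^ (2 * m)))"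
proof -
  have "cmod w ^ (2 * m) < 1"
    by (subst power_less_one_iff) (use assms in auto)
  then have "1 - cmod w ^ (2 * m) > 0" by simp
  have "(cmod z)\<^sup>2 < 1 - cmod w ^ (2 * m) \<longleftrightarrow> cmod z < sqrt (1 - cmod w ^ (2 * m))" for z
  proof -
    have "sqrt ((cmod z)\<^sup>2) < sqrt (1 - cmod w ^ (2 * m)) \<longleftrightarrow> (cmod z)\<^sup>2 < 1 - cmod w ^ (2 * m)"
      by (rule real_sqrt_less_iff)
    moreover have "sqrt ((cmod z)\<^sup>2) = cmod z" by simp
    ultimately show ?thesis by (simp only:)
  qed
  moreover have "vector [z, w] \<in> ellipsoid m \<longleftrightarrow> (cmod z)\<^sup>2 < 1 - cmod w ^ (2 * m)" for z
    by (simp only: ellipsoid_iff less_diff_eq)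
  ultimately show ?thesis by (simp add: ball_def)
qed

lemma measurable_circle_measure_pair:
  assumes "f \<in> borel_measurable (borel :: (real \<times> real) measure)"
  shows "f \<in> borel_measurable (circle_measure \<Otimes>\<^sub>M circle_measure)"
proof -
  have id: "(\<lambda>x. x) \<in> circle_measure \<rightarrow>\<^sub>M borel"
    by (rule measurable_circle_measure) simp
  have "(\<lambda>p. (fst p, snd p)) \<in> circle_measure \<Otimes>\<^sub>M circle_measure \<rightarrow>\<^sub>M borel \<Otimes>\<^sub>M borel"
    by (rule measurable_Pair [OF measurable_compose [OF measurable_fst id] measurable_compose [OF measurable_snd id]])
  then have "(\<lambda>p. p) \<in> circle_measure \<Otimes>\<^sub>M circle_measure \<rightarrow>\<^sub>M (borel :: (real \<times> real) measure)"
    by (simp only: prod.collapse borel_prod)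
  from measurable_compose [OF this assms] show ?thesis .
qed

text \<open>The expansion is iterated: Taylor coefficients \<open>C k\<close> in w for fixed z, then
  Taylor coefficients of \<open>C k\<close> in z. The point to prove is that \<open>C k\<close> is
  holomorphic; it is a circle integral in w of the expansion in z, and Cauchy estimates allow that
  expansion to be integrated term by term. The iterated sum is all that the evaluation of the kernel
  uses.\<close>

lemma holomorphic2_on_torus_expansion:
  assumes m: "m \<ge> 1" and f: "holomorphic2_on f (ellipsoid m)"
  obtains A :: "nat \<Rightarrow> nat \<Rightarrow> complex" where
    "\<And>z w. vector [z, w] \<in> ellipsoid m \<Longrightarrow>
       \<exists>C. (\<forall>k. (\<lambda>j. A k j * z ^ j) sums C k) \<and> (\<lambda>k. C k * w ^ k) sums f (vector [z, w])"
    "\<And>r1 r2 j k. 0 \<le> r1 \<Longrightarrow> 0 \<le> r2 \<Longrightarrow> r1\<^sup>2 + r2 ^ (2 * m) < 1 \<Longrightarrow>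
       (\<integral>\<theta>. (\<integral>\<phi>. f (vector [r1 * cis \<theta>, r2 * cis \<phi>]) * cnj (cis \<phi>) ^ k \<partial>circle_measure)
            * cnj (cis \<theta>) ^ j \<partial>circle_measure) = 4 * pi\<^sup>2 * r1 ^ j * r2 ^ k * A k j"
proof -
  define C where "C k z = (deriv ^^ k) (\<lambda>w. f (vector [z, w])) 0 / fact k" for k z
  define B where "B j w = (deriv ^^ j) (\<lambda>z. f (vector [z, w])) 0 / fact j" for j w
  define A where "A k j = (deriv ^^ j) (C k) 0 / fact j" for k j
  define R1 where "R1 z = root (2 * m) (1 - (cmod z)\<^sup>2)" for z
  define R2 where "R2 w = sqrt (1 - cmod w ^ (2 * m))" for w
  have C_sums: "(\<lambda>k. C k z * w ^ k) sums f (vector [z, w])" if "cmod z < 1" "cmod w < R1 z" for z w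
    using holomorphic_power_series [of "\<lambda>w. f (vector [z, w])" 0 "R1 z" w] that
      holomorphic2_on_slices(2) [OF f, of z]
    unfolding slice_ball [OF m that(1)] by (simp add: R1_def C_def)
  have B_sums: "(\<lambda>j. B j w * z ^ j) sums f (vector [z, w])" if "cmod w < 1" "cmod z < R2 w" for z w
    using holomorphic_power_series [of "\<lambda>z. f (vector [z, w])" 0 "R2 w" z] that
      holomorphic2_on_slices(1) [OF f, of w]
    unfolding slice_ball' [OF m that(1)] by (simp add: R2_def B_def)
  have norms: "cmod z < 1" "cmod w < 1" "cmod w < R1 z" "cmod z < R2 w"
    if "(cmod z)\<^sup>2 + cmod w ^ (2 * m) < 1" for z w
  proof -
    have "(cmod z)\<^sup>2 < 1" "cmod w ^ (2 * m) < 1"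
      using that zero_le_power [OF norm_ge_zero [of w], of "2 * m"] zero_le_power2 [of "cmod z"] by linarith+
    then show z: "cmod z < 1" and w: "cmod w < 1"
      using power_less_one_iff [of "cmod z" 2] power_less_one_iff [of "cmod w" "2 * m"] by simp_all
    have "w \<in> {w. vector [z, w] \<in> ellipsoid m}" "z \<in> {z. vector [z, w] \<in> ellipsoid m}"
      using that by (simp_all only: mem_Collect_eq ellipsoid_iff)
    then show "cmod w < R1 z" "cmod z < R2 w"
      unfolding slice_ball [OF m z] slice_ball' [OF m w] R1_def R2_def by simp_all
  qed
  have C_int: "(\<integral>\<phi>. f (vector [z, r2 * cis \<phi>]) * cnj (cis \<phi>) ^ k \<partial>circle_measure) = 2 * pi * r2 ^ k * C k z"
    if "(cmod z)\<^sup>2 + r2 ^ (2 * m) < 1" "0 \<le> r2" for z r2 k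
  proof -
    have *: "(cmod z)\<^sup>2 + cmod (of_real r2) ^ (2 * m) < 1" using that by simp
    show ?thesis
      by (rule integral_circle_power_series [where R = "R1 z" and c = "\<lambda>k. C k z" and g = "\<lambda>w. f (vector [z, w])"])
         (use C_sums [OF norms(1) [OF *]] norms [OF *] that in simp_all)
  qed
  have B_int: "(\<integral>\<theta>. f (vector [r1 * cis \<theta>, w]) * cnj (cis \<theta>) ^ j \<partial>circle_measure) = 2 * pi * r1 ^ j * B j w"
    if "r1\<^sup>2 + cmod w ^ (2 * m) < 1" "0 \<le> r1" for w r1 j
  proof -
    have *: "(cmod (of_real r1))\<^sup>2 + cmod w ^ (2 * m) < 1" using that by simp
    show ?thesis
      by (rule integral_circle_power_series [where R = "R2 w" and c = "\<lambda>k. B k w" and g = "\<lambda>z. f (vector [z, w])"])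
         (use B_sums [OF norms(2) [OF *]] norms [OF *] that in simp_all)
  qed
  have "C k holomorphic_on ball 0 R" if R: "0 < R" "R < 1" for k R
  proof -
    have R': "R\<^sup>2 < 1" using R by (simp add: power_less_one_iff)
    \<comment> \<open>This choice puts the whole torus with radii \<open>R\<close> and
      \<open>r2\<close> inside the domain, since R^2 + (1 - R^2)/2 < 1.\<close>
    define r2 where "r2 = root (2 * m) ((1 - R\<^sup>2) / 2)"
    have "r2 ^ (2 * m) = (1 - R\<^sup>2) / 2"
      using R' m by (simp add: r2_def)
    moreover have "(1 - R\<^sup>2) / 2 > 0" "R\<^sup>2 + (1 - R\<^sup>2) / 2 < 1"
      using R' by (auto simp: field_simps)
    ultimately have r2: "r2 > 0" "R\<^sup>2 + r2 ^ (2 * m) < 1"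
      using m by (simp_all add: r2_def)
    define F where "F \<theta> \<phi> = f (vector [R * cis \<theta>, r2 * cis \<phi>])" for \<theta> \<phi>
    have torus: "vector [R * cis \<theta>, r2 * cis \<phi>] \<in> ellipsoid m" for \<theta> \<phi>
      using r2 R by (simp add: ellipsoid_iff norm_mult)
    have contF: "continuous_on UNIV (\<lambda>x. F (fst x) (snd x))"
      unfolding F_def
    proof (rule continuous_on_compose2 [OF holomorphic2_on_continuous [OF f]])
      show "continuous_on UNIV (\<lambda>x. vector [R * cis (fst x), r2 * cis (snd x)] :: complex^2)"
        by (intro continuous_intros)
    qed (use torus in auto)
    define K where "K = (\<lambda>x. F (fst x) (snd x)) ` ({0..2 * pi} \<times> {0..2 * pi})"
    have "compact K"
      unfolding K_def
      by (intro compact_continuous_image compact_Times compact_Icc continuous_on_subset [OF contF]) auto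
    then obtain M where M: "\<And>x. x \<in> K \<Longrightarrow> cmod x \<le> M"
      using compact_imp_bounded bounded_iff by metis
    have M: "cmod (F \<theta> \<phi>) \<le> M" if "\<theta> \<in> {0..<2 * pi}" "\<phi> \<in> {0..<2 * pi}" for \<theta> \<phi>
      using that by (intro M) (force simp: K_def)
    \<comment> \<open>On the circle of radius \<open>r2\<close> the coefficients \<open>B j\<close>
      are means of \<open>f\<close> over circles in z. This gives measurability as parameter
      integrals and, with \<open>M\<close> bounding \<open>f\<close> on the torus, the Cauchy
      estimate M / R^j.\<close>
    have Bint: "B j (r2 * cis \<phi>) = (\<integral>\<theta>. F \<theta> \<phi> * cnj (cis \<theta>) ^ j \<partial>circle_measure) / (2 * pi * R ^ j)" for j \<phi>
      using B_int [of R "r2 * cis \<phi>" j] r2 R by (simp add: F_def norm_mult)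
    have Bmeas: "(\<lambda>\<phi>. B j (r2 * cis \<phi>)) \<in> borel_measurable circle_measure" for j
    proof -
      have "continuous_on UNIV (\<lambda>x::real \<times> real. (snd x, fst x))"
        by (intro continuous_intros)
      from continuous_on_compose2 [OF contF this]
      have "continuous_on UNIV (\<lambda>x. F (snd x) (fst x))"
        by simp
      then have "(\<lambda>x. F (snd x) (fst x) * cnj (cis (snd x)) ^ j) \<in> borel_measurable borel"
        by (intro borel_measurable_continuous_onI continuous_intros)
      from measurable_circle_measure_pair [OF this]
      have "(\<lambda>(\<phi>, \<theta>). F \<theta> \<phi> * cnj (cis \<theta>) ^ j) \<in> borel_measurable (circle_measure \<Otimes>\<^sub>M circle_measure)"
        by (simp add: case_prod_unfold)
      from circle_measure.borel_measurable_lebesgue_integral [OF this]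
      show ?thesis unfolding Bint
        by (intro borel_measurable_divide borel_measurable_const)
    qed
    have Bbound: "cmod (B j (r2 * cis \<phi>)) \<le> M / R ^ j" if "\<phi> \<in> {0..<2 * pi}" for j \<phi>
    proof -
      have "cmod (\<integral>\<theta>. F \<theta> \<phi> * cnj (cis \<theta>) ^ j \<partial>circle_measure) \<le> (\<integral>\<theta>. M \<partial>circle_measure)"
      proof (rule Bochner_Integration.integral_norm_bound_integral)
        show "integrable circle_measure (\<lambda>\<theta>. F \<theta> \<phi> * cnj (cis \<theta>) ^ j)"
        proof (rule circle_measure.integrable_const_bound)
          show "AE x in circle_measure. cmod (F x \<phi> * cnj (cis x) ^ j) \<le> M"
            using M [OF _ that] by (intro AE_I2) (simp add: norm_mult norm_power)
          have "continuous_on UNIV (\<lambda>x. F x \<phi>)"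
            using continuous_on_compose2 [OF contF, of UNIV "\<lambda>x. (x, \<phi>)"]
            by (simp add: continuous_on_Pair)
          then show "(\<lambda>x. F x \<phi> * cnj (cis x) ^ j) \<in> borel_measurable circle_measure"
            by (intro measurable_circle_measure borel_measurable_continuous_onI continuous_intros)
        qed
      qed (use M [OF _ that] in \<open>auto simp: norm_mult norm_power\<close>)
      also have "\<dots> = 2 * pi * M" by simp
      finally have "cmod (\<integral>\<theta>. F \<theta> \<phi> * cnj (cis \<theta>) ^ j \<partial>circle_measure) / (2 * pi * R ^ j)
          \<le> 2 * pi * M / (2 * pi * R ^ j)"
        by (rule divide_right_mono) (use R in simp)
      moreover have "cmod (B j (r2 * cis \<phi>)) =
          cmod (\<integral>\<theta>. F \<theta> \<phi> * cnj (cis \<theta>) ^ j \<partial>circle_measure) / (2 * pi * R ^ j)"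
        using R by (simp add: Bint norm_divide norm_mult norm_power)
      ultimately show ?thesis by simp
    qed
    define g where "g z j \<phi> = B j (r2 * cis \<phi>) * z ^ j * cnj (cis \<phi>) ^ k" for z j \<phi>
    \<comment> \<open>The circle mean in w of \<open>B j\<close>, divided by r2^k; it will be the
      j-th Taylor coefficient of \<open>C k\<close>.\<close>
    define a where "a j = (\<integral>\<phi>. B j (r2 * cis \<phi>) * cnj (cis \<phi>) ^ k \<partial>circle_measure) / (2 * pi * r2 ^ k)" for j
    have "(\<lambda>j. a j * (z - 0) ^ j) sums C k z" if z: "z \<in> ball 0 R" for z
    proof -
      have z': "cmod z < R" using z by simp
      have "0 \<le> cmod (F 0 0)" by simp
      also have "\<dots> \<le> M" by (rule M) auto
      finally have M0: "M \<ge> 0" .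
      have sm: "summable (\<lambda>j. M / R ^ j * cmod z ^ j)"
        using summable_mult [OF summable_geometric [of "cmod z / R"], of M] z' R
        by (simp add: power_divide)
      have gbound: "cmod (g z j \<phi>) \<le> M / R ^ j * cmod z ^ j" if "\<phi> \<in> {0..<2 * pi}" for j \<phi>
        using mult_right_mono [OF Bbound [OF that, of j], of "cmod z ^ j"] by (simp add: g_def norm_mult norm_power)
      have gint: "integrable circle_measure (g z j)" for j
      proof (rule circle_measure.integrable_const_bound)
        show "AE x in circle_measure. cmod (g z j x) \<le> M / R ^ j * cmod z ^ j"
          by (rule AE_I2, rule gbound) simp
        show "g z j \<in> borel_measurable circle_measure"
        proof -
          have "(\<lambda>\<phi>. z ^ j * cnj (cis \<phi>) ^ k) \<in> borel_measurable circle_measure"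
            by (intro measurable_circle_measure borel_measurable_continuous_onI continuous_intros)
          from borel_measurable_times [OF Bmeas [of j] this] show ?thesis
            by (simp add: g_def [abs_def] mult.assoc)
        qed
      qed
      \<comment> \<open>The geometric majorant with ratio |z| / R permits summation under the
        integral.\<close>
      have "(\<lambda>j. integral\<^sup>L circle_measure (g z j)) sums (\<integral>\<phi>. (\<Sum>j. g z j \<phi>) \<partial>circle_measure)"
      proof (rule sums_integral [OF gint])
        show "AE \<phi> in circle_measure. summable (\<lambda>j. norm (g z j \<phi>))"
        proof (rule AE_I2, rule summable_comparison_test' [OF sm])
          show "norm (norm (g z n \<phi>)) \<le> M / R ^ n * cmod z ^ n" if "\<phi> \<in> space circle_measure" for n \<phi>
            using gbound that by simp
        qed
        show "summable (\<lambda>j. \<integral>\<phi>. norm (g z j \<phi>) \<partial>circle_measure)"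
        proof (rule summable_comparison_test' [OF summable_mult [OF sm, of "2 * pi"]])
          fix j
          have "(\<integral>\<phi>. norm (g z j \<phi>) \<partial>circle_measure) \<le> (\<integral>\<phi>. M / R ^ j * cmod z ^ j \<partial>circle_measure)"
          proof (rule integral_mono)
            show "norm (g z j \<phi>) \<le> M / R ^ j * cmod z ^ j" if "\<phi> \<in> space circle_measure" for \<phi>
              using gbound that by simp
          qed (simp_all add: gint)
          then show "norm (\<integral>\<phi>. norm (g z j \<phi>) \<partial>circle_measure) \<le> 2 * pi * (M / R ^ j * cmod z ^ j)"
            by simp
        qed
      qed
      moreover have "(\<Sum>j. g z j \<phi>) = f (vector [z, r2 * cis \<phi>]) * cnj (cis \<phi>) ^ k" for \<phi>
      proof -
        have "(cmod z)\<^sup>2 \<le> R\<^sup>2" using z' by (intro power_mono) auto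
        then have "(cmod z)\<^sup>2 + cmod (r2 * cis \<phi>) ^ (2 * m) < 1"
          using r2 by (simp add: norm_mult)
        from B_sums [OF norms(2,4) [OF this]]
        show ?thesis
          unfolding g_def by (intro sums_unique [symmetric] sums_mult2)
      qed
      moreover have "(\<integral>\<phi>. f (vector [z, r2 * cis \<phi>]) * cnj (cis \<phi>) ^ k \<partial>circle_measure) = 2 * pi * r2 ^ k * C k z"
      proof (rule C_int)
        have "(cmod z)\<^sup>2 \<le> R\<^sup>2" using z' by (intro power_mono) auto
        then show "(cmod z)\<^sup>2 + r2 ^ (2 * m) < 1" using r2 by simp
      qed (use r2 in simp)
      moreover have "integral\<^sup>L circle_measure (g z j) = 2 * pi * r2 ^ k * (a j * z ^ j)" for j
      proof -
        have "g z j = (\<lambda>\<phi>. z ^ j * (B j (r2 * cis \<phi>) * cnj (cis \<phi>) ^ k))"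
          by (simp add: g_def fun_eq_iff)
        then have "integral\<^sup>L circle_measure (g z j) = z ^ j * (\<integral>\<phi>. B j (r2 * cis \<phi>) * cnj (cis \<phi>) ^ k \<partial>circle_measure)"
          by (simp only: integral_mult_right_zero)
        then show ?thesis using r2 by (simp add: a_def)
      qed
      ultimately have "(\<lambda>j. 2 * pi * r2 ^ k * (a j * z ^ j)) sums (2 * pi * r2 ^ k * C k z)"
        by simp
      then show ?thesis
        using r2 by (subst (asm) sums_mult_iff) auto
    qed
    then show ?thesis by (rule power_series_holomorphic)
  qed
  \<comment> \<open>The discs of radius \<open>R\<close> < 1 exhaust the unit disc, and
    differentiability is a pointwise matter.\<close>
  then have holC: "C k holomorphic_on ball 0 1" for k
  proof -
    have "C k field_differentiable at z" if "cmod z < 1" for z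
    proof -
      obtain R where "cmod z < R" "R < 1" using \<open>cmod z < 1\<close> dense by blast
      moreover then have "0 < R" using norm_ge_zero [of z] by linarith
      ultimately show ?thesis
        using \<open>\<And>k R. 0 < R \<Longrightarrow> R < 1 \<Longrightarrow> C k holomorphic_on ball 0 R\<close> [of R k]
        by (auto intro: holomorphic_on_imp_differentiable_at)
    qed
    then show ?thesis
      by (auto simp: holomorphic_on_def intro: field_differentiable_at_within)
  qed
  have A_sums: "(\<lambda>j. A k j * z ^ j) sums C k z" if "cmod z < 1" for k z
    using holomorphic_power_series [OF holC, of z k] that by (simp add: A_def)
  show thesis
  proof (rule that)
    fix z w assume "vector [z, w] \<in> ellipsoid m"
    then have "(cmod z)\<^sup>2 + cmod w ^ (2 * m) < 1" by (simp add: ellipsoid_iff)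
    note n = norms [OF this]
    show "\<exists>C. (\<forall>k. (\<lambda>j. A k j * z ^ j) sums C k) \<and> (\<lambda>k. C k * w ^ k) sums f (vector [z, w])"
      by (intro exI [of _ "\<lambda>k. C k z"] conjI allI A_sums C_sums n)
  next
    fix r1 r2 :: real and j k
    assume r: "0 \<le> r1" "0 \<le> r2" "r1\<^sup>2 + r2 ^ (2 * m) < 1"
    then have "(cmod (of_real r1))\<^sup>2 + cmod (of_real r2) ^ (2 * m) < 1" by simp
    from norms(1) [OF this] have r1: "r1 < 1" by simp
    have "(\<integral>\<phi>. f (vector [r1 * cis \<theta>, r2 * cis \<phi>]) * cnj (cis \<phi>) ^ k \<partial>circle_measure) =
        2 * pi * r2 ^ k * C k (r1 * cis \<theta>)" for \<theta>
      by (rule C_int) (use r in \<open>auto simp: norm_mult\<close>)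
    moreover have "(\<integral>\<theta>. C k (r1 * cis \<theta>) * cnj (cis \<theta>) ^ j \<partial>circle_measure) = 2 * pi * r1 ^ j * A k j"
      by (rule integral_circle_power_series [where R = 1]) (use r r1 in \<open>auto intro!: A_sums\<close>)
    moreover have "(\<integral>\<theta>. 2 * pi * r2 ^ k * C k (r1 * cis \<theta>) * cnj (cis \<theta>) ^ j \<partial>circle_measure) =
        2 * pi * r2 ^ k * (\<integral>\<theta>. C k (r1 * cis \<theta>) * cnj (cis \<theta>) ^ j \<partial>circle_measure)"
      by (simp only: mult.assoc integral_mult_right_zero)
    moreover have "2 * pi * r2 ^ k * (2 * pi * r1 ^ j * A k j) = 4 * pi\<^sup>2 * r1 ^ j * r2 ^ k * A k j"
      by (simp add: power2_eq_square)
    ultimately show "(\<integral>\<theta>. (\<integral>\<phi>. f (vector [r1 * cis \<theta>, r2 * cis \<phi>]) * cnj (cis \<phi>) ^ k \<partial>circle_measure)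
            * cnj (cis \<theta>) ^ j \<partial>circle_measure) = 4 * pi\<^sup>2 * r1 ^ j * r2 ^ k * A k j"
      by (simp only:)
  qed
qed

section \<open>Radial approach to the boundary\<close>

text \<open>Half the real gradient of \<open>rho m\<close>, in closed form and before normalisation;
  inner products with it are easier to estimate than those with the unit normal.\<close>

definition boundary_gradient :: "nat \<Rightarrow> complex^2 \<Rightarrow> complex^2" where
  "boundary_gradient m \<xi> = vector [\<xi> $ 1, of_nat m * \<xi> $ 2 * of_real (cmod (\<xi> $ 2) ^ (2 * m - 2))]"

lemma inner_complex2: "(x :: complex^2) \<bullet> y = Re (x $ 1 * cnj (y $ 1)) + Re (x $ 2 * cnj (y $ 2))"
  by (simp add: inner_vec_def sum_2 inner_complex_def)

text \<open>The full Hermitian product matters, not just its real part: because it is real, the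
  complex normal component of a radial vector coincides with the Euclidean one.\<close>

lemma boundary_gradient_self:
  assumes "m \<ge> 1"
  shows "\<xi> $ 1 * cnj (boundary_gradient m \<xi> $ 1) + \<xi> $ 2 * cnj (boundary_gradient m \<xi> $ 2)
     = of_real ((cmod (\<xi> $ 1))\<^sup>2 + real m * cmod (\<xi> $ 2) ^ (2 * m))"
proof -
  have "cmod (\<xi> $ 2) ^ (2 * m) = (cmod (\<xi> $ 2))\<^sup>2 * cmod (\<xi> $ 2) ^ (2 * m - 2)"
  proof -
    have "2 * m = 2 + (2 * m - 2)" using assms by simp
    then show ?thesis by (metis power_add)
  qed
  then show ?thesis
    by (simp add: boundary_gradient_def complex_norm_square [symmetric] mult_ac del: of_real_power)
qed

text \<open>The lower bound 1 comes from |z|^2 + m |w|^(2m) >= |z|^2 + |w|^(2m). It says that radii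
  cross the boundary transversally, and with the upper bound on the gradient it yields one constant
  for all boundary points.\<close>

lemma boundary_bounds:
  assumes "m \<ge> 1" "\<xi> \<in> frontier (ellipsoid m)"
  shows "cmod (\<xi> $ 1) \<le> 1" "cmod (\<xi> $ 2) \<le> 1" "norm \<xi> \<le> 2"
    and "\<xi> \<bullet> boundary_gradient m \<xi> \<ge> 1"
    and "norm (boundary_gradient m \<xi>) \<le> 1 + real m" "boundary_gradient m \<xi> \<noteq> 0"
proof -
  have e: "(cmod (\<xi> $ 1))\<^sup>2 + cmod (\<xi> $ 2) ^ (2 * m) = 1"
    using assms by (simp add: frontier_ellipsoid)
  have nn: "cmod (\<xi> $ 2) ^ (2 * m) \<ge> 0" "(cmod (\<xi> $ 1))\<^sup>2 \<ge> 0" by simp_all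
  have "(cmod (\<xi> $ 1))\<^sup>2 \<le> 1" using e nn by linarith
  then show 1: "cmod (\<xi> $ 1) \<le> 1" using power_le_one_iff [of "cmod (\<xi> $ 1)" 2] by simp
  have "cmod (\<xi> $ 2) ^ (2 * m) \<le> 1" using e nn by linarith
  then show 2: "cmod (\<xi> $ 2) \<le> 1" using power_le_one_iff [of "cmod (\<xi> $ 2)" "2 * m"] assms(1) by simp
  have n: "norm x \<le> cmod (x $ 1) + cmod (x $ 2)" for x :: "complex^2"
    by (simp add: norm_vec_def L2_set_def sum_2 sqrt_sum_squares_le_sum)
  show "norm \<xi> \<le> 2" using n [of \<xi>] 1 2 by simp
  have "\<xi> \<bullet> boundary_gradient m \<xi> = (cmod (\<xi> $ 1))\<^sup>2 + real m * cmod (\<xi> $ 2) ^ (2 * m)"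
    using arg_cong [OF boundary_gradient_self [OF assms(1), of \<xi>], of Re]
    by (simp only: inner_complex2 Re_complex_of_real plus_complex.sel)
  moreover have "1 * cmod (\<xi> $ 2) ^ (2 * m) \<le> real m * cmod (\<xi> $ 2) ^ (2 * m)"
    using assms(1) by (intro mult_right_mono) auto
  ultimately show ge: "\<xi> \<bullet> boundary_gradient m \<xi> \<ge> 1"
    using e by linarith
  then show "boundary_gradient m \<xi> \<noteq> 0" by auto
  have "cmod (\<xi> $ 2) * cmod (\<xi> $ 2) ^ (2 * m - 2) \<le> 1 * 1"
    using 2 by (intro mult_mono power_le_one) auto
  then have "real m * (cmod (\<xi> $ 2) * cmod (\<xi> $ 2) ^ (2 * m - 2)) \<le> real m * 1"
    by (intro mult_left_mono) auto
  then show "norm (boundary_gradient m \<xi>) \<le> 1 + real m"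
    using n [of "boundary_gradient m \<xi>"] 1
    by (simp add: boundary_gradient_def norm_mult norm_power mult_ac)
qed

text \<open>A convex power lies above its tangent at \<open>s\<close>; for s > 0 this is Bernoulli's
  inequality for t / s, scaled by s^n.\<close>

lemma power_tangent_le:
  fixes s t :: real
  assumes "0 \<le> s" "0 \<le> t" "n \<ge> 2"
  shows "s ^ n + real n * s ^ (n - 1) * (t - s) \<le> t ^ n"
proof (cases "s = 0")
  case True
  then show ?thesis using assms by (simp add: zero_power)
next
  case False
  then have s: "s > 0" using assms by simp
  have "1 + real n * (t / s - 1) \<le> (1 + (t / s - 1)) ^ n"
    by (rule Bernoulli_inequality) (use s assms in simp)
  then have "s ^ n * (1 + real n * (t / s - 1)) \<le> s ^ n * (t / s) ^ n"
    using s by (intro mult_left_mono) auto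
  moreover have "s ^ n * (t / s) ^ n = t ^ n" using s by (simp add: power_divide)
  moreover have "s ^ n * (1 + real n * (t / s - 1)) = s ^ n + real n * s ^ (n - 1) * (t - s)"
  proof -
    have "s ^ n = s * s ^ (n - 1)" using assms by (cases n) auto
    then show ?thesis using s by (simp add: field_simps)
  qed
  ultimately show ?thesis by simp
qed

text \<open>Convexity of the domain: the boundary lies on one side of the tangent plane at \<eta>.
  Bounding real parts by moduli reduces this to 2 t1 s1 <= t1^2 + s1^2 in the first coordinate and
  to the tangent of the 2m-th power in the second; the remainders cancel because both points satisfy
  the boundary equation.\<close>

lemma boundary_gradient_convex:
  assumes m: "m \<ge> 1" and "\<xi> \<in> frontier (ellipsoid m)" "\<eta> \<in> frontier (ellipsoid m)"
  shows "(\<eta> - \<xi>) \<bullet> boundary_gradient m \<eta> \<ge> 0"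
proof -
  define s1 s2 t1 t2 where "s1 = cmod (\<eta> $ 1)" "s2 = cmod (\<eta> $ 2)" "t1 = cmod (\<xi> $ 1)" "t2 = cmod (\<xi> $ 2)"
  have e: "s1\<^sup>2 + s2 ^ (2 * m) = 1" "t1\<^sup>2 + t2 ^ (2 * m) = 1"
    using assms by (simp_all add: frontier_ellipsoid s1_s2_t1_t2_def)
  have pos: "0 \<le> s1" "0 \<le> s2" "0 \<le> t1" "0 \<le> t2" by (simp_all add: s1_s2_t1_t2_def)
  have a: "Re (\<xi> $ 1 * cnj (\<eta> $ 1)) \<le> t1 * s1" "Re (\<xi> $ 2 * cnj (\<eta> $ 2)) \<le> t2 * s2"
    using complex_Re_le_cmod [of "\<xi> $ 1 * cnj (\<eta> $ 1)"] complex_Re_le_cmod [of "\<xi> $ 2 * cnj (\<eta> $ 2)"]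
    by (simp_all add: norm_mult s1_s2_t1_t2_def)
  have self: "\<eta> \<bullet> boundary_gradient m \<eta> = s1\<^sup>2 + real m * s2 ^ (2 * m)"
    using arg_cong [OF boundary_gradient_self [OF m, of \<eta>], of Re]
    by (simp only: inner_complex2 Re_complex_of_real plus_complex.sel s1_s2_t1_t2_def)
  have "\<xi> \<bullet> boundary_gradient m \<eta> =
      Re (\<xi> $ 1 * cnj (\<eta> $ 1)) + real m * s2 ^ (2 * m - 2) * Re (\<xi> $ 2 * cnj (\<eta> $ 2))"
  proof -
    have "\<xi> $ 2 * cnj (of_nat m * \<eta> $ 2 * of_real (s2 ^ (2 * m - 2)))
        = of_real (real m * s2 ^ (2 * m - 2)) * (\<xi> $ 2 * cnj (\<eta> $ 2))"
      by simp
    moreover have "Re (of_real c * z) = c * Re z" for c z by simp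
    ultimately show ?thesis
      by (simp only: inner_complex2 boundary_gradient_def s1_s2_t1_t2_def vector_2)
  qed
  also have "\<dots> \<le> t1 * s1 + real m * s2 ^ (2 * m - 2) * (t2 * s2)"
    by (intro add_mono a mult_left_mono) (use pos in auto)
  also have "\<dots> \<le> s1\<^sup>2 + real m * s2 ^ (2 * m)"
  proof -
    have "s2 ^ (2 * m) + real (2 * m) * s2 ^ (2 * m - 1) * (t2 - s2) \<le> t2 ^ (2 * m)"
      by (rule power_tangent_le) (use pos m in auto)
    moreover have "s2 ^ (2 * m - 1) = s2 ^ (2 * m - 2) * s2"
    proof -
      have "2 * m - 1 = Suc (2 * m - 2)" using m by simp
      then show ?thesis by (simp only: power_Suc2)
    qed
    moreover have "s2 ^ (2 * m) = s2 ^ (2 * m - 2) * s2 * s2"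
    proof -
      have "2 * m = Suc (Suc (2 * m - 2))" using m by simp
      then show ?thesis by (metis power_Suc2)
    qed
    moreover have "2 * (t1 * s1) \<le> t1\<^sup>2 + s1\<^sup>2"
      using sum_squares_bound [of t1 s1] by simp
    ultimately show ?thesis using e by (simp add: algebra_simps)
  qed
  finally show ?thesis by (simp add: inner_diff_left self)
qed

lemma outward_normal_eq_gradient:
  assumes "m \<ge> 1"
  shows "outward_normal m \<xi> = inverse (norm (boundary_gradient m \<xi>)) *\<^sub>R boundary_gradient m \<xi>"
  by (simp only: outward_normal_altdef [OF assms] boundary_gradient_def sgn_div_norm)

lemma continuous_on_outward_normal:
  assumes "m \<ge> 1"
  shows "continuous_on (frontier (ellipsoid m)) (outward_normal m)"
proof -
  have "continuous_on (frontier (ellipsoid m)) (boundary_gradient m)"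
    unfolding boundary_gradient_def [abs_def] by (intro continuous_intros)
  then have "continuous_on (frontier (ellipsoid m)) (\<lambda>\<xi>. boundary_gradient m \<xi> /\<^sub>R norm (boundary_gradient m \<xi>))"
    using boundary_bounds(6) [OF assms] by (intro continuous_intros) auto
  then show ?thesis
    by (simp only: outward_normal_eq_gradient [OF assms, abs_def])
qed

lemma norm_outward_normal:
  assumes "m \<ge> 1" "\<xi> \<in> frontier (ellipsoid m)"
  shows "norm (outward_normal m \<xi>) = 1"
  using boundary_bounds(6) [OF assms]
  by (simp add: outward_normal_eq_gradient [OF assms(1)])

text \<open>Orthogonal projection along the unit normal attains the distance, and Cauchy-Schwarz
  shows that no point of the plane is nearer. The closed form also exhibits the distance as a
  continuous function of \<xi>.\<close>

lemma infdist_tangent_plane: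
  assumes "m \<ge> 1" "\<xi> \<in> frontier (ellipsoid m)"
  shows "infdist p (tangent_plane m \<xi>) = \<bar>(p - \<xi>) \<bullet> outward_normal m \<xi>\<bar>"
proof (rule antisym)
  define \<nu> where "\<nu> = outward_normal m \<xi>"
  have \<nu>: "norm \<nu> = 1" "\<nu> \<bullet> \<nu> = 1"
    using norm_outward_normal [OF assms] by (simp_all add: \<nu>_def dot_square_norm)
  have "p - ((p - \<xi>) \<bullet> \<nu>) *\<^sub>R \<nu> \<in> tangent_plane m \<xi>"
    using \<nu> by (simp add: tangent_plane_def \<nu>_def [symmetric] algebra_simps)
  then have "infdist p (tangent_plane m \<xi>) \<le> dist p (p - ((p - \<xi>) \<bullet> \<nu>) *\<^sub>R \<nu>)"
    by (rule infdist_le)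
  then show "infdist p (tangent_plane m \<xi>) \<le> \<bar>(p - \<xi>) \<bullet> outward_normal m \<xi>\<bar>"
    using \<nu> by (simp add: dist_norm \<nu>_def [symmetric])
  have ne: "tangent_plane m \<xi> \<noteq> {}"
    by (auto simp: tangent_plane_def intro!: exI [of _ \<xi>])
  have "\<bar>(p - \<xi>) \<bullet> \<nu>\<bar> \<le> dist p x" if "x \<in> tangent_plane m \<xi>" for x
  proof -
    have "(p - \<xi>) \<bullet> \<nu> = (p - x) \<bullet> \<nu>"
      using that by (simp add: tangent_plane_def \<nu>_def [symmetric] algebra_simps)
    then show ?thesis
      using Cauchy_Schwarz_ineq2 [of "p - x" \<nu>] \<nu> by (simp add: dist_norm)
  qed
  then show "\<bar>(p - \<xi>) \<bullet> outward_normal m \<xi>\<bar> \<le> infdist p (tangent_plane m \<xi>)"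
    unfolding infdist_notempty [OF ne] by (intro cINF_greatest ne) (simp add: \<nu>_def)
qed

lemma compact_frontier_ellipsoid:
  assumes "m \<ge> 1"
  shows "compact (frontier (ellipsoid m))" "frontier (ellipsoid m) \<noteq> {}"
proof -
  have "bounded (frontier (ellipsoid m))"
    using boundary_bounds(3) [OF assms] by (auto simp: bounded_iff)
  then show "compact (frontier (ellipsoid m))"
    by (simp add: compact_eq_bounded_closed)
  have "vector [1, 0] \<in> frontier (ellipsoid m)"
    using assms by (simp add: frontier_ellipsoid)
  then show "frontier (ellipsoid m) \<noteq> {}" by blast
qed

text \<open>For a radial displacement the complex normal component is real, so the first condition
  of the approach region becomes a comparison of Euclidean distances: the right side is also the
  distance to the tangent plane.\<close>

lemma bilinear_dot_cnj_outward_normal: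
  assumes "m \<ge> 1" "\<xi> \<in> frontier (ellipsoid m)" "r \<le> 1"
  shows "cmod (bilinear_dot (\<xi> - r *\<^sub>R \<xi>) (\<chi> i. cnj (outward_normal m \<xi> $ i))) = (1 - r) * (\<xi> \<bullet> outward_normal m \<xi>)"
proof -
  define N where "N = norm (boundary_gradient m \<xi>)"
  define c where "c = (cmod (\<xi> $ 1))\<^sup>2 + real m * cmod (\<xi> $ 2) ^ (2 * m)"
  have N: "N > 0" using boundary_bounds(6) [OF assms(1,2)] by (simp add: N_def)
  have \<nu>: "outward_normal m \<xi> = inverse N *\<^sub>R boundary_gradient m \<xi>"
    by (simp add: outward_normal_eq_gradient [OF assms(1)] N_def)
  have c: "c \<ge> 0" by (simp add: c_def)
  have self: "\<xi> $ 1 * cnj (boundary_gradient m \<xi> $ 1) + \<xi> $ 2 * cnj (boundary_gradient m \<xi> $ 2) = of_real c"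
    unfolding c_def by (rule boundary_gradient_self [OF assms(1)])
  have "\<xi> \<bullet> outward_normal m \<xi> = inverse N * c"
  proof -
    have "\<xi> \<bullet> boundary_gradient m \<xi> = c"
      using arg_cong [OF self, of Re] by (simp only: inner_complex2 plus_complex.sel Re_complex_of_real)
    then show ?thesis by (simp add: \<nu>)
  qed
  moreover have "bilinear_dot (\<xi> - r *\<^sub>R \<xi>) (\<chi> i. cnj (outward_normal m \<xi> $ i)) = of_real ((1 - r) * inverse N) * of_real c"
  proof -
    have 1: "(\<xi> - r *\<^sub>R \<xi>) $ i = of_real (1 - r) * \<xi> $ i" for i
      by (simp only: vector_minus_component vector_scaleR_component) (simp add: scaleR_conv_of_real left_diff_distrib)
    have 2: "cnj (outward_normal m \<xi> $ i) = of_real (inverse N) * cnj (boundary_gradient m \<xi> $ i)" for i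
      by (simp only: \<nu> vector_scaleR_component) (simp add: scaleR_conv_of_real)
    show ?thesis
      unfolding self [symmetric] bilinear_dot_def sum_2 vec_lambda_beta 1 2 of_real_mult
      by (simp only: algebra_simps)
  qed
  ultimately show ?thesis
    using N c assms(3) by (simp only: norm_mult norm_of_real abs_mult) simp
qed

lemma scaled_frontier_ellipsoid:
  assumes "m \<ge> 1" "0 \<le> r" "r < 1" "\<xi> \<in> frontier (ellipsoid m)"
  shows "r *\<^sub>R \<xi> \<in> ellipsoid m"
proof -
  have e: "(cmod (\<xi> $ 1))\<^sup>2 + cmod (\<xi> $ 2) ^ (2 * m) = 1"
    using assms by (simp add: frontier_ellipsoid)
  have "r ^ (2 * m) \<le> r\<^sup>2" using assms by (intro power_decreasing) auto
  then have "r\<^sup>2 * (cmod (\<xi> $ 1))\<^sup>2 + r ^ (2 * m) * cmod (\<xi> $ 2) ^ (2 * m) \<le>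
      r\<^sup>2 * (cmod (\<xi> $ 1))\<^sup>2 + r\<^sup>2 * cmod (\<xi> $ 2) ^ (2 * m)"
    by (intro add_left_mono mult_right_mono) auto
  also have "\<dots> = r\<^sup>2" using e by (simp add: distrib_left [symmetric])
  also have "\<dots> < 1" using assms by (simp add: power_less_one_iff)
  finally show ?thesis using assms by (simp add: ellipsoid_def power_mult_distrib)
qed

text \<open>
  The nearest boundary point \<open>\<eta>\<close> to \<open>r \<xi>\<close> is at distance at least \<open>(1 - r) (\<eta> \<bullet> \<nu>\<^sub>\<eta>)\<close> by convexity, and
  either \<open>\<eta>\<close> is far from \<open>\<xi>\<close>, or \<open>\<eta> \<bullet> \<nu>\<^sub>\<eta>\<close> is close to \<open>\<xi> \<bullet> \<nu>\<^sub>\<xi>\<close> by uniform continuity. The bound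
  \<open>r0\<close> has to be uniform in \<open>\<xi>\<close>, so that the maximal function dominates all dilations at once.
\<close>

lemma radial_segment_in_approach_region:
  assumes m: "m \<ge> 1" and a: "a > 0"
  obtains r0 where "0 \<le> r0" "r0 < 1"
    "\<And>\<xi> r. \<xi> \<in> frontier (ellipsoid m) \<Longrightarrow> r0 \<le> r \<Longrightarrow> r < 1 \<Longrightarrow> r *\<^sub>R \<xi> \<in> approach_region m a \<xi>"
proof -
  let ?S = "frontier (ellipsoid m)"
  define h where "h \<xi> = \<xi> \<bullet> outward_normal m \<xi>" for \<xi>
  define c0 where "c0 = 1 / (1 + real m)"
  have c0: "c0 > 0" by (simp add: c0_def)
  have h_ge: "h \<xi> \<ge> c0" if "\<xi> \<in> ?S" for \<xi>
  proof -
    note b = boundary_bounds [OF m that]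
    have "h \<xi> = (\<xi> \<bullet> boundary_gradient m \<xi>) / norm (boundary_gradient m \<xi>)"
      by (simp add: h_def outward_normal_eq_gradient [OF m] divide_inverse mult.commute)
    also have "\<dots> \<ge> c0"
      unfolding c0_def using b by (intro frac_le) auto
    finally show ?thesis .
  qed
  have h_le: "h \<xi> \<le> 2" if "\<xi> \<in> ?S" for \<xi>
    using norm_cauchy_schwarz [of \<xi> "outward_normal m \<xi>"] boundary_bounds(3) [OF m that] norm_outward_normal [OF m that]
    by (simp add: h_def)
  have "continuous_on ?S h"
    unfolding h_def by (intro continuous_intros continuous_on_outward_normal m)
  then have uc: "uniformly_continuous_on ?S h"
    using compact_frontier_ellipsoid(1) [OF m] by (rule compact_uniformly_continuous)
  \<comment> \<open>With h \<xi> >= c0, a difference h \<xi> - h \<eta> below this tolerance implies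
    h \<xi> < (1 + a) h \<eta>.\<close>
  have e0: "c0 * a / (1 + a) > 0" using c0 a by simp
  from uniformly_continuous_onE [OF uc this] obtain d where d: "d > 0"
    "\<And>\<xi> \<eta>. \<xi> \<in> ?S \<Longrightarrow> \<eta> \<in> ?S \<Longrightarrow> dist \<eta> \<xi> < d \<Longrightarrow> dist (h \<eta>) (h \<xi>) < c0 * a / (1 + a)"
    by metis
  \<comment> \<open>The bound d / 5 gives 4 (1 - r) < d when the nearest boundary point is far from
    \<xi>; the last bound gives 4 (1 - r) <= c0 a / (1 + a) for the quadratic condition; the 1 keeps
    \<open>r0\<close> nonnegative.\<close>
  define r0 where "r0 = 1 - min 1 (min (d / 5) (c0 * a / (5 * (1 + a))))"
  show thesis
  proof (rule that)
    show "0 \<le> r0" by (simp add: r0_def)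
    show "r0 < 1" using d(1) c0 a by (simp add: r0_def)
    fix \<xi> r assume \<xi>: "\<xi> \<in> ?S" and r: "r0 \<le> r" "r < 1"
    have r': "0 \<le> r" "1 - r \<le> d / 5" "1 - r \<le> c0 * a / (5 * (1 + a))" "1 - r > 0"
    proof -
      have "1 - r \<le> min 1 (min (d / 5) (c0 * a / (5 * (1 + a))))"
        using r(1) by (simp only: r0_def)
      then show "0 \<le> r" "1 - r \<le> d / 5" "1 - r \<le> c0 * a / (5 * (1 + a))"
        unfolding min.bounded_iff by linarith+
    qed (use r in simp)
    note hb = h_ge [OF \<xi>] h_le [OF \<xi>]
    have T: "infdist (r *\<^sub>R \<xi>) (tangent_plane m \<xi>) = (1 - r) * h \<xi>"
    proof -
      have "(r *\<^sub>R \<xi> - \<xi>) \<bullet> outward_normal m \<xi> = - ((1 - r) * h \<xi>)"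
        by (simp add: h_def algebra_simps)
      then show ?thesis
        using infdist_tangent_plane [OF m \<xi>, of "r *\<^sub>R \<xi>"] r' hb c0 by (simp add: abs_mult)
    qed
    obtain \<eta> where \<eta>: "\<eta> \<in> ?S" "infdist (r *\<^sub>R \<xi>) ?S = dist (r *\<^sub>R \<xi>) \<eta>"
      using infdist_attains_inf [OF frontier_closed compact_frontier_ellipsoid(2) [OF m]] by metis
    have F: "(1 - r) * h \<xi> < (1 + a) * infdist (r *\<^sub>R \<xi>) ?S"
    proof (cases "dist \<eta> \<xi> < d")
      case True
      have conv: "(\<eta> - \<xi>) \<bullet> outward_normal m \<eta> \<ge> 0"
        using boundary_gradient_convex [OF m \<xi> \<eta>(1)] by (simp add: outward_normal_eq_gradient [OF m])
      have "dist (h \<eta>) (h \<xi>) < c0 * a / (1 + a)" using d(2) [OF \<xi> \<eta>(1) True] .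
      then have "h \<xi> - h \<eta> < c0 * a / (1 + a)" by (simp add: dist_real_def)
      also have "\<dots> \<le> h \<xi> * a / (1 + a)" using hb a by (intro divide_right_mono mult_right_mono) auto
      finally have "h \<xi> < (1 + a) * h \<eta>" using a by (simp add: field_simps)
      then have "(1 - r) * h \<xi> < (1 - r) * ((1 + a) * h \<eta>)"
        using r'(4) by (rule mult_strict_left_mono)
      also have "\<dots> = (1 + a) * ((1 - r) * h \<eta>)" by simp
      \<comment> \<open>Convexity enters through the splitting of \<eta> - r \<xi> as (1 - r) \<eta>
        + r (\<eta> - \<xi>).\<close>
      also have "(1 - r) * h \<eta> \<le> (1 - r) * h \<eta> + r * ((\<eta> - \<xi>) \<bullet> outward_normal m \<eta>)"
        using conv r' by simp
      also have "\<dots> = (\<eta> - r *\<^sub>R \<xi>) \<bullet> outward_normal m \<eta>"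
        by (simp add: h_def algebra_simps)
      also have "\<dots> \<le> norm (\<eta> - r *\<^sub>R \<xi>) * norm (outward_normal m \<eta>)"
        by (rule norm_cauchy_schwarz)
      also have "\<dots> = infdist (r *\<^sub>R \<xi>) ?S"
        using \<eta> norm_outward_normal [OF m \<eta>(1)] by (simp add: dist_norm norm_minus_commute)
      finally show ?thesis using a by simp
    next
      case False
      have "dist \<eta> \<xi> \<le> dist (r *\<^sub>R \<xi>) \<eta> + dist (r *\<^sub>R \<xi>) \<xi>" by (metis dist_triangle dist_commute)
      also have "dist (r *\<^sub>R \<xi>) \<xi> = (1 - r) * norm \<xi>"
      proof -
        have "r *\<^sub>R \<xi> - \<xi> = - ((1 - r) *\<^sub>R \<xi>)" by (simp add: algebra_simps)
        then show ?thesis using r' by (simp add: dist_norm)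
      qed
      also have "\<dots> \<le> (1 - r) * 2"
        using boundary_bounds(3) [OF m \<xi>] r' by (intro mult_left_mono) auto
      finally have "d \<le> infdist (r *\<^sub>R \<xi>) ?S + (1 - r) * 2" using False \<eta> by simp
      then have i: "infdist (r *\<^sub>R \<xi>) ?S > (1 - r) * 2" using r' by simp
      have "(1 - r) * h \<xi> \<le> (1 - r) * 2" using hb r' by (intro mult_left_mono) auto
      also have "\<dots> < infdist (r *\<^sub>R \<xi>) ?S" by (rule i)
      also have "\<dots> \<le> (1 + a) * infdist (r *\<^sub>R \<xi>) ?S"
        using a infdist_nonneg [of "r *\<^sub>R \<xi>" ?S] by (simp add: algebra_simps)
      finally show ?thesis .
    qed
    have h0: "(1 - r) * h \<xi> > 0" using hb c0 r' by simp
    have main: "(1 - r) * h \<xi> < (1 + a) * approach_dist m \<xi> (r *\<^sub>R \<xi>)"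
    proof -
      have "(1 + a) * ((1 - r) * h \<xi>) = (1 - r) * h \<xi> + a * ((1 - r) * h \<xi>)"
        by (simp only: distrib_right mult_1)
      then have "(1 - r) * h \<xi> < (1 + a) * ((1 - r) * h \<xi>)"
        using mult_pos_pos [OF a h0] by linarith
      then show ?thesis using F unfolding approach_dist_def T min_def by simp
    qed
    have "(norm (\<xi> - r *\<^sub>R \<xi>))\<^sup>2 < a * approach_dist m \<xi> (r *\<^sub>R \<xi>)"
    proof -
      have "\<xi> - r *\<^sub>R \<xi> = (1 - r) *\<^sub>R \<xi>" by (simp add: algebra_simps)
      then have "(norm (\<xi> - r *\<^sub>R \<xi>))\<^sup>2 = (1 - r)\<^sup>2 * (norm \<xi>)\<^sup>2"
        using r' by (simp add: power_mult_distrib)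
      also have "\<dots> \<le> (1 - r)\<^sup>2 * 2\<^sup>2"
        using boundary_bounds(3) [OF m \<xi>] by (intro mult_left_mono power_mono) auto
      also have "\<dots> = (1 - r) * (4 * (1 - r))" by (simp add: power2_eq_square)
      also have "\<dots> \<le> (1 - r) * (c0 * a / (1 + a))"
      proof (rule mult_left_mono)
        have "c0 * a / (5 * (1 + a)) = (c0 * a / (1 + a)) / 5" by simp
        then have "1 - r \<le> c0 * a / (1 + a) / 5" using r'(3) by (simp only:)
        moreover have "4 * (1 - r) \<le> K" if "1 - r \<le> K / 5" "K > 0" for K
          using that by argo
        ultimately show "4 * (1 - r) \<le> c0 * a / (1 + a)" using e0 by blast
      qed (use r' in simp)
      also have "\<dots> \<le> (1 - r) * (h \<xi> * a / (1 + a))"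
        using hb a r' by (intro mult_left_mono divide_right_mono mult_right_mono) auto
      also have "\<dots> = a * ((1 - r) * h \<xi> / (1 + a))" by simp
      also have "\<dots> < a * approach_dist m \<xi> (r *\<^sub>R \<xi>)"
        using main a by (intro mult_strict_left_mono) (simp_all add: divide_less_eq mult.commute)
      finally show ?thesis .
    qed
    moreover have "r *\<^sub>R \<xi> \<in> ellipsoid m"
      by (rule scaled_frontier_ellipsoid [OF m r'(1) r(2) \<xi>])
    ultimately show "r *\<^sub>R \<xi> \<in> approach_region m a \<xi>"
      using main bilinear_dot_cnj_outward_normal [OF m \<xi>, of r] r
      by (simp add: approach_region_def h_def)
  qed
qed

section \<open>Beta integrals and binomial series\<close>

text \<open>With b = (p + 1)/(2m) this is the Beta value B(b, j + 1)/(2m). Instead of a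
  substitution, induction on j splits off one factor 1 - s^(2m): the integral becomes a difference
  of those for p and p + 2m, and the shift of p raises b by 1. Hence the induction is for arbitrary
  p.\<close>

lemma has_bochner_integral_beta:
  assumes "m \<ge> 1" "p > 0"
  shows "has_bochner_integral lborel (\<lambda>s. indicator {0<..<1} s * ((1 - s ^ (2 * m)) ^ j * s powr p))
     (fact j / (2 * real m * pochhammer ((p + 1) / (2 * real m)) (Suc j)))"
  using assms(2)
proof (induction j arbitrary: p)
  case 0
  have "continuous_on {0..1} (\<lambda>s. s powr p)"
    using 0 by (intro continuous_on_powr') (auto intro: continuous_intros)
  then have "integrable lborel (\<lambda>s. indicator {0..1} s *\<^sub>R s powr p)"
    by (rule borel_integrable_compact [OF compact_Icc])
  then have int: "set_integrable lborel {0..1} (\<lambda>s. s powr p)"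
    by (simp add: set_integrable_def)
  have "((\<lambda>s. s powr p) has_integral (1 powr (p + 1) / (p + 1))) {0..1}"
    by (rule has_integral_powr_from_0) (use 0 in auto)
  then have "(LINT s:{0..1}|lborel. s powr p) = 1 / (p + 1)"
    using set_borel_integral_eq_integral(2) [OF int] by (simp add: integral_unique)
  with int have "has_bochner_integral lborel (\<lambda>s. indicator {0..1} s * s powr p) (1 / (p + 1))"
    by (simp add: has_bochner_integral_iff set_integrable_def set_lebesgue_integral_def)
  \<comment> \<open>Passing to the open interval removes two points, a null set.\<close>
  then have "has_bochner_integral lborel (\<lambda>s. indicator {0<..<1} s * s powr p) (1 / (p + 1))"
    by (rule has_bochner_integral_discrete_difference [where X = "{0, 1}", THEN iffD1, rotated -1])
       (auto split: split_indicator)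
  moreover have "1 / (p + 1) = fact 0 / (2 * real m * pochhammer ((p + 1) / (2 * real m)) (Suc 0))"
    using assms(1) by simp
  ultimately show ?case by simp
next
  case (Suc j)
  define b where "b = (p + 1) / (2 * real m)"
  have b: "b > 0" using Suc.prems assms(1) by (simp add: b_def)
  have b1: "(p + 2 * real m + 1) / (2 * real m) = b + 1"
    using assms(1) by (simp add: b_def field_simps)
  define Q where "Q = pochhammer (b + 1) j"
  have Q: "Q > 0" using b by (simp add: Q_def pochhammer_pos)
  have "has_bochner_integral lborel (\<lambda>s. indicator {0<..<1} s * ((1 - s ^ (2 * m)) ^ j * s powr p)
        - indicator {0<..<1} s * ((1 - s ^ (2 * m)) ^ j * s powr (p + 2 * real m)))
     (fact j / (2 * real m * pochhammer b (Suc j)) - fact j / (2 * real m * pochhammer (b + 1) (Suc j)))"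
    using has_bochner_integral_diff [OF Suc.IH [OF Suc.prems] Suc.IH [of "p + 2 * real m"]] Suc.prems
    by (simp add: b1 b_def [symmetric] del: pochhammer_Suc)
  moreover have "indicator {0<..<1} s * ((1 - s ^ (2 * m)) ^ j * s powr p)
        - indicator {0<..<1} s * ((1 - s ^ (2 * m)) ^ j * s powr (p + 2 * real m))
      = indicator {0<..<1} s * ((1 - s ^ (2 * m)) ^ Suc j * s powr p)" for s :: real
  proof (cases "s \<in> {0<..<1}")
    case True
    then have "s powr (p + 2 * real m) = s powr p * s ^ (2 * m)"
      using powr_realpow [of s "2 * m"] by (simp add: powr_add)
    then show ?thesis by (simp add: algebra_simps)
  qed simp
  moreover have "fact j / (2 * real m * pochhammer b (Suc j)) - fact j / (2 * real m * pochhammer (b + 1) (Suc j))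
      = fact (Suc j) / (2 * real m * pochhammer b (Suc (Suc j)))"
  proof -
    have 1: "pochhammer b (Suc j) = b * Q" by (simp only: Q_def pochhammer_rec)
    have 2: "pochhammer (b + 1) (Suc j) = (b + 1 + real j) * Q" by (simp only: Q_def pochhammer_rec')
    have 3: "pochhammer b (Suc (Suc j)) = b * ((b + 1 + real j) * Q)" by (simp only: pochhammer_rec [of b] 2)
    show ?thesis
      unfolding 1 2 3 using b Q assms(1) by (simp add: divide_simps) (simp add: algebra_simps)
  qed
  ultimately show ?case by (simp only: b_def)
qed

text \<open>The binomial series with exponent -b - 1, after splitting the first factor b off the
  Pochhammer symbol.\<close>

lemma sums_pochhammer_power:
  fixes b x :: real
  assumes "0 \<le> x" "x < 1"
  shows "(\<lambda>j. pochhammer b (Suc j) / fact j * x ^ j) sums (b * (1 - x) powr (- b - 1))"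
proof -
  have "(\<lambda>n. ((- b - 1) gchoose n) * (- x) ^ n) sums (1 + - x) powr (- b - 1)"
    by (rule gen_binomial_real) (use assms in auto)
  moreover have "((- b - 1) gchoose n) * (- x) ^ n = pochhammer (b + 1) n / fact n * x ^ n" for n
  proof -
    have "(- 1) ^ n * (- x) ^ n = x ^ n"
      by (simp add: power_mult_distrib [symmetric])
    then show ?thesis by (simp add: gbinomial_pochhammer algebra_simps)
  qed
  ultimately have "(\<lambda>n. pochhammer (b + 1) n / fact n * x ^ n) sums (1 - x) powr (- b - 1)"
    by simp
  from sums_mult [OF this, of b] show ?thesis
    by (simp add: pochhammer_rec mult.assoc)
qed

text \<open>The coefficient is (k + 1)/m + (m - 1)/(3m), a combination of the geometric series and
  its derivative. Over the common denominator the numerator is m + 2 - (m - 1) u, which is where the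
  ratio (m - 1)/(m + 2) originates.\<close>

lemma sums_linear_geometric:
  fixes u :: real
  assumes "0 \<le> u" "u < 1" "m \<ge> 1"
  shows "(\<lambda>k. (3 * real k + real m + 2) / (3 * real m) * u ^ k) sums
    ((real m + 2) / (3 * real m) * ((1 - (real m - 1) / (real m + 2) * u) / (1 - u)\<^sup>2))"
proof -
  have 1: "(\<lambda>k. real (Suc k) * u ^ k) sums (1 / (1 - u)\<^sup>2)"
    using geometric_deriv_sums [of u] assms by simp
  have 2: "(\<lambda>k. u ^ k) sums (1 / (1 - u))"
    using geometric_sums [of u] assms by simp
  have "(\<lambda>k. 1 / real m * (real (Suc k) * u ^ k) + (real m - 1) / (3 * real m) * u ^ k) sums
      (1 / real m * (1 / (1 - u)\<^sup>2) + (real m - 1) / (3 * real m) * (1 / (1 - u)))"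
    by (intro sums_add sums_mult 1 2)
  moreover have "1 / real m * (real (Suc k) * u ^ k) + (real m - 1) / (3 * real m) * u ^ k =
      (3 * real k + real m + 2) / (3 * real m) * u ^ k" for k
    using assms(3) by (simp add: field_simps)
  moreover have "1 / real m * (1 / (1 - u)\<^sup>2) + (real m - 1) / (3 * real m) * (1 / (1 - u)) =
      (real m + 2) / (3 * real m) * ((1 - (real m - 1) / (real m + 2) * u) / (1 - u)\<^sup>2)"
  proof -
    define v where "v = 1 - u"
    have v: "v \<noteq> 0" "u = 1 - v" using assms by (auto simp: v_def)
    have "real m \<noteq> 0" "real m + 2 \<noteq> 0" using assms by auto
    then show ?thesis
      unfolding v_def [symmetric] unfolding v(2) using v(1)
      by (simp add: divide_simps power2_eq_square) (simp add: algebra_simps)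
  qed
  ultimately show ?thesis by simp
qed

section \<open>Complex Hessians of invariant potentials\<close>

lemma has_derivative_cmod_square:
  "((\<lambda>c. (cmod (a + c))\<^sup>2) has_derivative (\<lambda>h. 2 * Re (cnj a * h))) (at 0)"
proof -
  have "((\<lambda>c. (Re (a + c))\<^sup>2 + (Im (a + c))\<^sup>2) has_derivative (\<lambda>h. 2 * Re a * Re h + 2 * Im a * Im h)) (at 0)"
    by (auto intro!: derivative_eq_intros simp: algebra_simps)
  then show ?thesis by (simp add: cmod_power2 algebra_simps)
qed

lemma has_derivative_radial:
  assumes "(h has_real_derivative h') (at ((cmod a)\<^sup>2))"
  shows "((\<lambda>c. complex_of_real (h ((cmod (a + c))\<^sup>2))) has_derivative
     (\<lambda>k. of_real h' * (cnj a * k + a * cnj k))) (at 0)"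
proof -
  have "((\<lambda>c. h ((cmod (a + c))\<^sup>2)) has_derivative (\<lambda>k. h' * (2 * Re (cnj a * k)))) (at 0)"
  proof (rule has_derivative_compose [OF has_derivative_cmod_square])
    show "(h has_derivative (\<lambda>k. h' * k)) (at ((cmod (a + 0))\<^sup>2))"
      using assms by (simp add: has_field_derivative_def)
  qed
  then have "((\<lambda>c. complex_of_real (h ((cmod (a + c))\<^sup>2))) has_derivative (\<lambda>k. of_real (h' * (2 * Re (cnj a * k))))) (at 0)"
    by (rule has_derivative_of_real)
  moreover have "of_real (h' * (2 * Re (cnj a * k))) = of_real h' * (cnj a * k + a * cnj k)" for k
    using complex_add_cnj [of "cnj a * k"] by simp
  ultimately show ?thesis by (simp only:)
qed

text \<open>The factor \<open>b\<close> collects what depends only on the other coordinate, which is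
  frozen in the slot \<open>i\<close>.\<close>

lemma has_wirtinger_radial:
  assumes "(h has_real_derivative h') (at ((cmod (p $ i))\<^sup>2))"
    and "\<And>c. f (p + axis i c) = b * of_real (h ((cmod (p $ i + c))\<^sup>2))"
  shows "has_wirtinger f p i (b * of_real h' * cnj (p $ i)) (b * of_real h' * p $ i)"
proof -
  have "((\<lambda>c. b * of_real (h ((cmod (p $ i + c))\<^sup>2))) has_derivative
      (\<lambda>k. b * (of_real h' * (cnj (p $ i) * k + p $ i * cnj k)))) (at 0)"
    by (rule has_derivative_mult_right [OF has_derivative_radial [OF assms(1)]])
  then show ?thesis
    by (simp add: has_wirtinger_def assms(2) algebra_simps)
qed

text \<open>The antiholomorphic derivative of a radial function carries the factor
  \<open>p $ i\<close>; this is the product rule for differentiating it again in the same slot, as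
  the diagonal of the Hessian requires.\<close>

lemma has_wirtinger_radial_mult:
  assumes "(h has_real_derivative h') (at ((cmod (p $ i))\<^sup>2))"
    and "\<And>c. f (p + axis i c) = (p $ i + c) * of_real (h ((cmod (p $ i + c))\<^sup>2))"
  shows "has_wirtinger f p i (of_real (h ((cmod (p $ i))\<^sup>2) + (cmod (p $ i))\<^sup>2 * h')) ((p $ i)\<^sup>2 * of_real h')"
proof -
  have "((\<lambda>c. (p $ i + c) * of_real (h ((cmod (p $ i + c))\<^sup>2))) has_derivative
      (\<lambda>k. (p $ i + 0) * (of_real h' * (cnj (p $ i) * k + p $ i * cnj k)) + k * of_real (h ((cmod (p $ i + 0))\<^sup>2)))) (at 0)"
    by (rule has_derivative_mult [OF _ has_derivative_radial [OF assms(1)]]) (auto intro!: derivative_eq_intros)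
  moreover have "(p $ i + 0) * (of_real h' * (cnj (p $ i) * k + p $ i * cnj k)) + k * of_real (h ((cmod (p $ i + 0))\<^sup>2)) =
      of_real (h ((cmod (p $ i))\<^sup>2) + (cmod (p $ i))\<^sup>2 * h') * k + (p $ i)\<^sup>2 * of_real h' * cnj k" for k
  proof -
    have "complex_of_real ((cmod (p $ i))\<^sup>2) = p $ i * cnj (p $ i)"
      by (simp only: complex_norm_square)
    moreover have "a * (b * (cnj a * k + a * cnj k)) + k * c = (c + a * cnj a * b) * k + a\<^sup>2 * b * cnj k" for a b c :: complex
      by (simp add: algebra_simps power2_eq_square)
    ultimately show ?thesis
      by (simp only: add_0_right of_real_add of_real_mult)
  qed
  ultimately show ?thesis
    unfolding has_wirtinger_def assms(2) by (simp only:)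
qed

definition scaled_modulus :: "nat \<Rightarrow> real \<Rightarrow> real \<Rightarrow> real" where
  "scaled_modulus m x y = y * (1 - x) powr (- 1 / real m)"

text \<open>The m-th power of the scaled modulus is |w|^(2m) / (1 - |z|^2), so the inequality
  defining the domain becomes u < 1.\<close>

lemma scaled_modulus_ellipsoid:
  assumes "m \<ge> 1" "p \<in> ellipsoid m"
  shows "(cmod (p $ 1))\<^sup>2 < 1"
    and "scaled_modulus m ((cmod (p $ 1))\<^sup>2) ((cmod (p $ 2))\<^sup>2) \<in> {0..<1}"
proof -
  define x y where "x = (cmod (p $ 1))\<^sup>2" and "y = (cmod (p $ 2))\<^sup>2"
  have xy: "x \<ge> 0" "y \<ge> 0" "x + y ^ m < 1"
    using assms(2) by (simp_all add: x_def y_def ellipsoid_def power_mult)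
  have "0 \<le> y ^ m" using xy(2) by simp
  then show x1: "(cmod (p $ 1))\<^sup>2 < 1" using xy(3) by (simp add: x_def [symmetric])
  have "scaled_modulus m x y ^ m = y ^ m * ((1 - x) powr (- 1 / real m)) ^ m"
    by (simp add: scaled_modulus_def power_mult_distrib)
  also have "((1 - x) powr (- 1 / real m)) ^ m = ((1 - x) powr (- 1 / real m)) powr real m"
    using x1 by (subst powr_realpow) (simp_all add: x_def)
  also have "\<dots> = 1 / (1 - x)"
  proof -
    have "- 1 / real m * real m = -1" using assms(1) by simp
    then show ?thesis using x1 by (simp only: powr_powr powr_minus_divide) (simp add: x_def)
  qed
  finally have "scaled_modulus m x y ^ m < 1"
    using xy x1 by (simp add: x_def [symmetric] divide_less_eq)
  moreover have "scaled_modulus m x y \<ge> 0"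
    using xy by (simp add: scaled_modulus_def)
  ultimately show "scaled_modulus m ((cmod (p $ 1))\<^sup>2) ((cmod (p $ 2))\<^sup>2) \<in> {0..<1}"
    using assms(1) power_less_one_iff [of "scaled_modulus m x y" m] by (simp add: x_def y_def)
qed

text \<open>The derivative in \<open>x\<close> is again a multiple of u, so differentiating a
  function of u produces functions of u and powers of 1 - x only.\<close>

lemma scaled_modulus_derivatives:
  assumes "x < 1"
  shows "((\<lambda>x. scaled_modulus m x y) has_real_derivative (scaled_modulus m x y / (real m * (1 - x)))) (at x)"
    and "((\<lambda>y. scaled_modulus m x y) has_real_derivative ((1 - x) powr (- 1 / real m))) (at y)"
proof -
  have "((\<lambda>x. y * (1 - x) powr (- 1 / real m)) has_real_derivative
      (y * (1 / real m * (1 - x) powr (- 1 / real m - 1)))) (at x)"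
    using assms by (auto intro!: derivative_eq_intros)
  moreover have "(1 - x) powr (- 1 / real m - 1) = (1 - x) powr (- 1 / real m) / (1 - x)"
    using assms by (simp add: powr_diff)
  ultimately show "((\<lambda>x. scaled_modulus m x y) has_real_derivative (scaled_modulus m x y / (real m * (1 - x)))) (at x)"
    by (simp add: scaled_modulus_def mult.commute)
  show "((\<lambda>y. scaled_modulus m x y) has_real_derivative ((1 - x) powr (- 1 / real m))) (at y)"
    unfolding scaled_modulus_def by (auto intro!: derivative_eq_intros)
qed

text \<open>
  Functions of this shape depend, up to a logarithm of \<open>1 - |z|\<^sup>2\<close>, only on the modulus \<open>u\<close> that is invariant
  under the automorphisms of the domain. Both \<open>log S\<close> and the logarithm of the determinant of its
  complex Hessian are of this shape, so one computation gives the metric and its Ricci curvature.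
\<close>

locale ellipsoid_potential =
  fixes m :: nat and \<kappa> :: real and L L' L'' :: "real \<Rightarrow> real" and G :: "complex^2 \<Rightarrow> complex"
  assumes m: "m \<ge> 1"
    and L: "\<And>u. 0 \<le> u \<Longrightarrow> u < 1 \<Longrightarrow> (L has_real_derivative L' u) (at u)"
    and L': "\<And>u. 0 \<le> u \<Longrightarrow> u < 1 \<Longrightarrow> (L' has_real_derivative L'' u) (at u)"
    and G: "\<And>p. p \<in> ellipsoid m \<Longrightarrow> G p =
      of_real (- \<kappa> * ln (1 - (cmod (p $ 1))\<^sup>2) + L (scaled_modulus m ((cmod (p $ 1))\<^sup>2) ((cmod (p $ 2))\<^sup>2)))"
begin

text \<open>\<open>Q u\<close> is 1 - x times the derivative of the potential in x = |z|^2, and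
  \<open>M\<close> is the derivative of u L'(u), so Q' = M / m. The whole Hessian is expressed
  through these two functions.\<close>

definition "Q u = \<kappa> + u * L' u / real m"
definition "M u = L' u + u * L'' u"

lemma Q_derivative:
  assumes "0 \<le> u" "u < 1"
  shows "(Q has_real_derivative M u / real m) (at u)"
  unfolding Q_def [abs_def] M_def
  using m by (auto intro!: derivative_eq_intros L' [OF assms] simp: algebra_simps add_divide_distrib)

context
  fixes p :: "complex^2" and x y u v :: real
  assumes p: "p \<in> ellipsoid m"
  defines "x \<equiv> (cmod (p $ 1))\<^sup>2" and "y \<equiv> (cmod (p $ 2))\<^sup>2"
  defines "v \<equiv> 1 - x" and "u \<equiv> scaled_modulus m x y"
begin

lemma v_pos: "x < 1" "0 < v" and u_range: "0 \<le> u" "u < 1"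
  using scaled_modulus_ellipsoid [OF m p] by (auto simp: x_def y_def u_def v_def)

text \<open>In each slot the potential depends on the squared modulus alone, so the antiholomorphic
  derivative is the coordinate times a real derivative in x or y. Since \<open>p\<close> is any
  point of the domain, the result may be differentiated again.\<close>

lemma wirtinger_bar_potential:
  shows "wirtinger_bar 1 G p = p $ 1 * of_real (Q u / v)"
    and "wirtinger_bar 2 G p = p $ 2 * of_real (L' u * v powr (- 1 / real m))"
proof -
  let ?G = "\<lambda>p. complex_of_real (- \<kappa> * ln (1 - (cmod (p $ 1))\<^sup>2) + L (scaled_modulus m ((cmod (p $ 1))\<^sup>2) ((cmod (p $ 2))\<^sup>2)))"
  have cong: "has_wirtinger G p i A B" if "has_wirtinger ?G p i A B" for i A B
    using has_wirtinger_cong [OF that open_ellipsoid p G] by blast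
  have Lu: "(L has_real_derivative L' u) (at u)" by (rule L [OF u_range])
  have "((\<lambda>x. - \<kappa> * ln (1 - x) + L (scaled_modulus m x y)) has_real_derivative
      (\<kappa> / v + L' u * (u / (real m * v)))) (at x)"
    using v_pos m unfolding v_def u_def
    by (auto intro!: derivative_eq_intros DERIV_chain' [OF scaled_modulus_derivatives(1) Lu [unfolded u_def]] simp: divide_simps)
  then have "has_wirtinger ?G p 1 (1 * of_real (\<kappa> / v + L' u * (u / (real m * v))) * cnj (p $ 1))
      (1 * of_real (\<kappa> / v + L' u * (u / (real m * v))) * p $ 1)"
    unfolding x_def by (rule has_wirtinger_radial) (simp add: y_def)
  moreover have "\<kappa> / v + L' u * (u / (real m * v)) = Q u / v"
    by (simp add: Q_def add_divide_distrib mult.commute)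
  ultimately show "wirtinger_bar 1 G p = p $ 1 * of_real (Q u / v)"
    using has_wirtinger_imp(2) [OF cong] by (simp only: mult_1 mult.commute)
  have "((\<lambda>y. - \<kappa> * ln (1 - x) + L (scaled_modulus m x y)) has_real_derivative
      (L' u * v powr (- 1 / real m))) (at y)"
    using v_pos m unfolding v_def u_def
    by (auto intro!: derivative_eq_intros DERIV_chain' [OF scaled_modulus_derivatives(2) Lu [unfolded u_def]])
  then have "has_wirtinger ?G p 2 (1 * of_real (L' u * v powr (- 1 / real m)) * cnj (p $ 2))
      (1 * of_real (L' u * v powr (- 1 / real m)) * p $ 2)"
    unfolding y_def by (rule has_wirtinger_radial) (simp add: x_def)
  then show "wirtinger_bar 2 G p = p $ 2 * of_real (L' u * v powr (- 1 / real m))"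
    using has_wirtinger_imp(2) [OF cong] by (simp only: mult_1 mult.commute)
qed

end

text \<open>Diagonal entries differentiate a coordinate times a radial function; off-diagonal
  entries differentiate a radial function with the other coordinate as a constant factor.\<close>

lemma hessian_potential:
  fixes p :: "complex^2" and x y u v :: real
  assumes p: "p \<in> ellipsoid m"
  defines "x \<equiv> (cmod (p $ 1))\<^sup>2" and "y \<equiv> (cmod (p $ 2))\<^sup>2"
  defines "v \<equiv> 1 - x" and "u \<equiv> scaled_modulus m x y"
  shows "wirtinger 1 (wirtinger_bar 1 G) p = of_real ((Q u + x * u * M u / (real m)\<^sup>2) / v\<^sup>2)"
    and "wirtinger 2 (wirtinger_bar 1 G) p = p $ 1 * cnj (p $ 2) * of_real (M u * v powr (- 1 / real m) / (real m * v))"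
    and "wirtinger 1 (wirtinger_bar 2 G) p = p $ 2 * cnj (p $ 1) * of_real (M u * v powr (- 1 / real m) / (real m * v))"
    and "wirtinger 2 (wirtinger_bar 2 G) p = of_real (M u * v powr (- 1 / real m))"
proof -
  let ?G1 = "\<lambda>p. p $ 1 * complex_of_real (Q (scaled_modulus m ((cmod (p $ 1))\<^sup>2) ((cmod (p $ 2))\<^sup>2)) / (1 - (cmod (p $ 1))\<^sup>2))"
  let ?G2 = "\<lambda>p. p $ 2 * complex_of_real (L' (scaled_modulus m ((cmod (p $ 1))\<^sup>2) ((cmod (p $ 2))\<^sup>2)) * (1 - (cmod (p $ 1))\<^sup>2) powr (- 1 / real m))"
  note v = v_pos [OF p, folded x_def y_def v_def u_def] and u = u_range [OF p, folded x_def y_def v_def u_def]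
  have cong: "wirtinger i (wirtinger_bar 1 G) p = A" if "has_wirtinger ?G1 p i A B" for i A B
    using has_wirtinger_imp(1) [OF has_wirtinger_cong [OF that open_ellipsoid p wirtinger_bar_potential(1)]] .
  have cong2: "wirtinger i (wirtinger_bar 2 G) p = A" if "has_wirtinger ?G2 p i A B" for i A B
    using has_wirtinger_imp(1) [OF has_wirtinger_cong [OF that open_ellipsoid p wirtinger_bar_potential(2)]] .
  note Qu = Q_derivative [OF u] and Lu = L' [OF u]
  note [derivative_intros] = DERIV_chain' [OF scaled_modulus_derivatives(1) [OF v(1)], OF Qu [unfolded u_def]]
    DERIV_chain' [OF scaled_modulus_derivatives(2) [OF v(1)], OF Qu [unfolded u_def]]
    DERIV_chain' [OF scaled_modulus_derivatives(1) [OF v(1)], OF Lu [unfolded u_def]]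
    DERIV_chain' [OF scaled_modulus_derivatives(2) [OF v(1)], OF Lu [unfolded u_def]]
  have 11: "((\<lambda>x. Q (scaled_modulus m x y) / (1 - x)) has_real_derivative
      ((u * M u / (real m)\<^sup>2 + Q u) / v\<^sup>2)) (at x)"
    using v m unfolding v_def u_def
    by (auto intro!: derivative_eq_intros simp: power2_eq_square)
  have hw: "has_wirtinger ?G1 p 1 (of_real (Q u / v + x * ((u * M u / (real m)\<^sup>2 + Q u) / v\<^sup>2)))
      ((p $ 1)\<^sup>2 * of_real ((u * M u / (real m)\<^sup>2 + Q u) / v\<^sup>2))"
    using has_wirtinger_radial_mult [OF 11 [unfolded x_def], of ?G1]
    by (simp add: x_def y_def u_def v_def)
  \<comment> \<open>Writing 1/v as v / v^2 and using x + v = 1, the two terms with Q combine to Q /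
    v^2.\<close>
  have eq: "Q u / v + x * ((u * M u / (real m)\<^sup>2 + Q u) / v\<^sup>2) = (Q u + x * u * M u / (real m)\<^sup>2) / v\<^sup>2"
  proof -
    have "Q u / v = Q u * v / v\<^sup>2" using v by (simp add: power2_eq_square)
    moreover have "x = 1 - v" by (simp add: v_def)
    ultimately show ?thesis by (simp add: add_divide_distrib [symmetric]) (simp add: algebra_simps)
  qed
  show "wirtinger 1 (wirtinger_bar 1 G) p = of_real ((Q u + x * u * M u / (real m)\<^sup>2) / v\<^sup>2)"
    using cong [OF hw] unfolding eq .
  have 12: "((\<lambda>y. Q (scaled_modulus m x y) / (1 - x)) has_real_derivative
      (M u * v powr (- 1 / real m) / (real m * v))) (at y)"
    using v m unfolding v_def u_def
    by (auto intro!: derivative_eq_intros)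
  show "wirtinger 2 (wirtinger_bar 1 G) p = p $ 1 * cnj (p $ 2) * of_real (M u * v powr (- 1 / real m) / (real m * v))"
    using cong [OF has_wirtinger_radial [OF 12 [unfolded y_def], of ?G1 "p $ 1"]]
    by (simp add: x_def y_def u_def v_def mult_ac)
  have 21: "((\<lambda>x. L' (scaled_modulus m x y) * (1 - x) powr (- 1 / real m)) has_real_derivative
      (M u * v powr (- 1 / real m) / (real m * v))) (at x)"
  proof -
    have P: "((\<lambda>x. (1 - x) powr (- 1 / real m)) has_real_derivative (v powr (- 1 / real m) / (real m * v))) (at x)"
      using scaled_modulus_derivatives(1) [OF v(1), of m 1] by (simp add: scaled_modulus_def v_def)
    have "((\<lambda>x. L' (scaled_modulus m x y)) has_real_derivative L'' u * (u / (real m * v))) (at x)"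
      using DERIV_chain' [OF scaled_modulus_derivatives(1) [OF v(1)] Lu [unfolded u_def]]
      by (simp add: u_def v_def)
    from DERIV_mult [OF this P] show ?thesis
      by (rule DERIV_cong) (simp add: M_def u_def v_def algebra_simps add_divide_distrib)
  qed
  show "wirtinger 1 (wirtinger_bar 2 G) p = p $ 2 * cnj (p $ 1) * of_real (M u * v powr (- 1 / real m) / (real m * v))"
    using cong2 [OF has_wirtinger_radial [OF 21 [unfolded x_def], of ?G2 "p $ 2"]]
    by (simp add: x_def y_def u_def v_def mult_ac)
  have 22: "((\<lambda>y. L' (scaled_modulus m x y) * (1 - x) powr (- 1 / real m)) has_real_derivative
      (L'' u * v powr (- 1 / real m) * v powr (- 1 / real m))) (at y)"
    using v m unfolding v_def u_def
    by (auto intro!: derivative_eq_intros)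
  have hw2: "has_wirtinger ?G2 p 2 (of_real (L' u * v powr (- 1 / real m) + y * (L'' u * v powr (- 1 / real m) * v powr (- 1 / real m))))
      ((p $ 2)\<^sup>2 * of_real (L'' u * v powr (- 1 / real m) * v powr (- 1 / real m)))"
    using has_wirtinger_radial_mult [OF 22 [unfolded y_def], of ?G2]
    by (simp add: x_def y_def u_def v_def)
  \<comment> \<open>Here y v^(-1/m) is u, which turns L' + y L'' v^(-1/m) into M.\<close>
  have eq2: "L' u * v powr (- 1 / real m) + y * (L'' u * v powr (- 1 / real m) * v powr (- 1 / real m))
      = M u * v powr (- 1 / real m)"
    by (simp add: M_def u_def v_def scaled_modulus_def algebra_simps)
  show "wirtinger 2 (wirtinger_bar 2 G) p = of_real (M u * v powr (- 1 / real m))"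
    using cong2 [OF hw2] unfolding eq2 .
qed

end

section \<open>The Fefferman measure in torus coordinates\<close>

text \<open>The density is the product of the area factor and the Fefferman weight along the
  parametrization; it depends on s = |w| only, so the angles separate.\<close>

definition radial_measure :: "nat \<Rightarrow> real measure" where
  "radial_measure m =
     density (restrict_space lborel {0<..<1}) (\<lambda>s. ennreal (root 3 ((real m)\<^sup>2 * s ^ (2 * m - 2)) * s))"

text \<open>The parametrization \<open>boundary_param\<close> on nested pairs instead of
  \<open>real^3\<close>, so that product measures and Fubini's theorem apply.\<close>

definition torus_point :: "nat \<Rightarrow> real \<times> real \<times> real \<Rightarrow> complex^2" where
  "torus_point m = (\<lambda>(s, \<theta>, \<phi>). vector [of_real (sqrt (1 - s ^ (2 * m))) * cis \<theta>, of_real s * cis \<phi>])"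

lemma boundary_param_torus_point: "boundary_param m (vector [s, \<theta>, \<phi>]) = torus_point m (s, \<theta>, \<phi>)"
  by (simp add: boundary_param_def torus_point_def)

lemma continuous_on_torus_point: "continuous_on UNIV (torus_point m)"
  unfolding torus_point_def case_prod_unfold by (intro continuous_intros)

lemma torus_point_frontier:
  assumes "m \<ge> 1" "0 \<le> s" "s \<le> 1"
  shows "torus_point m (s, \<theta>, \<phi>) \<in> frontier (ellipsoid m)"
proof -
  have "s ^ (2 * m) \<le> 1" using assms by (simp add: power_le_one)
  then show ?thesis using assms by (simp add: frontier_ellipsoid torus_point_def norm_mult)
qed

section \<open>Lebesgue measure on three-space as an iterated product\<close>

lemma continuous_on_vector3:
  fixes f g h :: "'a::topological_space \<Rightarrow> real"
  assumes "continuous_on X f" "continuous_on X g" "continuous_on X h"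
  shows "continuous_on X (\<lambda>x. vector [f x, g x, h x] :: real^3)"
proof -
  have "continuous_on X (\<lambda>x. \<chi> i. (vector [f x, g x, h x] :: real^3) $ i)"
  proof (rule continuous_on_vec_lambda)
    show "continuous_on X (\<lambda>x. (vector [f x, g x, h x] :: real^3) $ i)" for i
      using exhaust_3 [of i] assms by auto
  qed
  then show ?thesis by (simp only: vec_lambda_eta)
qed

text \<open>Lebesgue measure is determined by the volumes of boxes, and a box pulls back under the
  coordinate map to a product of intervals.\<close>

lemma lborel_real3_eq_distr:
  "distr (lborel :: (real \<times> real \<times> real) measure) borel (\<lambda>p. vector [fst p, fst (snd p), snd (snd p)]) = (lborel :: (real^3) measure)"
proof (rule lborel_eqI [symmetric])
  let ?T = "\<lambda>p::real \<times> real \<times> real. vector [fst p, fst (snd p), snd (snd p)] :: real^3"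
  fix l u :: "real^3" assume le: "\<And>b. b \<in> Basis \<Longrightarrow> l \<bullet> b \<le> u \<bullet> b"
  have le: "l $ i \<le> u $ i" for i
    using le [of "axis i 1"] by (simp add: inner_axis axis_in_Basis_iff)
  have contT: "continuous_on UNIV ?T"
    by (intro continuous_on_vector3 continuous_intros)
  have "?T -` box l u = {l $ 1<..<u $ 1} \<times> {l $ 2<..<u $ 2} \<times> {l $ 3<..<u $ 3}"
    by (auto simp: mem_box_cart forall_3)
  then have "emeasure (distr lborel borel ?T) (box l u) =
      emeasure lborel ({l $ 1<..<u $ 1} \<times> {l $ 2<..<u $ 2} \<times> {l $ 3<..<u $ 3})"
    by (simp add: emeasure_distr borel_measurable_continuous_onI [OF contT])
  also have "\<dots> = emeasure lborel {l $ 1<..<u $ 1} * emeasure lborel ({l $ 2<..<u $ 2} \<times> {l $ 3<..<u $ 3})"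
    unfolding lborel_prod [symmetric, where ?'b = "real \<times> real"]
    by (rule lborel.emeasure_pair_measure_Times) (auto intro!: borel_open open_Times)
  also have "emeasure lborel ({l $ 2<..<u $ 2} \<times> {l $ 3<..<u $ 3}) = emeasure lborel {l $ 2<..<u $ 2} * emeasure lborel {l $ 3<..<u $ 3}"
    unfolding lborel_prod [symmetric]
    by (rule lborel.emeasure_pair_measure_Times) auto
  also have "emeasure lborel {l $ 1<..<u $ 1} * (emeasure lborel {l $ 2<..<u $ 2} * emeasure lborel {l $ 3<..<u $ 3})
      = ennreal ((u $ 1 - l $ 1) * ((u $ 2 - l $ 2) * (u $ 3 - l $ 3)))"
    using le by (simp add: ennreal_mult)
  also have "(u $ 1 - l $ 1) * ((u $ 2 - l $ 2) * (u $ 3 - l $ 3)) = (\<Prod>b\<in>Basis. (u - l) \<bullet> b)"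
  proof -
    have "(\<Prod>b\<in>(Basis :: (real^3) set). (u - l) \<bullet> b) = (\<Prod>i\<in>UNIV. (u - l) \<bullet> axis i 1)"
    proof -
      have B: "(Basis :: (real^3) set) = range (\<lambda>i. axis i 1)" by (auto simp: Basis_vec_def)
      have "inj (\<lambda>i::3. axis i (1::real))" by (auto simp: inj_on_def axis_eq_axis)
      then show ?thesis unfolding B by (rule prod.reindex [unfolded o_def])
    qed
    also have "\<dots> = (u $ 1 - l $ 1) * ((u $ 2 - l $ 2) * (u $ 3 - l $ 3))"
    proof -
      have "prod f (UNIV :: 3 set) = f 1 * (f 2 * f 3)" for f :: "3 \<Rightarrow> real"
        unfolding UNIV_3 by (simp add: ac_simps)
      then show ?thesis by (simp only: inner_axis vector_minus_component inner_real_def mult_1_right)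
    qed
    finally show ?thesis by simp
  qed
  finally show "emeasure (distr lborel borel ?T) (box l u) = (\<Prod>b\<in>Basis. (u - l) \<bullet> b)" .
qed simp

section \<open>The area element of the boundary\<close>

lemma has_derivative_vector2:
  fixes f g :: "'a::real_normed_vector \<Rightarrow> complex"
  assumes "(f has_derivative f') (at x within S)" "(g has_derivative g') (at x within S)"
  shows "((\<lambda>x. vector [f x, g x] :: complex^2) has_derivative (\<lambda>h. vector [f' h, g' h])) (at x within S)"
proof -
  have "linear (\<lambda>p::complex \<times> complex. vector [fst p, snd p] :: complex^2)"
    by (rule linearI) (simp_all add: vec_eq_iff forall_2)
  then have "bounded_linear (\<lambda>p::complex \<times> complex. vector [fst p, snd p] :: complex^2)"
    by (rule linear_conv_bounded_linear [THEN iffD1])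
  from bounded_linear.has_derivative [OF this has_derivative_Pair [OF assms]] show ?thesis by simp
qed

lemma has_derivative_boundary_param:
  fixes u :: "real^3"
  assumes "m \<ge> 1" "0 < u $ 1" "u $ 1 < 1"
  shows "(boundary_param m has_derivative (\<lambda>h. vector
     [of_real (- (real m * (u $ 1) ^ (2 * m - 1)) / sqrt (1 - (u $ 1) ^ (2 * m)) * h $ 1) * cis (u $ 2)
        + of_real (sqrt (1 - (u $ 1) ^ (2 * m)) * h $ 2) * (\<i> * cis (u $ 2)),
      of_real (h $ 1) * cis (u $ 3) + of_real (u $ 1 * h $ 3) * (\<i> * cis (u $ 3))])) (at u)"
proof -
  let ?R = "sqrt (1 - (u $ 1) ^ (2 * m))"
  have lt: "(u $ 1) ^ (2 * m) < 1" using assms by (simp add: power_less_one_iff)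
  have nth: "((\<lambda>u::real^3. u $ i) has_derivative (\<lambda>h. h $ i)) (at u)" for i
    by (rule bounded_linear_imp_has_derivative [OF bounded_linear_vec_nth])
  have cis: "((\<lambda>u::real^3. cis (u $ i)) has_derivative (\<lambda>h. of_real (h $ i) * (\<i> * cis (u $ i)))) (at u)" for i
    using has_derivative_cis [OF nth [of i]] by (simp add: scaleR_conv_of_real)
  have sq: "((\<lambda>u::real^3. sqrt (1 - (u $ 1) ^ (2 * m))) has_derivative
      (\<lambda>h. - (real m * (u $ 1) ^ (2 * m - 1)) / ?R * h $ 1)) (at u)"
    using lt by (auto intro!: derivative_eq_intros nth simp: field_simps)
  have 1: "((\<lambda>u::real^3. of_real (sqrt (1 - (u $ 1) ^ (2 * m))) * cis (u $ 2)) has_derivative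
      (\<lambda>h. of_real ?R * (of_real (h $ 2) * (\<i> * cis (u $ 2)))
        + of_real (- (real m * (u $ 1) ^ (2 * m - 1)) / ?R * h $ 1) * cis (u $ 2))) (at u)"
    by (rule has_derivative_mult [OF has_derivative_of_real [OF sq] cis])
  have 2: "((\<lambda>u::real^3. of_real (u $ 1) * cis (u $ 3)) has_derivative
      (\<lambda>h. of_real (u $ 1) * (of_real (h $ 3) * (\<i> * cis (u $ 3))) + of_real (h $ 1) * cis (u $ 3))) (at u)"
    by (rule has_derivative_mult [OF has_derivative_of_real [OF nth] cis])
  have "(boundary_param m has_derivative (\<lambda>h. vector
     [of_real ?R * (of_real (h $ 2) * (\<i> * cis (u $ 2)))
        + of_real (- (real m * (u $ 1) ^ (2 * m - 1)) / ?R * h $ 1) * cis (u $ 2),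
      of_real (u $ 1) * (of_real (h $ 3) * (\<i> * cis (u $ 3))) + of_real (h $ 1) * cis (u $ 3)])) (at u)"
    unfolding boundary_param_def [abs_def] by (rule has_derivative_vector2 [OF 1 2])
  then show ?thesis by (simp add: add.commute mult.assoc)
qed

text \<open>The three coordinate vectors are orthogonal with squared lengths d^2 + 1, R^2 and s^2,
  so the Gram determinant is their product. The division by R contained in d disappears in (d
  R)^2.\<close>

lemma area_factor_boundary_param:
  fixes u :: "real^3"
  assumes "m \<ge> 1" "0 < u $ 1" "u $ 1 < 1"
  shows "area_factor (boundary_param m) u =
    u $ 1 * sqrt (1 - (u $ 1) ^ (2 * m) + (real m)\<^sup>2 * (u $ 1) ^ (4 * m - 2))"
proof -
  define s R where "s = u $ 1" and "R = sqrt (1 - (u $ 1) ^ (2 * m))"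
  define d where "d = - (real m * (u $ 1) ^ (2 * m - 1)) / R"
  have lt: "(u $ 1) ^ (2 * m) < 1" using assms by (simp add: power_less_one_iff)
  then have R: "R > 0" "R\<^sup>2 = 1 - s ^ (2 * m)" by (simp_all add: R_def s_def)
  have D: "frechet_derivative (boundary_param m) (at u) = (\<lambda>h. vector
     [of_real (d * h $ 1) * cis (u $ 2) + of_real (R * h $ 2) * (\<i> * cis (u $ 2)),
      of_real (h $ 1) * cis (u $ 3) + of_real (s * h $ 3) * (\<i> * cis (u $ 3))])"
    using frechet_derivative_at [OF has_derivative_boundary_param [OF assms]]
    by (simp add: s_def R_def d_def)
  define v1 v2 v3 where "v1 = frechet_derivative (boundary_param m) (at u) (axis 1 1)"
    and "v2 = frechet_derivative (boundary_param m) (at u) (axis 2 1)"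
    and "v3 = frechet_derivative (boundary_param m) (at u) (axis 3 1)"
  have v: "v1 = vector [of_real d * cis (u $ 2), cis (u $ 3)]"
    "v2 = vector [of_real R * (\<i> * cis (u $ 2)), 0]" "v3 = vector [0, of_real s * (\<i> * cis (u $ 3))]"
    by (simp_all add: v1_def v2_def v3_def D axis_def)
  have ip: "v1 \<bullet> v1 = d\<^sup>2 + 1" "v2 \<bullet> v2 = R\<^sup>2" "v3 \<bullet> v3 = s\<^sup>2"
    "v1 \<bullet> v2 = 0" "v2 \<bullet> v1 = 0" "v1 \<bullet> v3 = 0" "v3 \<bullet> v1 = 0" "v2 \<bullet> v3 = 0" "v3 \<bullet> v2 = 0"
    unfolding v inner_complex2
    by (simp_all add: algebra_simps power2_eq_square flip: distrib_left distrib_right)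
  have "det (\<chi> i j. frechet_derivative (boundary_param m) (at u) (axis i 1) \<bullet> frechet_derivative (boundary_param m) (at u) (axis j 1) :: real^3^3)
      = (d\<^sup>2 + 1) * R\<^sup>2 * s\<^sup>2"
    by (simp add: det_3 v1_def [symmetric] v2_def [symmetric] v3_def [symmetric] ip)
  also have "(d\<^sup>2 + 1) * R\<^sup>2 = R\<^sup>2 + (d * R)\<^sup>2" by (simp add: algebra_simps)
  also have "d * R = - (real m * s ^ (2 * m - 1))" using R by (simp add: d_def s_def)
  also have "(- (real m * s ^ (2 * m - 1)))\<^sup>2 = (real m)\<^sup>2 * s ^ (4 * m - 2)"
  proof -
    have "(2 * m - 1) * 2 = 4 * m - 2" by simp
    then show ?thesis by (simp add: power_mult_distrib power_mult [symmetric])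
  qed
  finally show ?thesis
    using assms(2) by (simp add: area_factor_def real_sqrt_mult R(2) s_def [symmetric] mult.commute)
qed

text \<open>The square root in the area factor is the norm in the denominator of the Fefferman
  weight. Their cancellation leaves a constant times a power of s, which makes the moments
  explicit.\<close>

lemma area_weight_product:
  fixes u :: "real^3"
  assumes "m \<ge> 1" "0 < u $ 1" "u $ 1 < 1"
  shows "area_factor (boundary_param m) u * fefferman_weight m (boundary_param m u)
     = root 3 ((real m)\<^sup>2 * (u $ 1) ^ (2 * m - 2)) * u $ 1"
proof -
  have lt: "(u $ 1) ^ (2 * m) < 1" using assms by (simp add: power_less_one_iff)
  have u: "u = vector [u $ 1, u $ 2, u $ 3]" by (simp add: vec_eq_iff forall_3)
  have fr: "boundary_param m u \<in> frontier (ellipsoid m)"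
    by (subst u) (use assms in \<open>simp add: boundary_param_torus_point torus_point_frontier\<close>)
  have c: "cmod (boundary_param m u $ 2) = u $ 1" "(cmod (boundary_param m u $ 1))\<^sup>2 = 1 - (u $ 1) ^ (2 * m)"
    using assms lt by (simp_all add: boundary_param_def norm_mult)
  have "1 - (u $ 1) ^ (2 * m) + (real m)\<^sup>2 * (u $ 1) ^ (4 * m - 2) > 0"
    using lt assms by (intro add_pos_nonneg) auto
  then show ?thesis
    unfolding area_factor_boundary_param [OF assms] fefferman_weight_boundary [OF assms(1) fr] c by simp
qed

section \<open>The Fefferman measure as the image of a product measure\<close>

definition boundary_space :: "nat \<Rightarrow> (complex^2) measure" where
  "boundary_space m = restrict_space borel (frontier (ellipsoid m))"

lemma space_boundary_space [simp]: "space (boundary_space m) = frontier (ellipsoid m)"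
  by (simp add: boundary_space_def space_restrict_space)

lemma borel_boundary_space:
  "f \<in> borel_measurable borel \<Longrightarrow> f \<in> borel_measurable (boundary_space m)"
  by (simp add: boundary_space_def measurable_restrict_space1)

lemma sets_sigma_F [simp, measurable_cong]: "sets (sigma_F m) = sets (boundary_space m)"
  by (simp add: sigma_F_def sigma_E_def surface_measure_def boundary_space_def)

lemma space_sigma_F [simp]: "space (sigma_F m) = frontier (ellipsoid m)"
  using sets_eq_imp_space_eq [OF sets_sigma_F] by simp

lemma sets_param_domain: "param_domain \<in> sets borel"
proof -
  have "(\<lambda>u::real^3. u $ i) \<in> borel_measurable borel" for i
    by (intro borel_measurable_continuous_onI continuous_intros)
  then have "(\<lambda>u::real^3. u $ i) -` A \<in> sets borel" if "A \<in> sets borel" for A i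
    using measurable_sets [of "\<lambda>u::real^3. u $ i" borel borel A] that by simp
  then have "(\<lambda>u::real^3. u $ 1) -` {0<..<1} \<inter> (\<lambda>u::real^3. u $ 2) -` {0..<2 * pi} \<inter> (\<lambda>u::real^3. u $ 3) -` {0..<2 * pi} \<in> sets borel"
    by (intro sets.Int) auto
  moreover have "param_domain = (\<lambda>u::real^3. u $ 1) -` {0<..<1} \<inter> (\<lambda>u::real^3. u $ 2) -` {0..<2 * pi} \<inter> (\<lambda>u::real^3. u $ 3) -` {0..<2 * pi}"
    by (auto simp: param_domain_def)
  ultimately show ?thesis by simp
qed

lemma boundary_param_frontier:
  assumes "m \<ge> 1" "u \<in> param_domain"
  shows "boundary_param m u \<in> frontier (ellipsoid m)"
  using bij_betwE [OF bij_betw_boundary_param [OF assms(1)]] assms(2) by auto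

lemma measurable_boundary_param: "boundary_param m \<in> borel_measurable borel"
  unfolding boundary_param_def [abs_def]
  by (intro borel_measurable_continuous_onI continuous_intros)

text \<open>The weight is defined through derivatives of \<open>rho m\<close>; its measurability is
  read off from the closed form valid on the boundary.\<close>

lemma measurable_fefferman_weight:
  assumes "m \<ge> 1"
  shows "fefferman_weight m \<in> borel_measurable (boundary_space m)"
proof -
  let ?w = "\<lambda>p::complex^2. root 3 ((real m)\<^sup>2 * cmod (p $ 2) ^ (2 * m - 2)) / sqrt ((cmod (p $ 1))\<^sup>2 + (real m)\<^sup>2 * cmod (p $ 2) ^ (4 * m - 2))"
  have "?w \<in> borel_measurable borel"
    by (intro borel_measurable_divide borel_measurable_continuous_onI continuous_intros)
  then have "?w \<in> borel_measurable (boundary_space m)"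
    by (rule borel_boundary_space)
  then show ?thesis
    by (rule measurable_cong [THEN iffD1, rotated]) (simp add: fefferman_weight_boundary [OF assms])
qed

text \<open>Two densities and a push-forward are unfolded into one integral over the parameters,
  where the area factor and the weight merge.\<close>

lemma nn_integral_sigma_F:
  assumes m: "m \<ge> 1" and f: "f \<in> borel_measurable borel"
  shows "(\<integral>\<^sup>+ \<xi>. f \<xi> \<partial>sigma_F m) =
    (\<integral>\<^sup>+ u. indicator param_domain u * (ennreal (root 3 ((real m)\<^sup>2 * (u $ 1) ^ (2 * m - 2)) * u $ 1) * f (boundary_param m u)) \<partial>lborel)"
proof -
  let ?U = "restrict_space lborel param_domain :: (real^3) measure"
  let ?a = "\<lambda>u. u $ 1 * sqrt (1 - (u $ 1) ^ (2 * m) + (real m)\<^sup>2 * (u $ 1) ^ (4 * m - 2))"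
  have dom: "0 < u $ 1" "u $ 1 < 1" if "u \<in> param_domain" for u
    using that by (auto simp: param_domain_def)
  have sU: "space ?U = param_domain" by (simp add: space_restrict_space)
  have "?a \<in> borel_measurable borel"
    by (intro borel_measurable_continuous_onI continuous_intros)
  then have "?a \<in> borel_measurable ?U" by (simp add: measurable_restrict_space1)
  then have meas_a: "area_factor (boundary_param m) \<in> borel_measurable ?U"
    by (rule measurable_cong [THEN iffD1, rotated]) (simp add: area_factor_boundary_param [OF m] dom sU)
  have "boundary_param m \<in> ?U \<rightarrow>\<^sub>M boundary_space m"
    unfolding boundary_space_def
    by (rule measurable_restrict_space2)
       (auto simp: sU boundary_param_frontier [OF m] measurable_boundary_param intro!: measurable_restrict_space1)
  then have meas_p: "boundary_param m \<in> density ?U (\<lambda>u. ennreal (area_factor (boundary_param m) u)) \<rightarrow>\<^sub>M boundary_space m"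
    by simp
  have fb: "f \<in> borel_measurable (boundary_space m)" by (rule borel_boundary_space [OF f])
  note wb = measurable_fefferman_weight [OF m]
  have "(\<integral>\<^sup>+ \<xi>. f \<xi> \<partial>sigma_F m) = (\<integral>\<^sup>+ \<xi>. ennreal (fefferman_weight m \<xi>) * f \<xi> \<partial>sigma_E m)"
    unfolding sigma_F_def
    by (rule nn_integral_density)
       (use wb fb in \<open>simp_all add: sigma_E_def surface_measure_def boundary_space_def [symmetric]\<close>)
  also have "\<dots> = (\<integral>\<^sup>+ u. ennreal (fefferman_weight m (boundary_param m u)) * f (boundary_param m u)
      \<partial>density ?U (\<lambda>u. ennreal (area_factor (boundary_param m) u)))"
    unfolding sigma_E_def surface_measure_def boundary_space_def [symmetric]
    by (rule nn_integral_distr [OF meas_p]) (use wb fb in simp)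
  also have "\<dots> = (\<integral>\<^sup>+ u. ennreal (area_factor (boundary_param m) u) * (ennreal (fefferman_weight m (boundary_param m u)) * f (boundary_param m u)) \<partial>?U)"
  proof (rule nn_integral_density)
    show "(\<lambda>u. ennreal (area_factor (boundary_param m) u)) \<in> borel_measurable ?U"
      using meas_a by simp
    show "(\<lambda>u. ennreal (fefferman_weight m (boundary_param m u)) * f (boundary_param m u)) \<in> borel_measurable ?U"
      using measurable_compose [OF \<open>boundary_param m \<in> ?U \<rightarrow>\<^sub>M boundary_space m\<close> wb]
        measurable_compose [OF \<open>boundary_param m \<in> ?U \<rightarrow>\<^sub>M boundary_space m\<close> fb] by simp
  qed
  also have "\<dots> = (\<integral>\<^sup>+ u. ennreal (root 3 ((real m)\<^sup>2 * (u $ 1) ^ (2 * m - 2)) * u $ 1) * f (boundary_param m u) \<partial>?U)"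
  proof (rule nn_integral_cong)
    fix u assume "u \<in> space ?U"
    then have u: "0 < u $ 1" "u $ 1 < 1" using dom by (auto simp: sU)
    then have "area_factor (boundary_param m) u \<ge> 0"
      using zero_le_power [of "u $ 1" "2 * m"] power_le_one [of "u $ 1" "2 * m"]
      by (simp add: area_factor_boundary_param [OF m])
    then show "ennreal (area_factor (boundary_param m) u) * (ennreal (fefferman_weight m (boundary_param m u)) * f (boundary_param m u))
        = ennreal (root 3 ((real m)\<^sup>2 * (u $ 1) ^ (2 * m - 2)) * u $ 1) * f (boundary_param m u)"
      by (simp add: area_weight_product [OF m u, symmetric] ennreal_mult' mult.assoc)
  qed
  also have "\<dots> = (\<integral>\<^sup>+ u. ennreal (root 3 ((real m)\<^sup>2 * (u $ 1) ^ (2 * m - 2)) * u $ 1) * f (boundary_param m u) * indicator param_domain u \<partial>lborel)"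
    by (rule nn_integral_restrict_space) (simp add: sets_param_domain)
  finally show ?thesis by (simp add: mult.commute)
qed

lemma finite_measure_radial_measure: "finite_measure (radial_measure m)"
proof
  have meas: "(\<lambda>s. ennreal (root 3 ((real m)\<^sup>2 * s ^ (2 * m - 2)) * s)) \<in> borel_measurable (restrict_space lborel {0<..<1})"
    by (intro measurable_restrict_space1 measurable_compose [OF _ measurable_ennreal] borel_measurable_continuous_onI continuous_intros)
       (simp add: borel_measurable_continuous_onI continuous_intros)
  have "emeasure (radial_measure m) (space (radial_measure m)) =
      (\<integral>\<^sup>+ s. ennreal (root 3 ((real m)\<^sup>2 * s ^ (2 * m - 2)) * s) \<partial>restrict_space lborel {0<..<1})"
    unfolding radial_measure_def space_density emeasure_density [OF meas sets.top]
    by (intro nn_integral_cong) simp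
  also have "\<dots> \<le> (\<integral>\<^sup>+ s. ennreal (root 3 ((real m)\<^sup>2)) \<partial>restrict_space lborel {0<..<1::real})"
  proof (rule nn_integral_mono, rule ennreal_leI)
    fix s :: real assume "s \<in> space (restrict_space lborel {0<..<1})"
    then have s: "0 < s" "s < 1" by (auto simp: space_restrict_space)
    \<comment> \<open>The density is bounded by m^(2/3), its value at s = 1.\<close>
    have "root 3 ((real m)\<^sup>2 * s ^ (2 * m - 2)) * s \<le> root 3 ((real m)\<^sup>2 * 1) * 1"
      using s by (intro mult_mono real_root_le_mono mult_left_mono power_le_one) auto
    then show "root 3 ((real m)\<^sup>2 * s ^ (2 * m - 2)) * s \<le> root 3 ((real m)\<^sup>2)" by simp
  qed
  also have "\<dots> < \<infinity>"
    by (simp add: emeasure_restrict_space space_restrict_space)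
  finally show "emeasure (radial_measure m) (space (radial_measure m)) \<noteq> \<infinity>" by simp
qed

lemma nn_integral_lborel_real3:
  fixes g :: "real^3 \<Rightarrow> ennreal"
  assumes g: "g \<in> borel_measurable borel"
  shows "(\<integral>\<^sup>+ u. g u \<partial>lborel) = (\<integral>\<^sup>+ s. \<integral>\<^sup>+ \<theta>. \<integral>\<^sup>+ \<phi>. g (vector [s, \<theta>, \<phi>]) \<partial>lborel \<partial>lborel \<partial>lborel)"
proof -
  let ?T = "\<lambda>p::real \<times> real \<times> real. vector [fst p, fst (snd p), snd (snd p)] :: real^3"
  have contT: "continuous_on UNIV ?T"
    by (intro continuous_on_vector3 continuous_intros)
  then have mT: "?T \<in> borel_measurable borel" by (rule borel_measurable_continuous_onI)
  have "(\<integral>\<^sup>+ u. g u \<partial>lborel) = (\<integral>\<^sup>+ u. g u \<partial>distr lborel borel ?T)"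
    by (simp only: lborel_real3_eq_distr)
  also have "\<dots> = (\<integral>\<^sup>+ p. g (?T p) \<partial>lborel)"
    by (rule nn_integral_distr) (use mT g in simp_all)
  also have "\<dots> = (\<integral>\<^sup>+ p. g (?T p) \<partial>(lborel \<Otimes>\<^sub>M lborel))"
    by (simp only: lborel_prod)
  also have "\<dots> = (\<integral>\<^sup>+ s. \<integral>\<^sup>+ q. g (?T (s, q)) \<partial>lborel \<partial>lborel)"
    by (rule lborel.nn_integral_fst [symmetric]) (use measurable_compose [OF mT g] in \<open>simp add: lborel_prod\<close>)
  also have "\<dots> = (\<integral>\<^sup>+ s. \<integral>\<^sup>+ \<theta>. \<integral>\<^sup>+ \<phi>. g (vector [s, \<theta>, \<phi>]) \<partial>lborel \<partial>lborel \<partial>lborel)"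
  proof (rule nn_integral_cong)
    fix s :: real
    have "continuous_on UNIV (\<lambda>q::real \<times> real. (s, q))" by (intro continuous_intros)
    from continuous_on_compose2 [OF contT this]
    have "(\<lambda>q. ?T (s, q)) \<in> borel_measurable borel"
      by (intro borel_measurable_continuous_onI) simp
    from measurable_compose [OF this g]
    have m: "(\<lambda>q. g (?T (s, q))) \<in> borel_measurable (lborel \<Otimes>\<^sub>M lborel)" by (simp add: lborel_prod)
    have "(\<integral>\<^sup>+ q. g (?T (s, q)) \<partial>lborel) = (\<integral>\<^sup>+ q. g (?T (s, q)) \<partial>(lborel \<Otimes>\<^sub>M lborel))"
      by (simp only: lborel_prod)
    also have "\<dots> = (\<integral>\<^sup>+ \<theta>. \<integral>\<^sup>+ \<phi>. g (?T (s, \<theta>, \<phi>)) \<partial>lborel \<partial>lborel)"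
      by (rule lborel.nn_integral_fst [OF m, symmetric])
    finally show "(\<integral>\<^sup>+ q. g (?T (s, q)) \<partial>lborel) = (\<integral>\<^sup>+ \<theta>. \<integral>\<^sup>+ \<phi>. g (vector [s, \<theta>, \<phi>]) \<partial>lborel \<partial>lborel)"
      by simp
  qed
  finally show ?thesis .
qed

abbreviation torus_measure :: "nat \<Rightarrow> (real \<times> real \<times> real) measure" where
  "torus_measure m \<equiv> radial_measure m \<Otimes>\<^sub>M (circle_measure \<Otimes>\<^sub>M circle_measure)"

lemma space_torus_measure: "space (torus_measure m) = {0<..<1} \<times> {0..<2 * pi} \<times> {0..<2 * pi}"
  by (simp add: space_pair_measure radial_measure_def space_restrict_space)

lemma measurable_torus_measure:
  assumes "f \<in> borel_measurable (borel :: (real \<times> real \<times> real) measure)"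
  shows "f \<in> borel_measurable (torus_measure m)"
proof -
  have id1: "(\<lambda>x. x) \<in> circle_measure \<rightarrow>\<^sub>M borel"
    by (rule measurable_circle_measure) simp
  have id2: "(\<lambda>x. x) \<in> radial_measure m \<rightarrow>\<^sub>M borel"
    unfolding radial_measure_def by (simp add: measurable_restrict_space1)
  have "(\<lambda>p. (fst p, snd p)) \<in> circle_measure \<Otimes>\<^sub>M circle_measure \<rightarrow>\<^sub>M borel \<Otimes>\<^sub>M borel"
    by (rule measurable_Pair [OF measurable_compose [OF measurable_fst id1] measurable_compose [OF measurable_snd id1]])
  then have id3: "(\<lambda>p. p) \<in> circle_measure \<Otimes>\<^sub>M circle_measure \<rightarrow>\<^sub>M (borel :: (real \<times> real) measure)"
    by (simp only: prod.collapse borel_prod)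
  have "(\<lambda>p. (fst p, snd p)) \<in> torus_measure m \<rightarrow>\<^sub>M borel \<Otimes>\<^sub>M borel"
    by (rule measurable_Pair [OF measurable_compose [OF measurable_fst id2] measurable_compose [OF measurable_snd id3]])
  then have "(\<lambda>p. p) \<in> torus_measure m \<rightarrow>\<^sub>M (borel :: (real \<times> real \<times> real) measure)"
    by (simp only: prod.collapse borel_prod)
  from measurable_compose [OF this assms] show ?thesis .
qed

lemma measurable_torus_point:
  assumes "m \<ge> 1"
  shows "torus_point m \<in> torus_measure m \<rightarrow>\<^sub>M boundary_space m"
  unfolding boundary_space_def
proof (rule measurable_restrict_space2)
  show "torus_point m \<in> torus_measure m \<rightarrow>\<^sub>M borel"
    by (intro measurable_torus_measure borel_measurable_continuous_onI continuous_on_torus_point)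
  show "torus_point m \<in> space (torus_measure m) \<rightarrow> frontier (ellipsoid m)"
    unfolding space_torus_measure using torus_point_frontier [OF assms] by auto
qed

text \<open>Both measures are compared on indicator functions: the indicator of the parameter domain
  factors into three intervals, and Tonelli's theorem reassembles the iterated integrals into the
  product measure.\<close>

lemma sigma_F_eq_distr:
  assumes m: "m \<ge> 1"
  shows "sigma_F m = distr (torus_measure m) (boundary_space m) (torus_point m)"
proof (rule measure_eqI)
  show "sets (sigma_F m) = sets (distr (torus_measure m) (boundary_space m) (torus_point m))" by simp
  fix A assume "A \<in> sets (sigma_F m)"
  then have Ab: "A \<in> sets (boundary_space m)" and A: "A \<in> sets borel"
    by (auto simp: boundary_space_def sets_restrict_space)
  let ?W = "\<lambda>s. ennreal (root 3 ((real m)\<^sup>2 * s ^ (2 * m - 2)) * s)"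
  let ?f = "\<lambda>p. indicator A p :: ennreal"
  define g where "g = (\<lambda>p. ?f (torus_point m p))"
  define H where "H s = (\<integral>\<^sup>+ q. g (s, q) \<partial>(circle_measure \<Otimes>\<^sub>M circle_measure))" for s
  interpret r: finite_measure "radial_measure m" by (rule finite_measure_radial_measure)
  interpret c2: pair_sigma_finite circle_measure circle_measure ..
  have f: "?f \<in> borel_measurable borel" using A by simp
  have g: "g \<in> borel_measurable borel" unfolding g_def
    by (rule measurable_compose [OF borel_measurable_continuous_onI [OF continuous_on_torus_point] f])
  then have g' [measurable]: "g \<in> borel_measurable (borel \<Otimes>\<^sub>M (borel \<Otimes>\<^sub>M borel))"
    by (simp only: borel_prod)
  have W: "?W \<in> borel_measurable borel"
    by (intro measurable_compose [OF _ measurable_ennreal] borel_measurable_continuous_onI continuous_intros)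
  have "emeasure (sigma_F m) A = (\<integral>\<^sup>+ \<xi>. ?f \<xi> \<partial>sigma_F m)"
    using \<open>A \<in> sets (sigma_F m)\<close> by simp
  also have "\<dots> = (\<integral>\<^sup>+ u. indicator param_domain u * (?W (u $ 1) * ?f (boundary_param m u)) \<partial>lborel)"
    by (rule nn_integral_sigma_F [OF m f])
  also have "\<dots> = (\<integral>\<^sup>+ s. \<integral>\<^sup>+ \<theta>. \<integral>\<^sup>+ \<phi>. indicator param_domain (vector [s, \<theta>, \<phi>] :: real^3) *
      (?W s * g (s, \<theta>, \<phi>)) \<partial>lborel \<partial>lborel \<partial>lborel)"
  proof (subst nn_integral_lborel_real3)
    have "(\<lambda>u::real^3. u $ 1) \<in> borel_measurable borel"
      by (intro borel_measurable_continuous_onI continuous_intros)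
    from measurable_compose [OF this W] measurable_compose [OF measurable_boundary_param f]
    show "(\<lambda>u. indicator param_domain u * (?W (u $ 1) * ?f (boundary_param m u))) \<in> borel_measurable borel"
      using sets_param_domain by simp
  qed (simp add: boundary_param_torus_point g_def)
  also have "\<dots> = (\<integral>\<^sup>+ s. \<integral>\<^sup>+ \<theta>. \<integral>\<^sup>+ \<phi>. ?W s * indicator {0<..<1} s * (indicator {0..<2 * pi} \<theta> * (g (s, \<theta>, \<phi>) * indicator {0..<2 * pi} \<phi>))
      \<partial>lborel \<partial>lborel \<partial>lborel)"
    by (intro nn_integral_cong) (auto simp: param_domain_def split: split_indicator)
  also have "\<dots> = (\<integral>\<^sup>+ s. ?W s * indicator {0<..<1} s * (\<integral>\<^sup>+ \<theta>. indicator {0..<2 * pi} \<theta> * (\<integral>\<^sup>+ \<phi>. g (s, \<theta>, \<phi>) * indicator {0..<2 * pi} \<phi>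
      \<partial>lborel) \<partial>lborel) \<partial>lborel)"
    by (simp add: nn_integral_cmult)
  also have "\<dots> = (\<integral>\<^sup>+ s. ?W s * indicator {0<..<1} s * (\<integral>\<^sup>+ \<theta>. \<integral>\<^sup>+ \<phi>. g (s, \<theta>, \<phi>)
      \<partial>circle_measure \<partial>circle_measure) \<partial>lborel)"
    by (simp add: circle_measure_def nn_integral_restrict_space mult.commute)
  also have "\<dots> = (\<integral>\<^sup>+ s. ?W s * H s * indicator {0<..<1} s \<partial>lborel)"
  proof (rule nn_integral_cong)
    fix s
    have "(\<lambda>q. g (s, q)) \<in> borel_measurable (borel \<Otimes>\<^sub>M borel)" by measurable
    then have "(\<lambda>q. g (s, q)) \<in> borel_measurable (circle_measure \<Otimes>\<^sub>M circle_measure)"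
      by (intro measurable_circle_measure_pair) (simp only: borel_prod)
    from circle_measure.nn_integral_fst [OF this]
    show "?W s * indicator {0<..<1} s * (\<integral>\<^sup>+ \<theta>. \<integral>\<^sup>+ \<phi>. g (s, \<theta>, \<phi>) \<partial>circle_measure \<partial>circle_measure)
        = ?W s * H s * indicator {0<..<1} s"
      by (simp add: H_def mult_ac)
  qed
  also have "\<dots> = (\<integral>\<^sup>+ s. ?W s * H s \<partial>restrict_space lborel {0<..<1})"
    by (rule nn_integral_restrict_space [symmetric]) simp
  also have "\<dots> = (\<integral>\<^sup>+ s. H s \<partial>radial_measure m)"
  proof -
    have "H \<in> borel_measurable (radial_measure m)"
      unfolding H_def by (intro c2.borel_measurable_nn_integral_fst measurable_torus_measure g)
    then have "H \<in> borel_measurable (restrict_space lborel {0<..<1})"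
      by (simp add: radial_measure_def)
    moreover have "?W \<in> borel_measurable (restrict_space lborel {0<..<1})"
      using W by (simp add: measurable_restrict_space1)
    ultimately show ?thesis
      unfolding radial_measure_def by (intro nn_integral_density [symmetric])
  qed
  also have "\<dots> = (\<integral>\<^sup>+ p. g p \<partial>torus_measure m)"
    unfolding H_def by (intro c2.nn_integral_fst measurable_torus_measure g)
  also have "\<dots> = (\<integral>\<^sup>+ \<xi>. ?f \<xi> \<partial>distr (torus_measure m) (boundary_space m) (torus_point m))"
    unfolding g_def by (rule nn_integral_distr [symmetric]) (use measurable_torus_point [OF m] Ab in simp_all)
  also have "\<dots> = emeasure (distr (torus_measure m) (boundary_space m) (torus_point m)) A"
    using Ab by simp
  finally show "emeasure (sigma_F m) A = emeasure (distr (torus_measure m) (boundary_space m) (torus_point m)) A" .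
qed

section \<open>Monomials in the Hardy space\<close>

lemma finite_measure_torus_measure: "finite_measure (torus_measure m)"
  by (intro finite_measure_pair_measure circle_measure.finite_measure_axioms finite_measure_radial_measure)

lemma finite_measure_sigma_F:
  assumes "m \<ge> 1"
  shows "finite_measure (sigma_F m)"
  unfolding sigma_F_eq_distr [OF assms]
  by (rule finite_measure.finite_measure_distr [OF finite_measure_torus_measure measurable_torus_point [OF assms]])

section \<open>Measurability of the non-tangential maximal function\<close>

lemma continuous_on_bilinear_dot [continuous_intros]:
  "continuous_on X f \<Longrightarrow> continuous_on X g \<Longrightarrow> continuous_on X (\<lambda>x. bilinear_dot (f x) (g x))"
  unfolding bilinear_dot_def by (intro continuous_intros)

text \<open>For fixed \<open>p\<close> in the domain both conditions are strict inequalities between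
  continuous functions of \<xi>; the distance to the moving tangent plane is continuous by its
  closed form.\<close>

lemma openin_approach_region:
  assumes m: "m \<ge> 1"
  shows "openin (top_of_set (frontier (ellipsoid m))) {\<xi> \<in> frontier (ellipsoid m). p \<in> approach_region m a \<xi>}"
proof (cases "p \<in> ellipsoid m")
  case True
  let ?S = "frontier (ellipsoid m)"
  define d where "d \<xi> = min (infdist p ?S) \<bar>(p - \<xi>) \<bullet> outward_normal m \<xi>\<bar>" for \<xi>
  have \<nu>: "continuous_on ?S (outward_normal m)" by (rule continuous_on_outward_normal [OF m])
  have cnj: "continuous_on ?S (\<lambda>\<xi>. \<chi> i. cnj (outward_normal m \<xi> $ i))"
    by (intro continuous_on_vec_lambda continuous_intros \<nu>)
  have d: "continuous_on ?S d"
    unfolding d_def by (intro continuous_intros \<nu>)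
  have "continuous_on ?S (\<lambda>\<xi>. (1 + a) * d \<xi> - cmod (bilinear_dot (\<xi> - p) (\<chi> i. cnj (outward_normal m \<xi> $ i))))"
    by (intro continuous_intros cnj d)
  from continuous_openin_preimage_gen [OF this open_greaterThan [of 0]]
  have 1: "openin (top_of_set ?S) (?S \<inter> (\<lambda>\<xi>. (1 + a) * d \<xi> - cmod (bilinear_dot (\<xi> - p) (\<chi> i. cnj (outward_normal m \<xi> $ i)))) -` {0<..})" .
  have "continuous_on ?S (\<lambda>\<xi>. a * d \<xi> - (norm (\<xi> - p))\<^sup>2)"
    by (intro continuous_intros d)
  from continuous_openin_preimage_gen [OF this open_greaterThan [of 0]]
  have 2: "openin (top_of_set ?S) (?S \<inter> (\<lambda>\<xi>. a * d \<xi> - (norm (\<xi> - p))\<^sup>2) -` {0<..})" .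
  have "approach_dist m \<xi> p = d \<xi>" if "\<xi> \<in> ?S" for \<xi>
    by (simp add: approach_dist_def d_def infdist_tangent_plane [OF m that])
  then have "{\<xi> \<in> ?S. p \<in> approach_region m a \<xi>} =
      (?S \<inter> (\<lambda>\<xi>. (1 + a) * d \<xi> - cmod (bilinear_dot (\<xi> - p) (\<chi> i. cnj (outward_normal m \<xi> $ i)))) -` {0<..})
      \<inter> (?S \<inter> (\<lambda>\<xi>. a * d \<xi> - (norm (\<xi> - p))\<^sup>2) -` {0<..})"
    using True by (auto simp: approach_region_def)
  then show ?thesis
    using openin_Int [OF 1 2] by (simp only:)
next
  case False
  then have "{\<xi> \<in> frontier (ellipsoid m). p \<in> approach_region m a \<xi>} = {}"
    by (auto simp: approach_region_def)
  then show ?thesis by (simp only: openin_empty)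
qed

text \<open>The supremum is uncountable, but a superlevel set is a union of relatively open sets,
  one for each \<open>p\<close> where |f| exceeds the level: the maximal function is lower
  semicontinuous.\<close>

lemma measurable_nt_maximal:
  assumes m: "m \<ge> 1"
  shows "nt_maximal m a f \<in> borel_measurable (sigma_F m)"
proof (rule borel_measurableI_greater)
  fix c :: ennreal
  let ?S = "frontier (ellipsoid m)"
  have "{\<xi> \<in> space (sigma_F m). c < nt_maximal m a f \<xi>} =
      (\<Union>p\<in>{p. c < ennreal (cmod (f p))}. {\<xi> \<in> ?S. p \<in> approach_region m a \<xi>})"
    by (auto simp: nt_maximal_def less_SUP_iff)
  moreover have "openin (top_of_set ?S) (\<Union>p\<in>{p. c < ennreal (cmod (f p))}. {\<xi> \<in> ?S. p \<in> approach_region m a \<xi>})"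
    by (intro openin_Union) (auto intro: openin_approach_region [OF m])
  ultimately obtain T where "open T" "{\<xi> \<in> space (sigma_F m). c < nt_maximal m a f \<xi>} = ?S \<inter> T"
    by (auto simp: openin_open)
  then show "{\<xi> \<in> space (sigma_F m). c < nt_maximal m a f \<xi>} \<in> sets (sigma_F m)"
    by (auto simp: boundary_space_def sets_restrict_space)
qed

section \<open>Monomials as test functions, and their moments\<close>

definition monomial2 :: "nat \<Rightarrow> nat \<Rightarrow> complex^2 \<Rightarrow> complex" where
  "monomial2 j k p = p $ 1 ^ j * p $ 2 ^ k"

lemma continuous_on_monomial2 [continuous_intros]: "continuous_on X f \<Longrightarrow> continuous_on X (\<lambda>x. monomial2 j k (f x))"
  unfolding monomial2_def by (intro continuous_intros)

lemma norm_monomial2_le: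
  assumes "m \<ge> 1" "p \<in> ellipsoid m \<union> frontier (ellipsoid m)"
  shows "cmod (monomial2 j k p) \<le> 1"
proof -
  have e: "(cmod (p $ 1))\<^sup>2 + cmod (p $ 2) ^ (2 * m) \<le> 1"
    using assms(2)
  proof
    assume "p \<in> ellipsoid m"
    then show ?thesis by (simp add: ellipsoid_def)
  qed (simp add: frontier_ellipsoid [OF assms(1)])
  have nn: "cmod (p $ 2) ^ (2 * m) \<ge> 0" "(cmod (p $ 1))\<^sup>2 \<ge> 0" by simp_all
  have "(cmod (p $ 1))\<^sup>2 \<le> 1" using e nn by linarith
  then have 1: "cmod (p $ 1) \<le> 1" using power_le_one_iff [of "cmod (p $ 1)" 2] by simp
  have "cmod (p $ 2) ^ (2 * m) \<le> 1" using e nn by linarith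
  then have 2: "cmod (p $ 2) \<le> 1" using power_le_one_iff [of "cmod (p $ 2)" "2 * m"] assms(1) by simp
  have "cmod (p $ 1) ^ j * cmod (p $ 2) ^ k \<le> 1 * 1"
    using 1 2 by (intro mult_mono power_le_one) auto
  then show ?thesis by (simp add: monomial2_def norm_mult norm_power)
qed

text \<open>A monomial is bounded by 1 on the domain, hence so is its maximal function, and the
  measure is finite.\<close>

lemma monomial2_hardy_space:
  assumes m: "m \<ge> 1"
  shows "monomial2 j k \<in> hardy_space m a"
proof -
  have "holomorphic2_on (monomial2 j k) (ellipsoid m)"
    unfolding holomorphic2_on_def
  proof
    fix p
    have nth: "((\<lambda>u::complex^2. u $ i) has_derivative (\<lambda>h. h $ i)) (at p within ellipsoid m)" for i
      by (rule bounded_linear_imp_has_derivative [OF bounded_linear_vec_nth])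
    have "((\<lambda>p. p $ 1 ^ j * p $ 2 ^ k) has_derivative
        (\<lambda>h. p $ 1 ^ j * (of_nat k * h $ 2 * p $ 2 ^ (k - 1)) + (of_nat j * h $ 1 * p $ 1 ^ (j - 1)) * p $ 2 ^ k)) (at p within ellipsoid m)"
      by (intro has_derivative_mult has_derivative_power nth)
    then have "(monomial2 j k has_derivative
        (\<lambda>h. (of_nat j * p $ 1 ^ (j - 1) * p $ 2 ^ k) * h $ 1 + (p $ 1 ^ j * of_nat k * p $ 2 ^ (k - 1)) * h $ 2)) (at p within ellipsoid m)"
      by (simp add: monomial2_def [abs_def] mult_ac add.commute)
    then show "\<exists>a b. (monomial2 j k has_derivative (\<lambda>h. a * h $ 1 + b * h $ 2)) (at p within ellipsoid m)"
      by blast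
  qed
  moreover have "(\<integral>\<^sup>+ \<xi>. (nt_maximal m a (monomial2 j k) \<xi>)\<^sup>2 \<partial>sigma_F m) < \<infinity>"
  proof -
    have "nt_maximal m a (monomial2 j k) \<xi> \<le> 1" for \<xi>
      unfolding nt_maximal_def
      by (rule SUP_least) (auto simp: approach_region_def intro!: norm_monomial2_le [OF m])
    then have "(nt_maximal m a (monomial2 j k) \<xi>)\<^sup>2 \<le> 1" for \<xi>
      by (simp add: power_le_one)
    then have "(\<integral>\<^sup>+ \<xi>. (nt_maximal m a (monomial2 j k) \<xi>)\<^sup>2 \<partial>sigma_F m) \<le> (\<integral>\<^sup>+ \<xi>. 1 \<partial>sigma_F m)"
      by (intro nn_integral_mono)
    also have "\<dots> < \<infinity>"
      using finite_measure.emeasure_finite [OF finite_measure_sigma_F [OF m]] by (simp add: top.not_eq_extremum)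
    finally show ?thesis .
  qed
  ultimately show ?thesis
    by (simp add: hardy_space_def measurable_nt_maximal [OF m])
qed

lemma measurable_sigma_F_continuous:
  "continuous_on (frontier (ellipsoid m)) f \<Longrightarrow> f \<in> borel_measurable (sigma_F m)"
  using borel_measurable_continuous_on_restrict [of "frontier (ellipsoid m)" f]
  by (simp add: measurable_cong_sets [OF sets_sigma_F refl] boundary_space_def)

lemma nt_boundary_value_monomial2:
  "nt_boundary_value m a (monomial2 j k) (monomial2 j k)"
proof -
  have "continuous_on UNIV (monomial2 j k)" using continuous_on_monomial2 [OF continuous_on_id] by simp
  then have "(monomial2 j k \<longlongrightarrow> monomial2 j k \<xi>) (at \<xi> within S)" for \<xi> S
    by (meson UNIV_I continuous_on_def subset_UNIV tendsto_within_subset)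
  then show ?thesis
    unfolding nt_boundary_value_def
    by (auto intro!: measurable_sigma_F_continuous continuous_on_monomial2 continuous_on_id)
qed

text \<open>The squared norm of z^j w^k with respect to \<open>sigma_F m\<close>: on the boundary
  |z|^2 = 1 - s^(2m) with s = |w|, and 4 pi^2 is the mass of the torus of angles.\<close>

definition monomial_moment :: "nat \<Rightarrow> nat \<Rightarrow> nat \<Rightarrow> real" where
  "monomial_moment m j k = 4 * pi\<^sup>2 * (\<integral>s. (1 - s ^ (2 * m)) ^ j * s ^ (2 * k) \<partial>radial_measure m)"

text \<open>A dilate is continuous on the compact boundary, hence bounded, and Fubini's theorem
  applies. Each boundary torus with radii R and s is moved to radii r R and r s inside the domain,
  where the hypothesis on \<open>A\<close> evaluates the angular integrals; together with the
  monomial this gives r^(j + k) R^(2j) s^(2k).\<close>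

lemma integral_dilation_monomial2:
  fixes A :: "nat \<Rightarrow> nat \<Rightarrow> complex"
  assumes m: "m \<ge> 1" and f: "holomorphic2_on f (ellipsoid m)"
    and A: "\<And>r1 r2 j k. 0 \<le> r1 \<Longrightarrow> 0 \<le> r2 \<Longrightarrow> r1\<^sup>2 + r2 ^ (2 * m) < 1 \<Longrightarrow>
       (\<integral>\<theta>. (\<integral>\<phi>. f (vector [r1 * cis \<theta>, r2 * cis \<phi>]) * cnj (cis \<phi>) ^ k \<partial>circle_measure)
            * cnj (cis \<theta>) ^ j \<partial>circle_measure) = 4 * pi\<^sup>2 * r1 ^ j * r2 ^ k * A k j"
    and r: "0 \<le> r" "r < 1"
  shows "(\<integral>\<xi>. f (r *\<^sub>R \<xi>) * cnj (monomial2 j k \<xi>) \<partial>sigma_F m) = of_real (r ^ (j + k) * monomial_moment m j k) * A k j"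
proof -
  let ?S = "frontier (ellipsoid m)"
  interpret tor: finite_measure "torus_measure m" by (rule finite_measure_torus_measure)
  interpret rad: finite_measure "radial_measure m" by (rule finite_measure_radial_measure)
  interpret c2: pair_sigma_finite circle_measure circle_measure ..
  interpret p3: pair_sigma_finite "radial_measure m" "circle_measure \<Otimes>\<^sub>M circle_measure" ..
  define F where "F \<xi> = f (r *\<^sub>R \<xi>) * cnj (monomial2 j k \<xi>)" for \<xi>
  have contF: "continuous_on ?S F"
    unfolding F_def
    by (intro continuous_intros continuous_on_compose2 [OF holomorphic2_on_continuous [OF f]])
       (auto intro: scaled_frontier_ellipsoid [OF m r])
  have measF: "F \<in> borel_measurable (boundary_space m)"
    unfolding boundary_space_def by (rule borel_measurable_continuous_on_restrict [OF contF])
  have "bounded (F ` ?S)"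
    by (intro compact_imp_bounded compact_continuous_image contF compact_frontier_ellipsoid m)
  then obtain B where B: "\<And>\<xi>. \<xi> \<in> ?S \<Longrightarrow> cmod (F \<xi>) \<le> B" by (auto simp: bounded_iff)
  have meas: "(\<lambda>p. F (torus_point m p)) \<in> borel_measurable (torus_measure m)"
    by (rule measurable_compose [OF measurable_torus_point [OF m] measF])
  have sp: "torus_point m p \<in> ?S" if "p \<in> space (torus_measure m)" for p
    using measurable_space [OF measurable_torus_point [OF m] that] by simp
  have int: "integrable (torus_measure m) (\<lambda>p. F (torus_point m p))"
    by (rule tor.integrable_const_bound [where B = B]) (use B sp meas in \<open>auto intro!: AE_I2\<close>)
  have "(\<integral>\<xi>. F \<xi> \<partial>sigma_F m) = (\<integral>p. F (torus_point m p) \<partial>torus_measure m)"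
    unfolding sigma_F_eq_distr [OF m] by (rule integral_distr [OF measurable_torus_point [OF m] measF])
  also have "\<dots> = (\<integral>s. (\<integral>q. F (torus_point m (s, q)) \<partial>(circle_measure \<Otimes>\<^sub>M circle_measure)) \<partial>radial_measure m)"
    by (rule p3.integral_fst' [OF int, symmetric])
  also have "\<dots> = (\<integral>s. complex_of_real (4 * pi\<^sup>2 * r ^ (j + k) * ((1 - s ^ (2 * m)) ^ j * s ^ (2 * k))) * A k j \<partial>radial_measure m)"
  proof (rule Bochner_Integration.integral_cong [OF refl])
    fix s assume "s \<in> space (radial_measure m)"
    then have s: "0 < s" "s < 1" by (auto simp: radial_measure_def space_restrict_space)
    define R where "R = sqrt (1 - s ^ (2 * m))"
    have sm: "0 \<le> s ^ (2 * m)" "s ^ (2 * m) \<le> 1" using s by (simp_all add: power_le_one)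
    have R: "0 \<le> R" "R\<^sup>2 = 1 - s ^ (2 * m)" using sm by (simp_all add: R_def)
    have tpS: "torus_point m (s, \<theta>, \<phi>) \<in> ?S" for \<theta> \<phi>
      by (rule torus_point_frontier [OF m]) (use s in auto)
    have "continuous_on UNIV (\<lambda>q::real \<times> real. torus_point m (s, q))"
      by (rule continuous_on_compose2 [OF continuous_on_torus_point]) (auto intro!: continuous_intros)
    then have "continuous_on UNIV (\<lambda>q. F (torus_point m (s, q)))"
      by (rule continuous_on_compose2 [OF contF]) (use tpS in auto)
    then have meas_q: "(\<lambda>q. F (torus_point m (s, q))) \<in> borel_measurable (circle_measure \<Otimes>\<^sub>M circle_measure)"
      by (intro measurable_circle_measure_pair borel_measurable_continuous_onI)
    interpret cc: finite_measure "circle_measure \<Otimes>\<^sub>M circle_measure"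
      by (intro finite_measure_pair_measure circle_measure.finite_measure_axioms)
    have int_q: "integrable (circle_measure \<Otimes>\<^sub>M circle_measure) (\<lambda>q. F (torus_point m (s, q)))"
      by (rule cc.integrable_const_bound [where B = B, OF _ meas_q]) (use B tpS in \<open>auto intro!: AE_I2\<close>)
    have Fe: "F (torus_point m (s, \<theta>, \<phi>)) = of_real (R ^ j * s ^ k) *
        (f (vector [of_real (r * R) * cis \<theta>, of_real (r * s) * cis \<phi>]) * cnj (cis \<phi>) ^ k * cnj (cis \<theta>) ^ j)" for \<theta> \<phi>
    proof -
      have "r *\<^sub>R torus_point m (s, \<theta>, \<phi>) = vector [of_real (r * R) * cis \<theta>, of_real (r * s) * cis \<phi>]"
        by (simp add: torus_point_def R_def vec_eq_iff forall_2) (simp add: scaleR_conv_of_real)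
      then show ?thesis
        by (simp add: F_def monomial2_def) (simp add: torus_point_def R_def power_mult_distrib)
    qed
    have lt: "(r * R)\<^sup>2 + (r * s) ^ (2 * m) < 1"
    proof -
      have "r *\<^sub>R torus_point m (s, 0, 0) \<in> ellipsoid m"
        by (rule scaled_frontier_ellipsoid [OF m r tpS])
      moreover have "cmod ((r *\<^sub>R torus_point m (s, 0, 0)) $ 1) = r * R" "cmod ((r *\<^sub>R torus_point m (s, 0, 0)) $ 2) = r * s"
        using r s R sm by (simp_all add: torus_point_def R_def)
      ultimately show ?thesis by (simp add: ellipsoid_def)
    qed
    have "(\<integral>q. F (torus_point m (s, q)) \<partial>(circle_measure \<Otimes>\<^sub>M circle_measure)) =
        (\<integral>\<theta>. (\<integral>\<phi>. F (torus_point m (s, \<theta>, \<phi>)) \<partial>circle_measure) \<partial>circle_measure)"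
      by (rule c2.integral_fst' [OF int_q, symmetric])
    also have "\<dots> = of_real (R ^ j * s ^ k) *
        (\<integral>\<theta>. (\<integral>\<phi>. f (vector [of_real (r * R) * cis \<theta>, of_real (r * s) * cis \<phi>]) * cnj (cis \<phi>) ^ k \<partial>circle_measure)
            * cnj (cis \<theta>) ^ j \<partial>circle_measure)"
      unfolding Fe by (simp only: integral_mult_right_zero integral_mult_left_zero)
    also have "\<dots> = of_real (R ^ j * s ^ k) * (4 * pi\<^sup>2 * (r * R) ^ j * (r * s) ^ k * A k j)"
      by (subst A) (use r R s lt in auto)
    also have "\<dots> = of_real (4 * pi\<^sup>2 * r ^ (j + k) * ((R\<^sup>2) ^ j * s ^ (2 * k))) * A k j"
      by (simp add: power_mult_distrib power_add power_mult [symmetric] mult_ac power2_eq_square mult_2_right mult_2)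
    finally show "(\<integral>q. F (torus_point m (s, q)) \<partial>(circle_measure \<Otimes>\<^sub>M circle_measure)) =
        of_real (4 * pi\<^sup>2 * r ^ (j + k) * ((1 - s ^ (2 * m)) ^ j * s ^ (2 * k))) * A k j"
      unfolding R(2) .
  qed
  also have "\<dots> = of_real (r ^ (j + k) * monomial_moment m j k) * A k j"
    unfolding integral_mult_left_zero integral_complex_of_real monomial_moment_def integral_mult_right_zero
    by (simp add: mult_ac)
  finally show ?thesis unfolding F_def .
qed

section \<open>The Fefferman--Szego kernel on the diagonal\<close>

text \<open>The base b of the Beta integral for the moments with w^k; it grows by 1/m when k grows
  by 1.\<close>

definition moment_exponent :: "nat \<Rightarrow> nat \<Rightarrow> real" where
  "moment_exponent m k = (3 * real k + real m + 2) / (3 * real m)"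

text \<open>The reciprocal of the factor 4 pi^2 m^(2/3) / (2m) common to all moments. It is a
  constant factor of the kernel and disappears on differentiating the logarithm.\<close>

definition kernel_constant :: "nat \<Rightarrow> real" where
  "kernel_constant m = 2 * real m / (4 * pi\<^sup>2 * root 3 ((real m)\<^sup>2))"

lemma kernel_constant_pos: "m \<ge> 1 \<Longrightarrow> kernel_constant m > 0"
  by (simp add: kernel_constant_def)

lemma monomial_moment_eq:
  assumes m: "m \<ge> 1"
  shows "monomial_moment m j k = fact j / (kernel_constant m * pochhammer (moment_exponent m k) (Suc j))"
proof -
  \<comment> \<open>Exponent of s in the moment: 2k from |w|^(2k), 1 from the factor s of the
    density, (2m - 2)/3 from its cube root.\<close>
  define p where "p = 2 * real k + 1 + (2 * real m - 2) / 3"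
  define c where "c = root 3 ((real m)\<^sup>2)"
  have c: "c > 0" using m by (simp add: c_def)
  have p: "p > 0" using m by (simp add: p_def add_pos_nonneg)
  have b: "(p + 1) / (2 * real m) = moment_exponent m k"
    using m by (simp add: p_def moment_exponent_def field_simps)
  have root_s: "root 3 ((real m)\<^sup>2 * s ^ (2 * m - 2)) * s * ((1 - s ^ (2 * m)) ^ j * s ^ (2 * k)) =
      c * ((1 - s ^ (2 * m)) ^ j * s powr p)" if s: "0 < s" for s :: real
  proof -
    have "root 3 (s ^ (2 * m - 2)) = s powr ((2 * real m - 2) / 3)"
      using s m by (simp add: root_powr_inverse powr_realpow [symmetric] powr_powr of_nat_diff)
    moreover have "s powr p = s powr (real (2 * k)) * s powr 1 * s powr ((2 * real m - 2) / 3)"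
      by (simp only: p_def powr_add of_nat_mult of_nat_numeral)
    then have "s powr p = s ^ (2 * k) * s * s powr ((2 * real m - 2) / 3)"
      using s by (simp only: powr_realpow powr_one)
    ultimately show ?thesis by (simp add: real_root_mult c_def mult_ac)
  qed
  have W: "(\<lambda>s. root 3 ((real m)\<^sup>2 * s ^ (2 * m - 2)) * s) \<in> borel_measurable borel"
    by (intro borel_measurable_continuous_onI continuous_intros)
  have "(\<lambda>s::real. (1 - s ^ (2 * m)) ^ j * s ^ (2 * k)) \<in> borel_measurable borel"
    by (intro borel_measurable_continuous_onI continuous_intros)
  then have "(\<integral>s. (1 - s ^ (2 * m)) ^ j * s ^ (2 * k) \<partial>radial_measure m) =
      (\<integral>s. (root 3 ((real m)\<^sup>2 * s ^ (2 * m - 2)) * s) *\<^sub>R ((1 - s ^ (2 * m)) ^ j * s ^ (2 * k)) \<partial>restrict_space lborel {0<..<1})"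
    unfolding radial_measure_def using W
    by (intro integral_density AE_I2) (auto simp: measurable_restrict_space1 space_restrict_space)
  also have "\<dots> = (\<integral>s. indicator {0<..<1} s *\<^sub>R ((root 3 ((real m)\<^sup>2 * s ^ (2 * m - 2)) * s) *\<^sub>R ((1 - s ^ (2 * m)) ^ j * s ^ (2 * k))) \<partial>lborel)"
    by (rule integral_restrict_space) simp
  also have "\<dots> = (\<integral>s. c * (indicator {0<..<1} s * ((1 - s ^ (2 * m)) ^ j * s powr p)) \<partial>lborel)"
  proof (rule Bochner_Integration.integral_cong [OF refl])
    show "indicator {0<..<1} s *\<^sub>R ((root 3 ((real m)\<^sup>2 * s ^ (2 * m - 2)) * s) *\<^sub>R ((1 - s ^ (2 * m)) ^ j * s ^ (2 * k))) =
        c * (indicator {0<..<1} s * ((1 - s ^ (2 * m)) ^ j * s powr p))" for s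
    proof (cases "s \<in> {0<..<1}")
      case True
      then have "0 < s" by simp
      with True show ?thesis by (simp only: real_scaleR_def indicator_simps mult_1 root_s)
    qed simp
  qed
  also have "\<dots> = c * (fact j / (2 * real m * pochhammer (moment_exponent m k) (Suc j)))"
    using has_bochner_integral_integral_eq [OF has_bochner_integral_beta [OF m p, of j]]
    by (simp only: b integral_mult_right_zero)
  finally show ?thesis
    unfolding monomial_moment_def kernel_constant_def c_def by (simp only:) (simp add: field_simps)
qed

lemma moment_exponent_pos: "m \<ge> 1 \<Longrightarrow> moment_exponent m k > 0"
  by (simp add: moment_exponent_def)

lemma monomial_moment_pos: "m \<ge> 1 \<Longrightarrow> monomial_moment m j k > 0"
  by (simp add: monomial_moment_eq kernel_constant_pos moment_exponent_pos pochhammer_pos del: pochhammer_Suc)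

text \<open>Coefficient integrals of dilates pass to the boundary: along radii the dilates tend to
  the boundary value and are dominated by the maximal function. The holomorphic function is the
  conjugate of \<open>s\<close>, so the pairing of \<open>s\<close> with a monomial is a conjugated
  coefficient.\<close>

lemma integral_kernel_monomial2:
  assumes m: "m \<ge> 1" and a: "a > 0"
    and k: "(\<lambda>\<eta>. cnj (s \<eta>)) \<in> hardy_space m a" and bv: "nt_boundary_value m a s s"
    and A: "\<And>r1 r2 j k. 0 \<le> r1 \<Longrightarrow> 0 \<le> r2 \<Longrightarrow> r1\<^sup>2 + r2 ^ (2 * m) < 1 \<Longrightarrow>
       (\<integral>\<theta>. (\<integral>\<phi>. cnj (s (vector [r1 * cis \<theta>, r2 * cis \<phi>])) * cnj (cis \<phi>) ^ k \<partial>circle_measure)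
            * cnj (cis \<theta>) ^ j \<partial>circle_measure) = 4 * pi\<^sup>2 * r1 ^ j * r2 ^ k * (A k j :: complex)"
  shows "(\<integral>\<xi>. s \<xi> * monomial2 j k \<xi> \<partial>sigma_F m) = of_real (monomial_moment m j k) * cnj (A k j)"
proof -
  let ?S = "frontier (ellipsoid m)"
  interpret fin: finite_measure "sigma_F m" by (rule finite_measure_sigma_F [OF m])
  have hol: "holomorphic2_on (\<lambda>\<eta>. cnj (s \<eta>)) (ellipsoid m)"
    using k by (simp add: hardy_space_def)
  have conts: "continuous_on (ellipsoid m) s"
    using continuous_on_cnj [OF holomorphic2_on_continuous [OF hol]] by simp
  obtain r0 where r0: "0 \<le> r0" "r0 < 1"
    "\<And>\<xi> r. \<xi> \<in> ?S \<Longrightarrow> r0 \<le> r \<Longrightarrow> r < 1 \<Longrightarrow> r *\<^sub>R \<xi> \<in> approach_region m a \<xi>"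
    using radial_segment_in_approach_region [OF m a] by blast
  \<comment> \<open>Tends to 1 from below without leaving [r0, 1), so every dilate is dominated by
    the maximal function.\<close>
  define r where "r n = 1 - (1 - r0) / real (Suc n)" for n
  have r: "r0 \<le> r n" "r n < 1" "0 \<le> r n" for n
  proof -
    have "(1 - r0) / real (Suc n) \<le> (1 - r0) / 1"
      using r0 by (intro divide_left_mono) auto
    then show "r0 \<le> r n" by (simp add: r_def)
    then show "0 \<le> r n" using r0 by simp
    show "r n < 1" using r0 by (simp add: r_def)
  qed
  have r_lim: "r \<longlonglongrightarrow> 1"
  proof -
    have "(\<lambda>n. 1 - (1 - r0) * inverse (real (Suc n))) \<longlonglongrightarrow> 1 - (1 - r0) * 0"
      by (intro tendsto_intros LIMSEQ_inverse_real_of_nat)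
    then show ?thesis by (simp add: r_def [abs_def] divide_inverse)
  qed
  define N where "N = nt_maximal m a (\<lambda>\<eta>. cnj (s \<eta>))"
  have N_meas: "N \<in> borel_measurable (sigma_F m)"
    and N_int: "(\<integral>\<^sup>+ \<xi>. (N \<xi>)\<^sup>2 \<partial>sigma_F m) < \<infinity>"
    using k by (simp_all add: hardy_space_def N_def)
  \<comment> \<open>On a finite measure space this inequality turns square integrability into
    integrability.\<close>
  have le: "N \<xi> \<le> 1 + (N \<xi>)\<^sup>2" for \<xi>
  proof (cases "N \<xi> \<le> 1")
    case False
    then have "N \<xi> * 1 \<le> N \<xi> * N \<xi>" by (intro mult_left_mono) auto
    then show ?thesis by (simp add: power2_eq_square add_increasing)
  qed (simp add: add_increasing2)
  have "(\<integral>\<^sup>+ \<xi>. N \<xi> \<partial>sigma_F m) \<le> (\<integral>\<^sup>+ \<xi>. 1 + (N \<xi>)\<^sup>2 \<partial>sigma_F m)"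
    by (intro nn_integral_mono le)
  also have "\<dots> = (\<integral>\<^sup>+ \<xi>. 1 \<partial>sigma_F m) + (\<integral>\<^sup>+ \<xi>. (N \<xi>)\<^sup>2 \<partial>sigma_F m)"
    using N_meas by (intro nn_integral_add) auto
  also have "\<dots> < \<infinity>"
    using N_int fin.emeasure_finite [of "space (sigma_F m)"] by (simp add: less_top [symmetric])
  finally have N1: "(\<integral>\<^sup>+ \<xi>. N \<xi> \<partial>sigma_F m) < \<infinity>" .
  have N_fin: "AE \<xi> in sigma_F m. N \<xi> \<noteq> \<infinity>"
    using nn_integral_noteq_infinite [OF N_meas] N1 by simp
  \<comment> \<open>\<open>N\<close> is extended-valued but finite almost everywhere; its real
    version is the dominating function.\<close>
  define M where "M \<xi> = enn2real (N \<xi>)" for \<xi>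
  have M_meas: "M \<in> borel_measurable (sigma_F m)" unfolding M_def using N_meas by measurable
  have M_int: "integrable (sigma_F m) M"
  proof (rule integrableI_bounded [OF M_meas])
    have "(\<integral>\<^sup>+ \<xi>. ennreal (norm (M \<xi>)) \<partial>sigma_F m) \<le> (\<integral>\<^sup>+ \<xi>. N \<xi> \<partial>sigma_F m)"
    proof (rule nn_integral_mono)
      show "ennreal (norm (M \<xi>)) \<le> N \<xi>" for \<xi>
        by (cases "N \<xi>") (auto simp: M_def)
    qed
    then show "(\<integral>\<^sup>+ \<xi>. ennreal (norm (M \<xi>)) \<partial>sigma_F m) < \<infinity>" using N1 by (rule le_less_trans)
  qed
  define t where "t n \<xi> = s (r n *\<^sub>R \<xi>) * monomial2 j k \<xi>" for n \<xi>
  have s_meas: "s \<in> borel_measurable (sigma_F m)" using bv by (simp add: nt_boundary_value_def)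
  have mono_meas: "monomial2 j k \<in> borel_measurable (sigma_F m)"
    by (intro measurable_sigma_F_continuous continuous_on_monomial2 continuous_on_id)
  have "(\<lambda>n. \<integral>\<xi>. t n \<xi> \<partial>sigma_F m) \<longlonglongrightarrow> (\<integral>\<xi>. s \<xi> * monomial2 j k \<xi> \<partial>sigma_F m)"
  proof (rule integral_dominated_convergence [where w = M])
    show "(\<lambda>\<xi>. s \<xi> * monomial2 j k \<xi>) \<in> borel_measurable (sigma_F m)"
      by (intro borel_measurable_times s_meas mono_meas)
    show "t n \<in> borel_measurable (sigma_F m)" for n
      unfolding t_def
    proof (rule measurable_sigma_F_continuous)
      have "continuous_on ?S (\<lambda>x. s (r n *\<^sub>R x))"
        by (rule continuous_on_compose2 [OF conts])
           (auto intro!: continuous_intros scaled_frontier_ellipsoid [OF m r(3,2)])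
      then show "continuous_on ?S (\<lambda>x. s (r n *\<^sub>R x) * monomial2 j k x)"
        by (intro continuous_on_mult continuous_on_monomial2 continuous_on_id)
    qed
    show "integrable (sigma_F m) M" by (rule M_int)
    show "AE \<xi> in sigma_F m. (\<lambda>n. t n \<xi>) \<longlonglongrightarrow> s \<xi> * monomial2 j k \<xi>"
    proof -
      have "AE \<xi> in sigma_F m. (s \<longlongrightarrow> s \<xi>) (at \<xi> within approach_region m a \<xi>)"
        using bv by (simp add: nt_boundary_value_def)
      then show ?thesis
      proof (rule AE_mp, intro AE_I2 impI)
        fix \<xi> assume "\<xi> \<in> space (sigma_F m)" and lim: "(s \<longlongrightarrow> s \<xi>) (at \<xi> within approach_region m a \<xi>)"
        then have \<xi>: "\<xi> \<in> ?S" by simp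
        have nz: "\<xi> \<noteq> 0" using boundary_bounds(4) [OF m \<xi>] by auto
        have "(\<lambda>n. r n *\<^sub>R \<xi>) \<longlonglongrightarrow> 1 *\<^sub>R \<xi>" by (intro tendsto_intros r_lim)
        \<comment> \<open>The limit is punctured: r n < 1 and \<xi> nonzero keep the radial points
          different from \<xi>.\<close>
        then have "filterlim (\<lambda>n. r n *\<^sub>R \<xi>) (at \<xi> within approach_region m a \<xi>) sequentially"
          unfolding filterlim_at
          using r0(3) [OF \<xi> r(1,2)] nz r(2)
          by (auto intro!: always_eventually simp: scaleR_left_imp_eq) (metis less_irrefl r(2) scaleR_cancel_right scaleR_one)
        from filterlim_compose [OF lim this]
        have "(\<lambda>n. s (r n *\<^sub>R \<xi>)) \<longlonglongrightarrow> s \<xi>" .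
        then show "(\<lambda>n. t n \<xi>) \<longlonglongrightarrow> s \<xi> * monomial2 j k \<xi>"
          unfolding t_def by (intro tendsto_intros)
      qed
    qed
    show "AE \<xi> in sigma_F m. norm (t n \<xi>) \<le> M \<xi>" for n
      using N_fin
    proof (rule AE_mp, intro AE_I2 impI)
      fix \<xi> assume "\<xi> \<in> space (sigma_F m)" and fin: "N \<xi> \<noteq> \<infinity>"
      then have \<xi>: "\<xi> \<in> ?S" by simp
      have "ennreal (cmod (cnj (s (r n *\<^sub>R \<xi>)))) \<le> N \<xi>"
        unfolding N_def nt_maximal_def by (rule SUP_upper [OF r0(3) [OF \<xi> r(1,2)]])
      then have "cmod (s (r n *\<^sub>R \<xi>)) \<le> M \<xi>"
        using fin by (cases "N \<xi>") (auto simp: M_def)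
      then have "cmod (s (r n *\<^sub>R \<xi>)) * cmod (monomial2 j k \<xi>) \<le> M \<xi> * 1"
        using norm_monomial2_le [OF m, of \<xi> j k] \<xi> by (intro mult_mono) (auto simp: M_def)
      then show "norm (t n \<xi>) \<le> M \<xi>" by (simp add: t_def norm_mult)
    qed
  qed
  moreover have "(\<integral>\<xi>. t n \<xi> \<partial>sigma_F m) = of_real (r n ^ (j + k) * monomial_moment m j k) * cnj (A k j)" for n
  proof -
    have "(\<integral>\<xi>. t n \<xi> \<partial>sigma_F m) = (\<integral>\<xi>. cnj (cnj (s (r n *\<^sub>R \<xi>)) * cnj (monomial2 j k \<xi>)) \<partial>sigma_F m)"
      by (simp add: t_def)
    also have "\<dots> = cnj (\<integral>\<xi>. cnj (s (r n *\<^sub>R \<xi>)) * cnj (monomial2 j k \<xi>) \<partial>sigma_F m)"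
      by (rule Bochner_Integration.integral_cnj)
    also have "\<dots> = cnj (of_real (r n ^ (j + k) * monomial_moment m j k) * A k j)"
      by (subst integral_dilation_monomial2 [OF m hol A r(3,2)]) simp_all
    finally show ?thesis by simp
  qed
  moreover have "(\<lambda>n. of_real (r n ^ (j + k) * monomial_moment m j k) * cnj (A k j))
      \<longlonglongrightarrow> of_real (1 ^ (j + k) * monomial_moment m j k) * cnj (A k j)"
    by (intro tendsto_intros r_lim)
  ultimately show ?thesis
    using LIMSEQ_unique by (simp only: power_one mult_1)
qed

text \<open>Pairing with z^j w^k gives the value of the monomial at \<zeta> on one side and a Taylor
  coefficient of \<open>\<lambda>\<eta>. cnj (S \<zeta> \<eta>)\<close> on the other. All
  coefficients are thus known, and evaluation at \<eta> = \<zeta> leaves a real series in |z|^2 and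
  |w|^2.\<close>

lemma kernel_diagonal:
  assumes m: "m \<ge> 1" and a: "a > 0" and S: "fefferman_szego_kernel m a S" and \<zeta>: "\<zeta> \<in> ellipsoid m"
  defines "x \<equiv> (cmod (\<zeta> $ 1))\<^sup>2"
  defines "u \<equiv> scaled_modulus m x ((cmod (\<zeta> $ 2))\<^sup>2)"
  shows "S \<zeta> \<zeta> = of_real (kernel_constant m * ((real m + 2) / (3 * real m)) *
      ((1 - x) powr (- ((4 * real m + 2) / (3 * real m))) *
        ((1 - (real m - 1) / (real m + 2) * u) / (1 - u)\<^sup>2)))"
proof -
  define z w y v where "z = \<zeta> $ 1" and "w = \<zeta> $ 2" and "y = (cmod (\<zeta> $ 2))\<^sup>2" and "v = 1 - x"
  define c where "c = kernel_constant m"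
  define b where "b = moment_exponent m"
  define \<kappa> where "\<kappa> = (4 * real m + 2) / (3 * real m)"
  have x: "0 \<le> x" "x < 1" and u: "0 \<le> u" "u < 1"
    using scaled_modulus_ellipsoid [OF m \<zeta>] by (auto simp: x_def u_def)
  have vec: "vector [z, w] = \<zeta>" by (simp add: z_def w_def vec_eq_iff forall_2)
  have h: "(\<lambda>\<eta>. cnj (S \<zeta> \<eta>)) \<in> hardy_space m a" "nt_boundary_value m a (S \<zeta>) (S \<zeta>)"
    and repr: "\<And>f g. f \<in> hardy_space m a \<Longrightarrow> nt_boundary_value m a f g \<Longrightarrow> f \<zeta> = (\<integral>\<xi>. S \<zeta> \<xi> * g \<xi> \<partial>sigma_F m)"
    using S \<zeta> unfolding fefferman_szego_kernel_def by blast+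
  have hol: "holomorphic2_on (\<lambda>\<eta>. cnj (S \<zeta> \<eta>)) (ellipsoid m)"
    using h(1) by (simp add: hardy_space_def)
  obtain A :: "nat \<Rightarrow> nat \<Rightarrow> complex" where
    A: "\<And>z w. vector [z, w] \<in> ellipsoid m \<Longrightarrow>
       \<exists>C. (\<forall>k. (\<lambda>j. A k j * z ^ j) sums C k) \<and> (\<lambda>k. C k * w ^ k) sums cnj (S \<zeta> (vector [z, w]))"
    "\<And>r1 r2 j k. 0 \<le> r1 \<Longrightarrow> 0 \<le> r2 \<Longrightarrow> r1\<^sup>2 + r2 ^ (2 * m) < 1 \<Longrightarrow>
       (\<integral>\<theta>. (\<integral>\<phi>. cnj (S \<zeta> (vector [r1 * cis \<theta>, r2 * cis \<phi>])) * cnj (cis \<phi>) ^ k \<partial>circle_measure)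
            * cnj (cis \<theta>) ^ j \<partial>circle_measure) = 4 * pi\<^sup>2 * r1 ^ j * r2 ^ k * A k j"
    by (rule holomorphic2_on_torus_expansion [OF m hol]) (rule that)
  \<comment> \<open>A monomial is its own boundary value, so the reproducing formula applies to it
    on both sides.\<close>
  have coeff: "A k j = cnj (monomial2 j k \<zeta>) / of_real (monomial_moment m j k)" for j k
  proof -
    have "monomial2 j k \<zeta> = of_real (monomial_moment m j k) * cnj (A k j)"
      using repr [OF monomial2_hardy_space [OF m] nt_boundary_value_monomial2]
        integral_kernel_monomial2 [OF m a h A(2)] by simp
    then have "cnj (monomial2 j k \<zeta>) = of_real (monomial_moment m j k) * A k j"
      by simp
    then show ?thesis using monomial_moment_pos [OF m, of j k] by (simp add: field_simps)
  qed
  obtain C where C: "\<And>k. (\<lambda>j. A k j * z ^ j) sums C k" "(\<lambda>k. C k * w ^ k) sums cnj (S \<zeta> \<zeta>)"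
    using A(1) [of z w] \<zeta> unfolding vec by blast
  have zz: "cnj z ^ j * z ^ j = of_real (x ^ j)" for j
  proof -
    have "complex_of_real x = z * cnj z" by (simp only: x_def z_def complex_norm_square)
    then show ?thesis by (simp add: power_mult_distrib)
  qed
  have ww: "cnj w ^ k * w ^ k = of_real (y ^ k)" for k
  proof -
    have "complex_of_real y = w * cnj w" by (simp only: y_def w_def complex_norm_square)
    then show ?thesis by (simp add: power_mult_distrib)
  qed
  \<comment> \<open>The sum over j is the binomial series with base b k.\<close>
  have Ck: "C k = cnj w ^ k * of_real (c * (b k * v powr (- b k - 1)))" for k
  proof -
    have "A k j * z ^ j = cnj w ^ k * of_real (c * (pochhammer (b k) (Suc j) / fact j * x ^ j))" for j
    proof -
      have "A k j * z ^ j = cnj w ^ k * (cnj z ^ j * z ^ j) / of_real (monomial_moment m j k)"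
        by (simp add: coeff monomial2_def z_def w_def)
      also have "\<dots> = cnj w ^ k * of_real (x ^ j / monomial_moment m j k)"
        by (simp only: zz of_real_divide times_divide_eq_right)
      also have "x ^ j / monomial_moment m j k = c * (pochhammer (b k) (Suc j) / fact j * x ^ j)"
        by (simp add: monomial_moment_eq [OF m] c_def b_def del: pochhammer_Suc)
      finally show ?thesis .
    qed
    moreover have "(\<lambda>j. cnj w ^ k * complex_of_real (c * (pochhammer (b k) (Suc j) / fact j * x ^ j))) sums
        (cnj w ^ k * of_real (c * (b k * (1 - x) powr (- b k - 1))))"
      by (intro sums_mult sums_of_real sums_pochhammer_power x)
    ultimately show ?thesis
      using sums_unique2 [OF C(1)] by (simp only: v_def)
  qed
  have term_eq: "C k * w ^ k = of_real (c * (v powr (- \<kappa>) * (b k * u ^ k)))" for k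
  proof -
    \<comment> \<open>The part of the exponent depending on k is -k/m, which joins |w|^(2k) to form
      u^k; what remains is \<kappa> = b 0 + 1.\<close>
    have "- b k - 1 = - \<kappa> + (- 1 / real m) * real k"
      using m by (simp add: b_def \<kappa>_def moment_exponent_def field_simps)
    moreover have "(v powr (- 1 / real m)) ^ k = v powr ((- 1 / real m) * real k)"
      using x by (simp add: powr_realpow [symmetric] powr_powr v_def)
    ultimately have "v powr (- b k - 1) = v powr (- \<kappa>) * (v powr (- 1 / real m)) ^ k"
      by (simp only: powr_add)
    then have "y ^ k * (b k * v powr (- b k - 1)) = v powr (- \<kappa>) * (b k * u ^ k)"
      by (simp add: u_def scaled_modulus_def y_def v_def power_mult_distrib)
    moreover have "C k * w ^ k = of_real (c * (y ^ k * (b k * v powr (- b k - 1))))"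
    proof -
      have "C k * w ^ k = (cnj w ^ k * w ^ k) * of_real (c * (b k * v powr (- b k - 1)))"
        by (simp only: Ck mult_ac)
      also have "\<dots> = of_real (c * (y ^ k * (b k * v powr (- b k - 1))))"
        unfolding ww of_real_mult [symmetric] by (simp only: mult_ac)
      finally show ?thesis .
    qed
    ultimately show ?thesis by (simp only:)
  qed
  have "(\<lambda>k. complex_of_real (c * (v powr (- \<kappa>) * (b k * u ^ k)))) sums
      of_real (c * (v powr (- \<kappa>) * ((real m + 2) / (3 * real m) * ((1 - (real m - 1) / (real m + 2) * u) / (1 - u)\<^sup>2))))"
    unfolding b_def moment_exponent_def
    by (intro sums_of_real sums_mult sums_linear_geometric u m)
  with C(2) have "cnj (S \<zeta> \<zeta>) = of_real (c * (v powr (- \<kappa>) * ((real m + 2) / (3 * real m) * ((1 - (real m - 1) / (real m + 2) * u) / (1 - u)\<^sup>2))))"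
    unfolding term_eq by (rule sums_unique2)
  then have "S \<zeta> \<zeta> = of_real (c * (v powr (- \<kappa>) * ((real m + 2) / (3 * real m) * ((1 - (real m - 1) / (real m + 2) * u) / (1 - u)\<^sup>2))))"
    by (metis complex_cnj_cnj complex_cnj_complex_of_real)
  then show ?thesis
    by (simp only: c_def v_def \<kappa>_def mult_ac)
qed

text \<open>Since y (1 - x)^(-1/m) = u, the product of the off-diagonal entries cancels the
  contribution of x u M / m^2 from the first diagonal entry. The determinant is therefore a pure
  product, and its logarithm splits.\<close>

lemma (in ellipsoid_potential) det_hessian_potential:
  assumes p: "p \<in> ellipsoid m"
  shows "det (\<chi> i j. wirtinger i (wirtinger_bar j G) p :: complex^2^2) =
    of_real ((1 - (cmod (p $ 1))\<^sup>2) powr (- 2 - 1 / real m) *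
      (Q (scaled_modulus m ((cmod (p $ 1))\<^sup>2) ((cmod (p $ 2))\<^sup>2)) * M (scaled_modulus m ((cmod (p $ 1))\<^sup>2) ((cmod (p $ 2))\<^sup>2))))"
proof -
  define x y where "x = (cmod (p $ 1))\<^sup>2" and "y = (cmod (p $ 2))\<^sup>2"
  define v u where "v = 1 - x" and "u = scaled_modulus m x y"
  define P where "P = v powr (- 1 / real m)"
  note hess = hessian_potential [OF p, folded x_def y_def, folded v_def u_def, folded P_def]
  have v: "v > 0" using scaled_modulus_ellipsoid(1) [OF m p] by (simp add: v_def x_def)
  have yP: "u = y * P" by (simp add: u_def scaled_modulus_def P_def v_def)
  have zz: "p $ 1 * cnj (p $ 1) = of_real x" "p $ 2 * cnj (p $ 2) = of_real y"
    by (simp_all only: x_def y_def complex_norm_square)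
  have "det (\<chi> i j. wirtinger i (wirtinger_bar j G) p :: complex^2^2) =
      of_real ((Q u + x * u * M u / (real m)\<^sup>2) / v\<^sup>2) * of_real (M u * P)
      - (p $ 2 * cnj (p $ 1) * of_real (M u * P / (real m * v))) * (p $ 1 * cnj (p $ 2) * of_real (M u * P / (real m * v)))"
    by (simp add: det_2 hess)
  also have "\<dots> = of_real ((Q u + x * u * M u / (real m)\<^sup>2) / v\<^sup>2) * of_real (M u * P)
      - (p $ 1 * cnj (p $ 1)) * (p $ 2 * cnj (p $ 2)) * (of_real (M u * P / (real m * v)) * of_real (M u * P / (real m * v)))"
    by (simp only: mult_ac)
  also have "\<dots> = of_real ((Q u + x * u * M u / (real m)\<^sup>2) / v\<^sup>2 * (M u * P) - x * y * (M u * P / (real m * v) * (M u * P / (real m * v))))"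
    by (simp only: zz of_real_mult of_real_diff)
  also have "(Q u + x * u * M u / (real m)\<^sup>2) / v\<^sup>2 * (M u * P) - x * y * (M u * P / (real m * v) * (M u * P / (real m * v))) = P / v\<^sup>2 * (Q u * M u)"
    unfolding yP by (simp add: power2_eq_square add_divide_distrib algebra_simps)
  also have "P / v\<^sup>2 = v powr (- 2 - 1 / real m)"
  proof -
    have "- 2 - 1 / real m = - 1 / real m - 2" by simp
    then have "v powr (- 2 - 1 / real m) = v powr (- 1 / real m) / v powr 2"
      by (simp only: powr_diff)
    then show ?thesis using v by (simp add: P_def)
  qed
  finally show ?thesis by (simp only: x_def y_def u_def v_def)
qed

text \<open>On the axis 1 - |z|^2 = 1 and u = |w|^2, and the off-diagonal entries contain the factor
  z = 0.\<close>

lemma (in ellipsoid_potential) hessian_potential_axis: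
  assumes "cmod w < 1"
  shows "(\<chi> i j. wirtinger i (wirtinger_bar j G) (vector [0, w]) :: complex^2^2) =
    vector [vector [of_real (Q ((cmod w)\<^sup>2)), 0], vector [0, of_real (M ((cmod w)\<^sup>2))]]"
proof -
  have "vector [0, w] \<in> ellipsoid m"
    using assms m by (simp add: ellipsoid_iff power_less_one_iff)
  from hessian_potential [OF this] show ?thesis
    by (simp add: vec_eq_iff forall_2 scaled_modulus_def)
qed

section \<open>The metric and its Ricci curvature\<close>

text \<open>The map y -> (1 - y)/(1 - r y) is an involution, so the same formula leads back from t
  to y.\<close>

lemma ratio_coordinates:
  fixes r y :: real
  assumes r: "0 \<le> r" "r < 1" and y: "0 \<le> y" "y < 1"
  defines "t \<equiv> (1 - y) / (1 - r * y)"
  shows "0 < t" "t \<le> 1" "y = (1 - t) / (1 - r * t)" "1 - y = t * (1 - r) / (1 - r * t)" "1 - r * y = (1 - r) / (1 - r * t)"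
    "0 < 1 - r * t"
proof -
  have ry: "r * y \<le> y" using mult_right_mono [of r 1 y] r y by simp
  then have d: "1 - r * y > 0" using y by linarith
  show "0 < t" using d y by (simp add: t_def)
  show t1: "t \<le> 1" using d ry by (simp add: t_def divide_le_eq)
  have e: "1 - r * t = (1 - r) / (1 - r * y)"
    using d by (simp add: t_def field_simps)
  show "0 < 1 - r * t" unfolding e using d r by simp
  show "1 - r * y = (1 - r) / (1 - r * t)" unfolding e using d r by simp
  show "1 - y = t * (1 - r) / (1 - r * t)" unfolding e using d r by (simp add: t_def)
  have "(1 - t) = (y * (1 - r)) / (1 - r * y)" using d by (simp add: t_def field_simps)
  then show "y = (1 - t) / (1 - r * t)" unfolding e using d r by simp
qed

text \<open>These are the values at y of Q, M, M' and M'' for the potential log S. The last three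
  combine powers of 1/(1 - y) and 1/(1 - r y), which share their numerator 1 - r t in the variable
  t.\<close>

lemma metric_coefficients:
  fixes r t m y :: real
  assumes m: "m = (1 + 2 * r) / (1 - r)" and r: "0 \<le> r" "r < 1" and t: "0 < t" "0 < 1 - r * t"
    and y: "y = (1 - t) / (1 - r * t)" "1 - y = t * (1 - r) / (1 - r * t)" "1 - r * y = (1 - r) / (1 - r * t)"
  shows "(4 * m + 2) / (3 * m) + y * (2 / (1 - y) - r / (1 - r * y)) / m = (2 + r * t + r * t\<^sup>2) / (t * (1 + 2 * r))"
    and "2 / (1 - y)\<^sup>2 - r / (1 - r * y)\<^sup>2 = (2 - r * t\<^sup>2) * ((1 - r * t)\<^sup>2 / (t\<^sup>2 * (1 - r)\<^sup>2))"
    and "4 / (1 - y) ^ 3 - 2 * r\<^sup>2 / (1 - r * y) ^ 3 = 2 * (1 - r * t) ^ 3 * (2 - r\<^sup>2 * t ^ 3) / (t ^ 3 * (1 - r) ^ 3)"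
    and "12 / (1 - y) ^ 4 - 6 * r ^ 3 / (1 - r * y) ^ 4 = 6 * (1 - r * t) ^ 4 * (2 - r ^ 3 * t ^ 4) / (t ^ 4 * (1 - r) ^ 4)"
proof -
  define e f where "e = 1 - r" and "f = 1 - r * t"
  have e: "e > 0" and f: "f > 0" using r t by (simp_all add: e_def f_def)
  have q: "1 + 2 * r > 0" using r by simp
  have m': "m = (1 + 2 * r) / e" by (simp add: m e_def)
  note y' = y [folded e_def f_def]
  have "y * (2 / (1 - y) - r / (1 - r * y)) = (1 - t) * (2 / t - r) / e"
    unfolding y'(2,3) unfolding y'(1) using e f t by (simp add: field_simps)
  then have "y * (2 / (1 - y) - r / (1 - r * y)) / m = (1 - t) * (2 / t - r) / (1 + 2 * r)"
    using e q by (simp add: m')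
  moreover have "(4 * m + 2) / (3 * m) = 2 * (1 + r) / (1 + 2 * r)"
  proof -
    have "(4 * m + 2) / (3 * m) = (4 * (1 + 2 * r) + 2 * e) / (3 * (1 + 2 * r))"
      using e q by (simp add: m' divide_simps)
    also have "4 * (1 + 2 * r) + 2 * e = 3 * (2 * (1 + r))" by (simp add: e_def)
    also have "3 * (2 * (1 + r)) / (3 * (1 + 2 * r)) = 2 * (1 + r) / (1 + 2 * r)"
      by (rule mult_divide_mult_cancel_left) simp
    finally show ?thesis .
  qed
  ultimately have "(4 * m + 2) / (3 * m) + y * (2 / (1 - y) - r / (1 - r * y)) / m
      = (2 * (1 + r) + (1 - t) * (2 / t - r)) / (1 + 2 * r)"
    by (simp only: add_divide_distrib)
  also have "2 * (1 + r) + (1 - t) * (2 / t - r) = (2 + r * t + r * t\<^sup>2) / t"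
    using t by (simp add: field_simps power2_eq_square)
  finally show "(4 * m + 2) / (3 * m) + y * (2 / (1 - y) - r / (1 - r * y)) / m = (2 + r * t + r * t\<^sup>2) / (t * (1 + 2 * r))"
    by simp
  show "2 / (1 - y)\<^sup>2 - r / (1 - r * y)\<^sup>2 = (2 - r * t\<^sup>2) * ((1 - r * t)\<^sup>2 / (t\<^sup>2 * (1 - r)\<^sup>2))"
    unfolding y'(2,3) e_def [symmetric] f_def [symmetric] using e f t
    by (simp add: power_divide power_mult_distrib field_simps)
  show "4 / (1 - y) ^ 3 - 2 * r\<^sup>2 / (1 - r * y) ^ 3 = 2 * (1 - r * t) ^ 3 * (2 - r\<^sup>2 * t ^ 3) / (t ^ 3 * (1 - r) ^ 3)"
    unfolding y'(2,3) e_def [symmetric] f_def [symmetric] using e f t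
    by (simp add: power_divide power_mult_distrib field_simps)
  show "12 / (1 - y) ^ 4 - 6 * r ^ 3 / (1 - r * y) ^ 4 = 6 * (1 - r * t) ^ 4 * (2 - r ^ 3 * t ^ 4) / (t ^ 4 * (1 - r) ^ 4)"
    unfolding y'(2,3) e_def [symmetric] f_def [symmetric] using e f t
    by (simp add: power_divide power_mult_distrib field_simps)
qed

text \<open>The left side is -(2 + 1/m + y L'/m) for L = log Q + log M, written in r and t.\<close>

lemma ricci_coefficient_11:
  fixes r t :: real
  assumes "0 \<le> r" "0 < t" "2 + r * t + r * t\<^sup>2 \<noteq> 0" "2 - r * t\<^sup>2 \<noteq> 0"
  defines "\<alpha> \<equiv> 2 + r * t + r * t\<^sup>2" and "\<beta> \<equiv> 2 - r * t\<^sup>2"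
  shows "- ((3 + 3 * r) / (1 + 2 * r) + (1 - t) * (1 - r * t) * \<beta> / ((1 + 2 * r) * t * \<alpha>)
      + 2 * (1 - t) * (2 - r\<^sup>2 * t ^ 3) / ((1 + 2 * r) * t * \<beta>)) =
    - ((2 * (- (r\<^sup>2 * t ^ 4) + (3 * r\<^sup>2 + 2 * r) * t ^ 3 + 2 * r\<^sup>2 * t\<^sup>2 - 2) + 4 * \<alpha>) / (t * \<alpha> * (1 + 2 * r)))
    + (- 2 * r\<^sup>2 * t ^ 4 + (r + r\<^sup>2) * t ^ 3 + 2 * (1 + r) * t - 4) / ((2 * r + 1) * t * \<beta>)
    + (1 - t) * (1 - r * t) * \<beta> / (t * \<alpha> * (1 + 2 * r))"
proof -
  define q where "q = 1 + 2 * r"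
  define A where "A = - (r\<^sup>2 * t ^ 4) + (3 * r\<^sup>2 + 2 * r) * t ^ 3 + 2 * r\<^sup>2 * t\<^sup>2 - 2"
  define B where "B = - 2 * r\<^sup>2 * t ^ 4 + (r + r\<^sup>2) * t ^ 3 + 2 * (1 + r) * t - 4"
  define C where "C = (1 - t) * (1 - r * t) * \<beta>"
  define D where "D = 2 * (1 - t) * (2 - r\<^sup>2 * t ^ 3)"
  have q: "q \<noteq> 0" "2 * r + 1 = q" using assms(1) by (simp_all add: q_def)
  have nz: "\<alpha> \<noteq> 0" "\<beta> \<noteq> 0" "t \<noteq> 0" using assms by auto
  \<comment> \<open>Over the common denominator t \<alpha> \<beta> q the claim is this polynomial
    identity; \<open>C\<close> is doubled because it occurs on both sides with opposite
    signs.\<close>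
  have poly: "(2 * A + 4 * \<alpha>) * \<beta> = B * \<alpha> + 2 * C * \<beta> + (3 + 3 * r) * t * \<alpha> * \<beta> + D * \<alpha>"
    unfolding A_def B_def C_def D_def \<alpha>_def \<beta>_def by algebra
  have "- ((3 + 3 * r) / q + C / (q * t * \<alpha>) + D / (q * t * \<beta>)) =
      - ((2 * A + 4 * \<alpha>) / (t * \<alpha> * q)) + B / (q * t * \<beta>) + C / (t * \<alpha> * q)"
  proof -
    have "(2 * A + 4 * \<alpha>) / (t * \<alpha> * q) = ((2 * A + 4 * \<alpha>) * \<beta>) / (t * \<alpha> * \<beta> * q)"
      using nz by simp
    also have "\<dots> = (B * \<alpha> + 2 * C * \<beta> + (3 + 3 * r) * t * \<alpha> * \<beta> + D * \<alpha>) / (t * \<alpha> * \<beta> * q)"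
      by (simp only: poly)
    also have "\<dots> = B / (q * t * \<beta>) + 2 * C / (t * \<alpha> * q) + (3 + 3 * r) / q + D / (q * t * \<beta>)"
      using nz q by (simp add: add_divide_distrib mult_ac)
    finally show ?thesis by (simp add: mult_ac)
  qed
  then show ?thesis unfolding A_def B_def C_def D_def q(2) unfolding q_def by simp
qed

text \<open>The two fractions on the left are M'/M and y M''/M; over the denominator of the right
  side the numerators agree as polynomials in r and t.\<close>

lemma ricci_coefficient_22:
  fixes r t :: real
  assumes "t \<noteq> 0" "1 - r \<noteq> 0" "2 - r * t\<^sup>2 \<noteq> 0"
  shows "- (2 * (1 - r * t) * (2 - r\<^sup>2 * t ^ 3) / (t * (1 - r) * (2 - r * t\<^sup>2))
      + 6 * (1 - t) * (1 - r * t) * (2 - r ^ 3 * t ^ 4) / (t\<^sup>2 * (1 - r)\<^sup>2 * (2 - r * t\<^sup>2))) =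
    (- 2 * t\<^sup>2 * (1 - r)\<^sup>2 * (2 - r\<^sup>2 * t\<^sup>2)
      - 8 * t * (1 - r) * (1 - t) * (2 - r ^ 3 * t ^ 3)
      - 6 * (1 - t)\<^sup>2 * (2 - r ^ 4 * t ^ 4)) / (t\<^sup>2 * (1 - r)\<^sup>2 * (2 - r * t\<^sup>2))"
proof -
  define e b where "e = 1 - r" and "b = 2 - r * t\<^sup>2"
  have nz: "t \<noteq> 0" "e \<noteq> 0" "b \<noteq> 0" using assms by (simp_all add: e_def b_def)
  have poly: "- (2 * t * e * (1 - r * t) * (2 - r\<^sup>2 * t ^ 3) + 6 * (1 - t) * (1 - r * t) * (2 - r ^ 3 * t ^ 4)) =
     - 2 * t\<^sup>2 * e\<^sup>2 * (2 - r\<^sup>2 * t\<^sup>2) - 8 * t * e * (1 - t) * (2 - r ^ 3 * t ^ 3) - 6 * (1 - t)\<^sup>2 * (2 - r ^ 4 * t ^ 4)"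
    unfolding e_def by algebra
  have "2 * (1 - r * t) * (2 - r\<^sup>2 * t ^ 3) / (t * e * b) = 2 * t * e * (1 - r * t) * (2 - r\<^sup>2 * t ^ 3) / (t\<^sup>2 * e\<^sup>2 * b)"
  proof -
    have "X / (t * e * b) = (t * e * X) / (t\<^sup>2 * e\<^sup>2 * b)" for X
      using nz by (simp add: power2_eq_square)
    from this [of "2 * (1 - r * t) * (2 - r\<^sup>2 * t ^ 3)"] show ?thesis by (simp only: mult_ac)
  qed
  then show ?thesis
    unfolding e_def [symmetric] b_def [symmetric] poly [symmetric]
    by (simp only: minus_divide_left [symmetric] add_divide_distrib)
qed

lemma DERIV_divide_linear_power:
  fixes a c u :: real
  assumes "1 - a * u \<noteq> 0"
  shows "((\<lambda>u. c / (1 - a * u) ^ n) has_real_derivative c * real n * a / (1 - a * u) ^ Suc n) (at u)"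
proof (cases n)
  case (Suc k)
  have "((\<lambda>u. inverse (1 - a * u)) has_real_derivative a * (inverse (1 - a * u))\<^sup>2) (at u)"
    using assms by (auto intro!: derivative_eq_intros simp: power2_eq_square)
  from DERIV_cmult [OF DERIV_power [OF this], of c n]
  have "((\<lambda>u. c * inverse (1 - a * u) ^ n) has_real_derivative
      c * (real n * (a * (inverse (1 - a * u))\<^sup>2 * inverse (1 - a * u) ^ k))) (at u)"
    using Suc by simp
  then show ?thesis
    using Suc by (simp add: divide_inverse power_inverse power2_eq_square mult_ac)
qed simp

text \<open>For log Q + log M with Q' = M/m, put X = Q'/Q and Y = M'/M. Then L' = X + Y and L'' =
  Q''/Q - X^2 + M''/M - Y^2, where \<open>M0\<close>, \<open>M1\<close>, \<open>M2\<close> are the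
  values of M, M', M''. In the second entry D comes from -(Y + y M''/M), E from y Y^2, and F from -X
  - y Q''/Q + y X^2.\<close>

lemma ricci_from_derivatives:
  fixes r t m y Qv M0 M1 M2 L2' L2'' :: real
  assumes m: "m = (1 + 2 * r) / (1 - r)" and r: "0 \<le> r" "r < 1" and t: "0 < t" "t \<le> 1" "0 < 1 - r * t"
    and y: "y = (1 - t) / (1 - r * t)"
    and Qv: "Qv = (2 + r * t + r * t\<^sup>2) / (t * (1 + 2 * r))"
    and M0: "M0 = (2 - r * t\<^sup>2) * ((1 - r * t)\<^sup>2 / (t\<^sup>2 * (1 - r)\<^sup>2))"
    and M1: "M1 = 2 * (1 - r * t) ^ 3 * (2 - r\<^sup>2 * t ^ 3) / (t ^ 3 * (1 - r) ^ 3)"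
    and M2: "M2 = 6 * (1 - r * t) ^ 4 * (2 - r ^ 3 * t ^ 4) / (t ^ 4 * (1 - r) ^ 4)"
    and L2': "L2' = M0 / m / Qv + M1 / M0"
    and L2'': "L2'' = (M1 / m * Qv - M0 / m * (M0 / m)) / (Qv * Qv) + (M2 * M0 - M1 * M1) / (M0 * M0)"
  shows "- (2 + 1 / m + y * L2' / m) =
    - ((2 * (- (r\<^sup>2 * t ^ 4) + (3 * r\<^sup>2 + 2 * r) * t ^ 3 + 2 * r\<^sup>2 * t\<^sup>2 - 2) + 4 * (2 + r * t + r * t\<^sup>2)) / (t * (2 + r * t + r * t\<^sup>2) * (1 + 2 * r)))
    + (- 2 * r\<^sup>2 * t ^ 4 + (r + r\<^sup>2) * t ^ 3 + 2 * (1 + r) * t - 4) / ((2 * r + 1) * t * (2 - r * t\<^sup>2))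
    + (1 - t) * (1 - r * t) * (2 - r * t\<^sup>2) / (t * (2 + r * t + r * t\<^sup>2) * (1 + 2 * r))" (is ?R11)
    and "- (L2' + y * L2'') =
    (- 2 * t\<^sup>2 * (1 - r)\<^sup>2 * (2 - r\<^sup>2 * t\<^sup>2)
      - 8 * t * (1 - r) * (1 - t) * (2 - r ^ 3 * t ^ 3)
      - 6 * (1 - t)\<^sup>2 * (2 - r ^ 4 * t ^ 4)) / (t\<^sup>2 * (1 - r)\<^sup>2 * (2 - r * t\<^sup>2))
    + 4 * (1 - t) * (1 - r * t) * (2 - r\<^sup>2 * t ^ 3)\<^sup>2 / (t\<^sup>2 * (1 - r)\<^sup>2 * (2 - r * t\<^sup>2)\<^sup>2)
    + (- ((1 - r * t)\<^sup>2 * (2 - r * t\<^sup>2) / ((1 - r) * t * (2 + r * t + r * t\<^sup>2)))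
       - 2 * (1 - t) * (1 - r * t)\<^sup>2 * (2 - r\<^sup>2 * t ^ 3) / ((1 - r)\<^sup>2 * t\<^sup>2 * (2 + r * t + r * t\<^sup>2))
       + (1 - t) * (1 - r * t) ^ 3 * (2 - r * t\<^sup>2)\<^sup>2 / ((1 - r)\<^sup>2 * t\<^sup>2 * (2 + r * t + r * t\<^sup>2)\<^sup>2))" (is ?R22)
proof -
  define e f q \<alpha> \<beta> P R where "e = 1 - r" and "f = 1 - r * t" and "q = 1 + 2 * r"
    and "\<alpha> = 2 + r * t + r * t\<^sup>2" and "\<beta> = 2 - r * t\<^sup>2" and "P = 2 - r\<^sup>2 * t ^ 3" and "R = 2 - r ^ 3 * t ^ 4"
  note d = e_def [symmetric] f_def [symmetric] q_def [symmetric] \<alpha>_def [symmetric] \<beta>_def [symmetric] P_def [symmetric] R_def [symmetric]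
  have "r * t\<^sup>2 \<le> 1 * 1" using r t by (intro mult_mono power_le_one) auto
  then have \<beta>: "\<beta> > 0" by (simp add: \<beta>_def)
  have \<alpha>: "\<alpha> > 0" using r t by (simp add: \<alpha>_def add_pos_nonneg)
  have pos: "e > 0" "f > 0" "q > 0" "t > 0" using r t by (simp_all add: e_def f_def q_def)
  have \<alpha>': "2 + r * t + r * t\<^sup>2 \<noteq> 0" and \<beta>': "2 - r * t\<^sup>2 \<noteq> 0" and e': "1 - r \<noteq> 0"
    using \<alpha> \<beta> pos by (simp_all add: \<alpha>_def \<beta>_def e_def)
  note eqs = m y Qv M0 M1 M2
  note E = eqs [unfolded d]
  have nz: "m \<noteq> 0" "Qv \<noteq> 0" "M0 \<noteq> 0" unfolding E using pos \<alpha> \<beta> by auto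
  define X Y where "X = M0 / m / Qv" and "Y = M1 / M0"
  have X: "X = f\<^sup>2 * \<beta> / (e * t * \<alpha>)"
    unfolding X_def E using pos \<alpha> by (simp add: power2_eq_square mult_ac)
  have Y: "Y = 2 * f * P / (t * e * \<beta>)"
    unfolding Y_def E using pos \<beta> by (simp add: power2_eq_square power3_eq_cube mult_ac)
  have Z: "M2 / M0 = 6 * f\<^sup>2 * R / (t\<^sup>2 * e\<^sup>2 * \<beta>)"
    unfolding E using pos \<beta> by (simp add: power2_eq_square power4_eq_xxxx mult_ac)
  have V: "M1 / m / Qv = 2 * f ^ 3 * P / (e\<^sup>2 * t\<^sup>2 * \<alpha>)"
    unfolding E using pos \<alpha> by (simp add: power2_eq_square power3_eq_cube mult_ac)
  have L1: "L2' = X + Y" by (simp add: L2' X_def Y_def)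
  have L2: "L2'' = M1 / m / Qv - X\<^sup>2 + M2 / M0 - Y\<^sup>2"
  proof -
    have "(M1 / m * Qv - M0 / m * (M0 / m)) / (Qv * Qv) = M1 / m / Qv - X\<^sup>2"
      using nz by (simp add: X_def diff_divide_distrib power2_eq_square)
    moreover have "(M2 * M0 - M1 * M1) / (M0 * M0) = M2 / M0 - Y\<^sup>2"
      using nz by (simp add: Y_def diff_divide_distrib power2_eq_square)
    ultimately show ?thesis by (simp add: L2'')
  qed
  have m1: "2 + 1 / m = (3 + 3 * r) / q"
  proof -
    have "1 / m = e / q" by (simp add: E)
    then have "2 + 1 / m = (2 * q + e) / q" using pos by (simp add: add_divide_distrib)
    also have "2 * q + e = 3 + 3 * r" by (simp add: q_def e_def)
    finally show ?thesis .
  qed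
  have "y * L2' / m = (1 - t) * f * \<beta> / (q * t * \<alpha>) + 2 * (1 - t) * P / (q * t * \<beta>)"
  proof -
    have "y * X / m = (1 - t) * f * \<beta> / (q * t * \<alpha>)"
      unfolding X E(1,2) using pos by (simp add: power2_eq_square mult_ac)
    moreover have "y * Y / m = 2 * (1 - t) * P / (q * t * \<beta>)"
      unfolding Y E(1,2) using pos by (simp add: mult_ac)
    ultimately show ?thesis by (simp add: L1 distrib_left add_divide_distrib)
  qed
  then have R11: "- (2 + 1 / m + y * L2' / m) = - ((3 + 3 * r) / q + (1 - t) * f * \<beta> / (q * t * \<alpha>) + 2 * (1 - t) * P / (q * t * \<beta>))"
    by (simp only: m1 add.assoc)
  show ?R11
    unfolding R11 unfolding f_def q_def \<alpha>_def \<beta>_def P_def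
    by (rule ricci_coefficient_11 [OF r(1) t(1) \<alpha>' \<beta>'])
  have yZ: "y * (M2 / M0) = 6 * (1 - t) * f * R / (t\<^sup>2 * e\<^sup>2 * \<beta>)"
    unfolding Z E(2) using pos by (simp add: power2_eq_square mult_ac)
  have yV: "y * (M1 / m / Qv) = 2 * (1 - t) * f\<^sup>2 * P / (e\<^sup>2 * t\<^sup>2 * \<alpha>)"
    unfolding V E(2) using pos by (simp add: power2_eq_square power3_eq_cube mult_ac)
  have yX: "y * X\<^sup>2 = (1 - t) * f ^ 3 * \<beta>\<^sup>2 / (e\<^sup>2 * t\<^sup>2 * \<alpha>\<^sup>2)"
    unfolding X E(2) using pos by (simp add: power2_eq_square power3_eq_cube mult_ac)
  have yY: "y * Y\<^sup>2 = 4 * (1 - t) * f * P\<^sup>2 / (t\<^sup>2 * e\<^sup>2 * \<beta>\<^sup>2)"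
    unfolding Y E(2) using pos by (simp add: power2_eq_square mult_ac)
  have "- (L2' + y * L2'') = - (Y + y * (M2 / M0)) + y * Y\<^sup>2 + (- X - y * (M1 / m / Qv) + y * X\<^sup>2)"
    unfolding L1 L2 by (simp add: algebra_simps)
  also have "\<dots> = - (2 * f * P / (t * e * \<beta>) + 6 * (1 - t) * f * R / (t\<^sup>2 * e\<^sup>2 * \<beta>))
      + 4 * (1 - t) * f * P\<^sup>2 / (t\<^sup>2 * e\<^sup>2 * \<beta>\<^sup>2)
      + (- (f\<^sup>2 * \<beta> / (e * t * \<alpha>)) - 2 * (1 - t) * f\<^sup>2 * P / (e\<^sup>2 * t\<^sup>2 * \<alpha>) + (1 - t) * f ^ 3 * \<beta>\<^sup>2 / (e\<^sup>2 * t\<^sup>2 * \<alpha>\<^sup>2))"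
    unfolding yZ yV yX yY unfolding X Y ..
  finally have R22: "- (L2' + y * L2'') = \<dots>" .
  have ric: "- (2 * f * P / (t * e * \<beta>) + 6 * (1 - t) * f * R / (t\<^sup>2 * e\<^sup>2 * \<beta>)) =
    (- 2 * t\<^sup>2 * (1 - r)\<^sup>2 * (2 - r\<^sup>2 * t\<^sup>2)
      - 8 * t * (1 - r) * (1 - t) * (2 - r ^ 3 * t ^ 3)
      - 6 * (1 - t)\<^sup>2 * (2 - r ^ 4 * t ^ 4)) / (t\<^sup>2 * (1 - r)\<^sup>2 * (2 - r * t\<^sup>2))"
    unfolding e_def f_def P_def R_def \<beta>_def by (rule ricci_coefficient_22) (use pos \<beta>' e' in auto)
  show ?R22
    unfolding R22 ric unfolding e_def f_def \<alpha>_def \<beta>_def P_def R_def ..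
qed

theorem theorem1p4:
  fixes m :: nat and a :: real and S :: "complex^2 \<Rightarrow> complex^2 \<Rightarrow> complex" and w :: complex
  assumes "m \<ge> 1" and "a > 0"
    and "fefferman_szego_kernel m a S"
    and "cmod w < 1"
  shows
    "let r = (real m - 1) / (real m + 2);
         t = (1 - (cmod w)\<^sup>2) / (1 - r * (cmod w)\<^sup>2);
         \<alpha> = 2 + r * t + r * t^2;
         \<beta> = 2 - r * t^2;
         A = - (r^2 * t^4) + (3 * r^2 + 2 * r) * t^3 + 2 * r^2 * t^2 - 2;
         B = - 2 * r^2 * t^4 + (r + r^2) * t^3 + 2 * (1 + r) * t - 4;
         C = (1 - t) * (1 - r * t) * (2 - r * t^2);
         D = (- 2 * t^2 * (1 - r)^2 * (2 - r^2 * t^2)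
              - 8 * t * (1 - r) * (1 - t) * (2 - r^3 * t^3)
              - 6 * (1 - t)^2 * (2 - r^4 * t^4))
             / (t^2 * (1 - r)^2 * (2 - r * t^2));
         E = 4 * (1 - t) * (1 - r * t) * (2 - r^2 * t^3)^2
             / (t^2 * (1 - r)^2 * (2 - r * t^2)^2);
         F = - ((1 - r * t)^2 * (2 - r * t^2) / ((1 - r) * t * \<alpha>))
             - 2 * (1 - t) * (1 - r * t)^2 * (2 - r^2 * t^3) / ((1 - r)^2 * t^2 * \<alpha>)
             + (1 - t) * (1 - r * t)^3 * (2 - r * t^2)^2 / ((1 - r)^2 * t^2 * \<alpha>^2)
     in fs_metric S (vector [0, w]) =
          vector [vector [complex_of_real (\<alpha> / (t * (1 + 2 * r))), 0],
                  vector [0, complex_of_real (\<beta> * ((1 - r * t)^2 / (t^2 * (1 - r)^2)))]]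
      \<and> fs_ricci S (vector [0, w]) =
          vector [vector [complex_of_real
                            (- ((2 * A + 4 * \<alpha>) / (t * \<alpha> * (1 + 2 * r)))
                             + B / ((2 * r + 1) * t * (2 - r * t^2))
                             + C / (t * \<alpha> * (1 + 2 * r))), 0],
                  vector [0, complex_of_real (D + E + F)]]"
proof -
  note m = \<open>m \<ge> 1\<close>
  define r where "r = (real m - 1) / (real m + 2)"
  define y where "y = (cmod w)\<^sup>2"
  define t where "t = (1 - y) / (1 - r * y)"
  define \<kappa> where "\<kappa> = (4 * real m + 2) / (3 * real m)"
  define c where "c = kernel_constant m * ((real m + 2) / (3 * real m))"
  have r: "0 \<le> r" "r < 1" using m by (simp_all add: r_def)
  \<comment> \<open>With m expressed through r, every coefficient becomes rational in r and
    t.\<close>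
  have mr: "real m = (1 + 2 * r) / (1 - r)" using m by (simp add: r_def field_simps)
  have y: "0 \<le> y" "y < 1" using \<open>cmod w < 1\<close> by (simp_all add: y_def power_less_one_iff)
  have c: "c > 0" using m kernel_constant_pos [OF m] by (simp add: c_def)
  note t = ratio_coordinates [OF r y, folded t_def]
  \<comment> \<open>The logarithm of c (1 - r u)/(1 - u)^2; the remaining power of 1 - |z|^2 in the
    kernel accounts for \<kappa>.\<close>
  define L1 where "L1 u = ln c + ln (1 - r * u) - 2 * ln (1 - u)" for u
  define L1' where "L1' u = 2 / (1 - u) - r / (1 - r * u)" for u
  define L1'' where "L1'' u = 2 / (1 - u)\<^sup>2 - r\<^sup>2 / (1 - r * u)\<^sup>2" for u
  define M0 where "M0 u = 2 / (1 - u)\<^sup>2 - r / (1 - r * u)\<^sup>2" for u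
  define M1 where "M1 u = 4 / (1 - u) ^ 3 - 2 * r\<^sup>2 / (1 - r * u) ^ 3" for u
  define M2 where "M2 u = 12 / (1 - u) ^ 4 - 6 * r ^ 3 / (1 - r * u) ^ 4" for u
  have ru: "1 - r * u > 0" "1 - u \<le> 1 - r * u" if "0 \<le> u" "u < 1" for u
    using that r mult_right_mono [of r 1 u] by (auto intro: order.strict_trans1)
  interpret g: ellipsoid_potential m \<kappa> L1 L1' L1'' "\<lambda>q. Ln (S q q)"
  proof
    fix u :: real assume u: "0 \<le> u" "u < 1"
    show "(L1 has_real_derivative L1' u) (at u)"
      unfolding L1_def [abs_def] L1'_def using u ru [OF u] by (auto intro!: derivative_eq_intros)
    show "(L1' has_real_derivative L1'' u) (at u)"
      unfolding L1'_def [abs_def] L1''_def using u ru [OF u]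
      by (auto intro!: derivative_eq_intros simp: power2_eq_square)
  next
    fix p assume p: "p \<in> ellipsoid m"
    define u v where "u = scaled_modulus m ((cmod (p $ 1))\<^sup>2) ((cmod (p $ 2))\<^sup>2)" and "v = 1 - (cmod (p $ 1))\<^sup>2"
    have u: "0 \<le> u" "u < 1" and v: "v > 0"
      using scaled_modulus_ellipsoid [OF m p] by (auto simp: u_def v_def)
    have "S p p = of_real (c * (v powr (- \<kappa>) * ((1 - r * u) / (1 - u)\<^sup>2)))"
      using kernel_diagonal [OF m \<open>a > 0\<close> \<open>fefferman_szego_kernel m a S\<close> p]
      by (simp only: c_def \<kappa>_def r_def u_def v_def)
    moreover have "c * (v powr (- \<kappa>) * ((1 - r * u) / (1 - u)\<^sup>2)) > 0"
      using c v u ru [OF u] by simp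
    ultimately have "Ln (S p p) = of_real (ln (c * (v powr (- \<kappa>) * ((1 - r * u) / (1 - u)\<^sup>2))))"
      by (simp only: Ln_of_real)
    also have "ln (c * (v powr (- \<kappa>) * ((1 - r * u) / (1 - u)\<^sup>2))) = - \<kappa> * ln v + L1 u"
      using c v u ru [OF u] by (simp add: ln_mult ln_div ln_powr ln_realpow L1_def)
    finally show "Ln (S p p) = of_real (- \<kappa> * ln (1 - (cmod (p $ 1))\<^sup>2) + L1 (scaled_modulus m ((cmod (p $ 1))\<^sup>2) ((cmod (p $ 2))\<^sup>2)))"
      by (simp only: u_def v_def)
  qed (rule m)
  have metric: "fs_metric S p = (\<chi> i j. wirtinger i (wirtinger_bar j (\<lambda>q. Ln (S q q))) p)" for p
    by (rule fs_metric_def)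
  \<comment> \<open>M is the derivative of u L1'(u) = 2u/(1 - u) - r u/(1 - r u), so each pair of
    terms collapses to one double pole.\<close>
  have gM: "g.M u = M0 u" if u: "0 \<le> u" "u < 1" for u
  proof -
    have 1: "2 / (1 - u) + u * (2 / (1 - u)\<^sup>2) = 2 / (1 - u)\<^sup>2"
      using u by (simp add: power2_eq_square divide_simps)
    have 2: "r / (1 - r * u) + u * (r\<^sup>2 / (1 - r * u)\<^sup>2) = r / (1 - r * u)\<^sup>2"
      using ru [OF u] by (simp add: power2_eq_square divide_simps) (simp add: algebra_simps)
    have "g.M u = (2 / (1 - u) + u * (2 / (1 - u)\<^sup>2)) - (r / (1 - r * u) + u * (r\<^sup>2 / (1 - r * u)\<^sup>2))"
      by (simp add: g.M_def L1'_def L1''_def algebra_simps)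
    then show ?thesis unfolding 1 2 M0_def .
  qed
  \<comment> \<open>Positivity of \<open>M0\<close> and \<open>g.Q\<close> makes the determinant of
    the metric positive, so its complex logarithm is the real one.\<close>
  have M0_pos: "M0 u > 0" if u: "0 \<le> u" "u < 1" for u
  proof -
    have "r / (1 - r * u)\<^sup>2 \<le> 1 / (1 - u)\<^sup>2"
      using u ru [OF u] r by (intro frac_le power_mono) auto
    also have "\<dots> < 2 / (1 - u)\<^sup>2" using u by (simp add: divide_strict_right_mono)
    finally show ?thesis by (simp add: M0_def)
  qed
  have Q_pos: "g.Q u > 0" if u: "0 \<le> u" "u < 1" for u
  proof -
    have "r / (1 - r * u) \<le> 1 / (1 - u)" using u ru [OF u] r by (intro frac_le) auto
    also have "\<dots> \<le> 2 / (1 - u)" using u by (intro divide_right_mono) auto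
    finally have "L1' u \<ge> 0" by (simp add: L1'_def)
    moreover have "\<kappa> > 0" using m by (simp add: \<kappa>_def)
    ultimately show ?thesis using u by (simp add: g.Q_def add_pos_nonneg)
  qed
  \<comment> \<open>The second potential is the logarithm of the determinant; the power -2 - 1/m of
    1 - |z|^2 supplies its constant 2 + 1/m.\<close>
  define L2 where "L2 u = ln (g.Q u) + ln (M0 u)" for u
  define L2' where "L2' u = M0 u / real m / g.Q u + M1 u / M0 u" for u
  define L2'' where "L2'' u = (M1 u / real m * g.Q u - M0 u / real m * (M0 u / real m)) / (g.Q u * g.Q u)
    + (M2 u * M0 u - M1 u * M1 u) / (M0 u * M0 u)" for u
  interpret h: ellipsoid_potential m "2 + 1 / real m" L2 L2' L2'' "\<lambda>q. Ln (det (fs_metric S q))"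
  proof
    fix u :: real assume u: "0 \<le> u" "u < 1"
    have nz: "1 - u \<noteq> 0" "1 - r * u \<noteq> 0" "g.Q u \<noteq> 0" "M0 u \<noteq> 0"
      using u ru [OF u] Q_pos [OF u] M0_pos [OF u] by auto
    have Qd: "(g.Q has_real_derivative M0 u / real m) (at u)"
      using g.Q_derivative [OF u] by (simp add: gM [OF u])
    have M0d: "(M0 has_real_derivative M1 u) (at u)"
    proof -
      have "((\<lambda>u. 2 / (1 - u)\<^sup>2) has_real_derivative 4 / (1 - u) ^ 3) (at u)"
        using DERIV_divide_linear_power [of 1 u 2 2] nz by simp
      moreover have "((\<lambda>u. r / (1 - r * u)\<^sup>2) has_real_derivative 2 * r\<^sup>2 / (1 - r * u) ^ 3) (at u)"
        using DERIV_divide_linear_power [of r u r 2] nz by (simp add: power2_eq_square mult_ac)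
      ultimately show ?thesis
        unfolding M0_def [abs_def] M1_def by (rule DERIV_diff)
    qed
    have M1d: "(M1 has_real_derivative M2 u) (at u)"
    proof -
      have "((\<lambda>u. 4 / (1 - u) ^ 3) has_real_derivative 12 / (1 - u) ^ 4) (at u)"
        using DERIV_divide_linear_power [of 1 u 4 3] nz by simp
      moreover have "((\<lambda>u. 2 * r\<^sup>2 / (1 - r * u) ^ 3) has_real_derivative 6 * r ^ 3 / (1 - r * u) ^ 4) (at u)"
      proof -
        have "2 * r\<^sup>2 * real 3 * r / (1 - r * u) ^ Suc 3 = 6 * r ^ 3 / (1 - r * u) ^ 4"
          by (simp add: power2_eq_square power3_eq_cube)
        then show ?thesis
          using DERIV_divide_linear_power [OF nz(2), of "2 * r\<^sup>2" 3] by (simp only:)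
      qed
      ultimately show ?thesis
        unfolding M1_def [abs_def] M2_def by (rule DERIV_diff)
    qed
    have "((\<lambda>u. ln (g.Q u)) has_real_derivative M0 u / real m / g.Q u) (at u)"
      using DERIV_chain' [OF Qd DERIV_ln_divide [OF Q_pos [OF u]]] by (simp add: mult.commute)
    moreover have "((\<lambda>u. ln (M0 u)) has_real_derivative M1 u / M0 u) (at u)"
      using DERIV_chain' [OF M0d DERIV_ln_divide [OF M0_pos [OF u]]] by (simp add: mult.commute)
    ultimately show "(L2 has_real_derivative L2' u) (at u)"
      unfolding L2_def [abs_def] L2'_def by (rule DERIV_add)
    show "(L2' has_real_derivative L2'' u) (at u)"
      unfolding L2'_def [abs_def] L2''_def
      by (intro DERIV_add DERIV_divide DERIV_cdivide Qd M0d M1d nz)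
  next
    fix p assume p: "p \<in> ellipsoid m"
    define u v where "u = scaled_modulus m ((cmod (p $ 1))\<^sup>2) ((cmod (p $ 2))\<^sup>2)" and "v = 1 - (cmod (p $ 1))\<^sup>2"
    have u: "0 \<le> u" "u < 1" and v: "v > 0"
      using scaled_modulus_ellipsoid [OF m p] by (auto simp: u_def v_def)
    have "det (fs_metric S p) = of_real (v powr (- 2 - 1 / real m) * (g.Q u * M0 u))"
      unfolding metric g.det_hessian_potential [OF p] u_def [symmetric] v_def [symmetric] gM [OF u] ..
    moreover have "v powr (- 2 - 1 / real m) * (g.Q u * M0 u) > 0"
      using v Q_pos [OF u] M0_pos [OF u] by simp
    ultimately have "Ln (det (fs_metric S p)) = of_real (ln (v powr (- 2 - 1 / real m) * (g.Q u * M0 u)))"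
      by (simp only: Ln_of_real)
    also have "ln (v powr (- 2 - 1 / real m) * (g.Q u * M0 u)) = - (2 + 1 / real m) * ln v + L2 u"
      using v Q_pos [OF u] M0_pos [OF u] by (simp add: ln_mult ln_powr L2_def)
    finally show "Ln (det (fs_metric S p)) = of_real (- (2 + 1 / real m) * ln (1 - (cmod (p $ 1))\<^sup>2)
        + L2 (scaled_modulus m ((cmod (p $ 1))\<^sup>2) ((cmod (p $ 2))\<^sup>2)))"
      by (simp only: u_def v_def)
  qed (rule m)
  note coeffs = metric_coefficients [OF mr r t(1,6,3,4,5)]
  have Qy: "g.Q y = (2 + r * t + r * t\<^sup>2) / (t * (1 + 2 * r))"
    unfolding g.Q_def unfolding L1'_def \<kappa>_def by (rule coeffs(1))
  have M0y: "M0 y = (2 - r * t\<^sup>2) * ((1 - r * t)\<^sup>2 / (t\<^sup>2 * (1 - r)\<^sup>2))"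
    using coeffs(2) by (simp only: M0_def)
  have M1y: "M1 y = 2 * (1 - r * t) ^ 3 * (2 - r\<^sup>2 * t ^ 3) / (t ^ 3 * (1 - r) ^ 3)"
    using coeffs(3) by (simp only: M1_def)
  have M2y: "M2 y = 6 * (1 - r * t) ^ 4 * (2 - r ^ 3 * t ^ 4) / (t ^ 4 * (1 - r) ^ 4)"
    using coeffs(4) by (simp only: M2_def)
  note ricci = ricci_from_derivatives [OF mr r t(1,2,6,3) Qy M0y M1y M2y L2'_def L2''_def]
  have 1: "fs_metric S (vector [0, w]) =
      vector [vector [complex_of_real ((2 + r * t + r * t\<^sup>2) / (t * (1 + 2 * r))), 0],
              vector [0, complex_of_real ((2 - r * t\<^sup>2) * ((1 - r * t)\<^sup>2 / (t\<^sup>2 * (1 - r)\<^sup>2)))]]"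
    unfolding metric g.hessian_potential_axis [OF \<open>cmod w < 1\<close>] y_def [symmetric] gM [OF y] Qy M0y ..
  have 2: "fs_ricci S (vector [0, w]) =
      vector [vector [complex_of_real (- (2 + 1 / real m + y * L2' y / real m)), 0],
              vector [0, complex_of_real (- (L2' y + y * L2'' y))]]"
  proof -
    \<comment> \<open>The Ricci form is minus the Hessian of the second potential, so the same axis
      formula applies with \<open>h\<close> in place of \<open>g\<close>.\<close>
    have "fs_ricci S (vector [0, w]) = - (\<chi> i j. wirtinger i (wirtinger_bar j (\<lambda>q. Ln (det (fs_metric S q)))) (vector [0, w]))"
      by (simp add: fs_ricci_def vec_eq_iff)
    also have "\<dots> = - vector [vector [complex_of_real (h.Q y), 0], vector [0, complex_of_real (h.M y)]]"
      by (simp only: h.hessian_potential_axis [OF \<open>cmod w < 1\<close>] y_def)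
    finally show ?thesis
      by (simp add: h.Q_def h.M_def vec_eq_iff forall_2)
  qed
  show ?thesis
    unfolding Let_def r_def [symmetric] y_def [symmetric] t_def [symmetric]
    using 1 2 [unfolded ricci] by (intro conjI)
qed

end
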